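(* Let $\mathcal F(x,y,w,h)=\sum_{m\ge1,n\ge1}K_{m,n}(x,y)w^mh^n$. Then $$\mathcal F(x,y,w,h)=\frac{(1-xy)\big(hw-P(x;w,h)P(y;w,h)\big)}{(1-x)(1-y)\big(1-h-w-P(x;w,h)-P(y;w,h)\big)}.$$
   Context: Let $m,n\ge 1$. $K_{m,n}$ is the complete bipartite graph with vertex set $V=A_m\sqcup B_n$, $A_m=\{a_1,\dots,a_m\}$, $B_n=\{b_1,\dots,b_n\}$, one edge $\{a_i,b_j\}$ for every $i,j$; $a_m$ is the sink. A configuration is $u:V\to\mathbb Z$, $\mathrm{degree}(u)=\sum_cu_c$. $\Delta^{(c)}=d_c e_c-\sum_{c'\text{ adjacent to }c}e_{c'}$ ($d_c$ the graph degree, $e_c$ the indicator of $c$), $\Delta^{(C)}=\sum_{c\in C}\Delta^{(c)}$. Toppling equivalence: difference in the integer span of the $\Delta^{(c)}$; effective: toppling equivalent to a non-negative configuration; $\mathrm{rank}(u)=-1+\min\{\mathrm{degree}(f): f\ge0,\ u-f\text{ not effective}\}$. $u$ is parking if $u_c\ge0$ for $c\ne a_m$ and for every non-empty $C\subseteq V\setminus\{a_m\}$, $u-\Delta^{(C)}$ has a negative value at a vertex other than $a_m$; sorted if $u_{a_1}\le\dots\le u_{a_{m-1}}$ and $u_{b_1}\le\dots\le u_{b_n}$ (no condition at the sink). $K_{m,n}(x,y)=\sum_u x^{(m-1)(n-1)+\mathrm{rank}(u)-\mathrm{degree}(u)}y^{\mathrm{rank}(u)+1}$, summed over all parking sorted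 configurations $u$ on $K_{m,n}$ (all sink values), a formal power series; equivalently $K_{m,n}(x,y)=x^{(m-1)(n-1)}y\,\widetilde K_{m,n}(x^{-1},xy)$ with $\widetilde K_{m,n}(d,r)=\sum_u d^{\mathrm{degree}(u)}r^{\mathrm{rank}(u)}$. A parallelogram polyomino is a non-empty union of unit cells enclosed between two north/east lattice paths with common start and end points meeting only there; area = number of cells, width/height = those of the bounding box. $P(q;w,h)=\sum_{\mathcal P}q^{\mathrm{area}}w^{\mathrm{width}}h^{\mathrm{height}}$ over all parallelogram polyominoes. *)

theory Defs
  imports "HOL-Computational_Algebra.Formal_Power_Series"
begin

datatype vtx = A nat | B nat

definition verts :: "nat \<Rightarrow> nat \<Rightarrow> vtx set" where
  "verts m n = A ` {1..m} \<union> B ` {1..n}"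

definition adj :: "nat \<Rightarrow> nat \<Rightarrow> vtx \<Rightarrow> vtx \<Rightarrow> bool" where
  "adj m n c d \<longleftrightarrow>
     (\<exists>i j. i \<in> {1..m} \<and> j \<in> {1..n} \<and> ((c = A i \<and> d = B j) \<or> (c = B j \<and> d = A i)))"

definition gdeg :: "nat \<Rightarrow> nat \<Rightarrow> vtx \<Rightarrow> int" where
  "gdeg m n c = int (card {d \<in> verts m n. adj m n c d})"

definition sink :: "nat \<Rightarrow> vtx" where
  "sink m = A m"

definition is_conf :: "nat \<Rightarrow> nat \<Rightarrow> (vtx \<Rightarrow> int) \<Rightarrow> bool" where
  "is_conf m n u \<longleftrightarrow> (\<forall>v. v \<notin> verts m n \<longrightarrow> u v = 0)"

definition cdegree :: "nat \<Rightarrow> nat \<Rightarrow> (vtx \<Rightarrow> int) \<Rightarrow> int" where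
  "cdegree m n u = (\<Sum>c\<in>verts m n. u c)"

definition lap :: "nat \<Rightarrow> nat \<Rightarrow> vtx \<Rightarrow> vtx \<Rightarrow> int" where
  "lap m n c = (\<lambda>v. (if v = c then gdeg m n c else 0) - (if adj m n c v then 1 else 0))"

definition lapset :: "nat \<Rightarrow> nat \<Rightarrow> vtx set \<Rightarrow> vtx \<Rightarrow> int" where
  "lapset m n C = (\<lambda>v. \<Sum>c\<in>C. lap m n c v)"

definition toppling_equiv :: "nat \<Rightarrow> nat \<Rightarrow> (vtx \<Rightarrow> int) \<Rightarrow> (vtx \<Rightarrow> int) \<Rightarrow> bool" where
  "toppling_equiv m n u v \<longleftrightarrow>
     (\<exists>z :: vtx \<Rightarrow> int. \<forall>d. u d - v d = (\<Sum>c\<in>verts m n. z c * lap m n c d))"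

definition effective :: "nat \<Rightarrow> nat \<Rightarrow> (vtx \<Rightarrow> int) \<Rightarrow> bool" where
  "effective m n u \<longleftrightarrow>
     (\<exists>w. is_conf m n w \<and> (\<forall>c\<in>verts m n. w c \<ge> 0) \<and> toppling_equiv m n u w)"

definition crank :: "nat \<Rightarrow> nat \<Rightarrow> (vtx \<Rightarrow> int) \<Rightarrow> int" where
  "crank m n u = -1 + (LEAST d :: int. \<exists>f. is_conf m n f \<and> (\<forall>c\<in>verts m n. f c \<ge> 0) \<and>
        \<not> effective m n (\<lambda>v. u v - f v) \<and> cdegree m n f = d)"

definition parking :: "nat \<Rightarrow> nat \<Rightarrow> (vtx \<Rightarrow> int) \<Rightarrow> bool" where
  "parking m n u \<longleftrightarrow>
     (\<forall>c\<in>verts m n - {sink m}. u c \<ge> 0) \<and>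
     (\<forall>C. C \<subseteq> verts m n - {sink m} \<and> C \<noteq> {} \<longrightarrow>
        (\<exists>c\<in>verts m n - {sink m}. u c - lapset m n C c < 0))"

definition sorted_conf :: "nat \<Rightarrow> nat \<Rightarrow> (vtx \<Rightarrow> int) \<Rightarrow> bool" where
  "sorted_conf m n u \<longleftrightarrow>
     (\<forall>i j. 1 \<le> i \<and> i \<le> j \<and> j \<le> m - 1 \<longrightarrow> u (A i) \<le> u (A j)) \<and>
     (\<forall>i j. 1 \<le> i \<and> i \<le> j \<and> j \<le> n \<longrightarrow> u (B i) \<le> u (B j))"

definition Kcoeff :: "nat \<Rightarrow> nat \<Rightarrow> nat \<Rightarrow> nat \<Rightarrow> int" where
  "Kcoeff m n a b = int (card {u. is_conf m n u \<and> parking m n u \<and> sorted_conf m n u \<and>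
      int ((m - 1) * (n - 1)) + crank m n u - cdegree m n u = int a \<and>
      crank m n u + 1 = int b})"

text \<open>North/east lattice paths as bool lists (True = north step, False = east step).\<close>
definition path_pt :: "bool list \<Rightarrow> nat \<Rightarrow> nat \<times> nat" where
  "path_pt p k = (length (filter Not (take k p)), length (filter id (take k p)))"

definition path_verts :: "bool list \<Rightarrow> (nat \<times> nat) set" where
  "path_verts p = path_pt p ` {0..length p}"

text \<open>Height at which the path performs its east step from column i to column i+1.\<close>
fun ehgt :: "bool list \<Rightarrow> nat \<Rightarrow> nat" where
  "ehgt [] i = 0"
| "ehgt (True # p) i = Suc (ehgt p i)"
| "ehgt (False # p) 0 = 0"
| "ehgt (False # p) (Suc i) = ehgt p i"

definition pwidth :: "bool list \<Rightarrow> nat" where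
  "pwidth p = length (filter Not p)"

definition pheight :: "bool list \<Rightarrow> nat" where
  "pheight p = length (filter id p)"

text \<open>A parallelogram polyomino is given by its upper path U (starting north) and lower
  path L (starting east), with common endpoints and no other common vertex.\<close>
definition is_ppoly :: "bool list \<times> bool list \<Rightarrow> bool" where
  "is_ppoly UL \<longleftrightarrow> (case UL of (U, L) \<Rightarrow>
     U \<noteq> [] \<and> L \<noteq> [] \<and> hd U \<and> \<not> hd L \<and>
     pwidth U = pwidth L \<and> pheight U = pheight L \<and>
     path_verts U \<inter> path_verts L = {(0, 0), (pwidth U, pheight U)})"

definition ppoly_cells :: "bool list \<times> bool list \<Rightarrow> (nat \<times> nat) set" where
  "ppoly_cells UL = (case UL of (U, L) \<Rightarrow>
     {(i, j). i < pwidth U \<and> ehgt L i \<le> j \<and> j < ehgt U i})"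

definition ppoly_area :: "bool list \<times> bool list \<Rightarrow> nat" where
  "ppoly_area UL = card (ppoly_cells UL)"

definition Pcoeff :: "nat \<Rightarrow> nat \<Rightarrow> nat \<Rightarrow> int" where
  "Pcoeff a b c = int (card {UL. is_ppoly UL \<and> ppoly_area UL = a \<and>
      pwidth (fst UL) = b \<and> pheight (fst UL) = c})"

text \<open>Z[[x,y,w,h]] realised as nested power series: outermost variable h, then w, then y,
  innermost x.\<close>
type_synonym ps4 = "int fps fps fps fps"

definition mk4 :: "(nat \<Rightarrow> nat \<Rightarrow> nat \<Rightarrow> nat \<Rightarrow> int) \<Rightarrow> ps4" where
  "mk4 c = Abs_fps (\<lambda>d. Abs_fps (\<lambda>cw. Abs_fps (\<lambda>b. Abs_fps (\<lambda>a. c a b cw d))))"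

definition X4 :: ps4 where "X4 = fps_const (fps_const (fps_const fps_X))"
definition Y4 :: ps4 where "Y4 = fps_const (fps_const fps_X)"
definition W4 :: ps4 where "W4 = fps_const fps_X"
definition H4 :: ps4 where "H4 = fps_X"

definition Fser :: ps4 where
  "Fser = mk4 (\<lambda>a b m n. if m \<ge> 1 \<and> n \<ge> 1 then Kcoeff m n a b else 0)"

definition Px :: ps4 where
  "Px = mk4 (\<lambda>a b cw d. if b = 0 then Pcoeff a cw d else 0)"
definition Py :: ps4 where
  "Py = mk4 (\<lambda>a b cw d. if a = 0 then Pcoeff b cw d else 0)"

end

theory Submission
  imports Defs "HOL-Library.Product_Plus"
begin

text \<open>For a configuration \<open>u\<close> let \<open>f t\<close> be the sum of the \<open>(u (A i) + t) div n\<close> and \<open>g s\<close> the sum of the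
  \<open>(u (B j) + s) div m\<close>; \<open>f t\<close> is the largest total number of topplings on the \<open>A\<close>-side that \<open>t\<close>
  topplings on the \<open>B\<close>-side allow, so \<open>u\<close> is effective iff \<open>t \<le> g (f t)\<close> for some \<open>t\<close>. With the
  generalised inverse \<open>psi\<close> of \<open>g\<close> this reads \<open>psi t < f t\<close>. Removing a chip changes \<open>f\<close> or
  \<open>psi\<close> by one on one residue class mod \<open>n\<close>, so \<open>rank u + 1\<close> is the sum over a period of the positive
  part of \<open>f - psi\<close>; genus + rank - degree is that of \<open>psi - f\<close>.

  Omitting the sink from \<open>f\<close>, a parking sorted \<open>u\<close> becomes a pair of quasi-periodic functions
  \<open>(al, ps)\<close> and the sink value; translating by the sink value gives all pairs with \<open>al 0 = 0\<close>
  exactly once, a cycle lemma. A further translation by one step multiplies the weight of a pair by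
  \<open>y\<close> or divides it by \<open>x\<close>. Telescoping, \<open>(1 - x)(1 - y)F / (1 - xy)\<close> becomes the difference of the
  generating functions of two finite families of pairs, which are pairs of lattice paths with common
  ends. Cutting these wherever they meet yields common steps and parallelogram polyominoes.\<close>

section \<open>Generating functions of weighted sets\<close>

text \<open>What drives the argument is the gap \<open>ps t - al t\<close>. Leaving out the sink
  lowers the increment of \<open>al\<close> per period from \<open>m\<close> to
  \<open>m - 1\<close>, so the gap grows by exactly 1 per period: it is negative far to the left and
  non-negative far to the right. Hence it has a last negative point, and the position of that point
  encodes the sink value. For the same reason, sliding the window \<open>0, ..., n - 1\<close> one
  step to the left replaces one gap by that gap minus 1, so exactly one of the two positive parts
  changes, by exactly 1. The obstacle is that for fixed \<open>m\<close> and \<open>n\<close> there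
  are infinitely many pairs, and sliding has infinite orbits. Telescoping along them leaves only
  pairs for which a comparison of the two functions turns out oppositely at the two ends of the
  window. In each surviving family one function is then outermost at both ends of a period;
  monotonicity traps the other one in the same interval, and a monotone function with bounded values
  on a period is a lattice path.\<close>

text \<open>The exponents of \<open>x\<close>, \<open>y\<close>, \<open>w\<close>, \<open>h\<close>, in this order.\<close>
type_synonym weight = "nat \<times> nat \<times> nat \<times> nat"

definition gf :: "('o \<Rightarrow> weight) \<Rightarrow> 'o set \<Rightarrow> ps4" where
  "gf wt S = mk4 (\<lambda>a b c d. int (card {s \<in> S. wt s = (a, b, c, d)}))"

text \<open>The cardinality of an infinite set is 0, so unions and products of sets match sums and
  products of series only when the fibres are finite.\<close>

definition finite_fibers :: "('o \<Rightarrow> weight) \<Rightarrow> 'o set \<Rightarrow> bool" where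
  "finite_fibers wt S \<longleftrightarrow> (\<forall>v. finite {s \<in> S. wt s = v})"

lemma mk4_nth [simp]: "fps_nth (fps_nth (fps_nth (fps_nth (mk4 f) d) c) b) a = f a b c d"
  by (simp add: mk4_def)

lemma ps4_eqI:
  fixes F G :: ps4
  assumes "\<And>a b c d. fps_nth (fps_nth (fps_nth (fps_nth F d) c) b) a
      = fps_nth (fps_nth (fps_nth (fps_nth G d) c) b) a"
  shows "F = G"
  using assms by (simp add: fps_eq_iff)

lemma gf_nth [simp]:
  "fps_nth (fps_nth (fps_nth (fps_nth (gf wt S) d) c) b) a = int (card {s \<in> S. wt s = (a, b, c, d)})"
  by (simp add: gf_def)

lemma finite_fibers_subset:
  "finite_fibers wt S \<Longrightarrow> T \<subseteq> S \<Longrightarrow> finite_fibers wt T"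
  unfolding finite_fibers_def by (blast intro: finite_subset[rotated])

lemma finite_fibersD: "finite_fibers wt S \<Longrightarrow> finite {s \<in> S. wt s = v}"
  unfolding finite_fibers_def by blast

lemma gf_bij_betw:
  assumes "bij_betw f S T" and "\<And>s. s \<in> S \<Longrightarrow> wt' (f s) = wt s"
  shows "gf wt S = gf wt' T"
proof (rule ps4_eqI, simp, rule bij_betw_same_card)
  fix a b c d
  show "bij_betw f {s \<in> S. wt s = (a, b, c, d)} {s \<in> T. wt' s = (a, b, c, d)}"
    using assms unfolding bij_betw_def inj_on_def by fastforce
qed

lemma gf_Un:
  assumes "finite_fibers wt S" "finite_fibers wt T" "S \<inter> T = {}"
  shows "gf wt (S \<union> T) = gf wt S + gf wt T"
proof (rule ps4_eqI)
  fix a b c d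
  have "{s \<in> S \<union> T. wt s = (a, b, c, d)} =
      {s \<in> S. wt s = (a, b, c, d)} \<union> {s \<in> T. wt s = (a, b, c, d)}" by auto
  then show "fps_nth (fps_nth (fps_nth (fps_nth (gf wt (S \<union> T)) d) c) b) a =
      fps_nth (fps_nth (fps_nth (fps_nth (gf wt S + gf wt T) d) c) b) a"
    using assms by (simp add: finite_fibersD) (subst card_Un_disjoint, auto simp: finite_fibersD)
qed

lemma ps4_mult_nth:
  fixes F G :: ps4
  shows "fps_nth (fps_nth (fps_nth (fps_nth (F * G) d) c) b) a =
    (\<Sum>i\<le>d. \<Sum>j\<le>c. \<Sum>k\<le>b. \<Sum>l\<le>a.
       fps_nth (fps_nth (fps_nth (fps_nth F i) j) k) l *
       fps_nth (fps_nth (fps_nth (fps_nth G (d - i)) (c - j)) (b - k)) (a - l))"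
  by (simp add: fps_mult_nth fps_sum_nth atMost_atLeast0)

lemma gf_Times:
  assumes S: "finite_fibers wt S" and T: "finite_fibers wt' T"
  shows "gf (\<lambda>(s, t). wt s + wt' t) (S \<times> T) = gf wt S * gf wt' T"
proof (rule ps4_eqI)
  fix a b c d :: nat
  let ?I = "{..d} \<times> {..c} \<times> {..b} \<times> {..a}"
  let ?U = "\<lambda>(i, j, k, l). {s \<in> S. wt s = (l, k, j, i)} \<times>
      {t \<in> T. wt' t = (a - l, b - k, c - j, d - i)}"
  have eq: "{z \<in> S \<times> T. (case z of (s, t) \<Rightarrow> wt s + wt' t) = (a, b, c, d)} = (\<Union>v\<in>?I. ?U v)"
  proof (intro set_eqI iffI)
    fix z assume "z \<in> {z \<in> S \<times> T. (case z of (s, t) \<Rightarrow> wt s + wt' t) = (a, b, c, d)}"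
    then obtain s t where z: "z = (s, t)" "s \<in> S" "t \<in> T" "wt s + wt' t = (a, b, c, d)" by auto
    obtain l k j i where ws: "wt s = (l, k, j, i)" by (metis prod.collapse)
    obtain l' k' j' i' where wt: "wt' t = (l', k', j', i')" by (metis prod.collapse)
    from z(4) ws wt have "a = l + l'" "b = k + k'" "c = j + j'" "d = i + i'" by auto
    then show "z \<in> (\<Union>v\<in>?I. ?U v)"
      using z ws wt by (intro UN_I[of "(i, j, k, l)"]) auto
  next
    fix z assume "z \<in> (\<Union>v\<in>?I. ?U v)"
    then show "z \<in> {z \<in> S \<times> T. (case z of (s, t) \<Rightarrow> wt s + wt' t) = (a, b, c, d)}" by auto
  qed
  have "card (\<Union>v\<in>?I. ?U v) = (\<Sum>v\<in>?I. card (?U v))"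
  proof (rule card_UN_disjoint)
    show "\<forall>v\<in>?I. finite (?U v)"
      using S T by (auto simp: finite_fibersD)
  qed auto
  also have "\<dots> = (\<Sum>i\<le>d. \<Sum>j\<le>c. \<Sum>k\<le>b. \<Sum>l\<le>a.
       card {s \<in> S. wt s = (l, k, j, i)} * card {t \<in> T. wt' t = (a - l, b - k, c - j, d - i)})"
    by (simp add: sum.cartesian_product split_def card_cartesian_product)
  finally show "fps_nth (fps_nth (fps_nth (fps_nth (gf (\<lambda>(s, t). wt s + wt' t) (S \<times> T)) d) c) b) a =
      fps_nth (fps_nth (fps_nth (fps_nth (gf wt S * gf wt' T) d) c) b) a"
    by (simp add: ps4_mult_nth eq)
qed

lemma finite_fibers_finite: "finite S \<Longrightarrow> finite_fibers wt S"
  by (simp add: finite_fibers_def)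

lemma gf_singleton_zero:
  assumes "wt s = 0" shows "gf wt {s} = 1"
proof (rule ps4_eqI)
  fix a b c d
  have "{x \<in> {s}. wt x = (a, b, c, d)} = (if a = 0 \<and> b = 0 \<and> c = 0 \<and> d = 0 then {s} else {})"
    using assms by (auto simp: zero_prod_def)
  then show "fps_nth (fps_nth (fps_nth (fps_nth (gf wt {s}) d) c) b) a =
      fps_nth (fps_nth (fps_nth (fps_nth 1 d) c) b) a"
    by (simp only: gf_nth) auto
qed

lemma gf_singleton_aux:
  assumes "wt s = (e1, e2, e3, e4)"
  shows "fps_nth (fps_nth (fps_nth (fps_nth (gf wt {s}) d) c) b) a =
    (if a = e1 \<and> b = e2 \<and> c = e3 \<and> d = e4 then 1 else 0)"
proof -
  have "{x \<in> {s}. wt x = (a, b, c, d)} =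
      (if a = e1 \<and> b = e2 \<and> c = e3 \<and> d = e4 then {s} else {})"
    using assms by auto
  then show ?thesis by (simp only: gf_nth) auto
qed

lemma gf_singleton_X: "wt s = (1, 0, 0, 0) \<Longrightarrow> gf wt {s} = X4"
  by (rule ps4_eqI) (simp add: gf_singleton_aux X4_def del: gf_nth)

lemma gf_singleton_Y: "wt s = (0, 1, 0, 0) \<Longrightarrow> gf wt {s} = Y4"
  by (rule ps4_eqI) (simp add: gf_singleton_aux Y4_def del: gf_nth)

lemma gf_singleton_W: "wt s = (0, 0, 1, 0) \<Longrightarrow> gf wt {s} = W4"
  by (rule ps4_eqI) (simp add: gf_singleton_aux W4_def del: gf_nth)

lemma gf_singleton_H: "wt s = (0, 0, 0, 1) \<Longrightarrow> gf wt {s} = H4"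
  by (rule ps4_eqI) (simp add: gf_singleton_aux H4_def del: gf_nth)

text \<open>\<open>gf (\<lambda>_. v) {()}\<close> is the monomial with exponent \<open>v\<close>,
  written as the series of a one-point set so that \<open>gf_Times\<close> applies.\<close>

lemma gf_shift:
  assumes S: "finite_fibers wt S" and "bij_betw f S T"
    and "\<And>s. s \<in> S \<Longrightarrow> wt' (f s) = v + wt s"
  shows "gf wt' T = gf (\<lambda>_. v) {()} * gf wt S"
proof -
  have "gf (\<lambda>_. v) {()} * gf wt S = gf (\<lambda>(s, t). v + wt t) ({()} \<times> S)"
    by (rule gf_Times[symmetric]) (simp_all add: S finite_fibers_finite)
  also have "\<dots> = gf wt' T"
  proof (rule gf_bij_betw[where f = "\<lambda>(_, s). f s"])
    show "bij_betw (\<lambda>(_, s). f s) ({()} \<times> S) T"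
      using assms(2) unfolding bij_betw_def inj_on_def by (auto simp: image_iff)
  qed (use assms(3) in auto)
  finally show ?thesis ..
qed

section \<open>Balanced pairs of words\<close>

lemma pwidth_simps [simp]: "pwidth [] = 0" "pwidth (True # p) = pwidth p"
    "pwidth (False # p) = Suc (pwidth p)" "pwidth (p @ q) = pwidth p + pwidth q"
  by (simp_all add: pwidth_def)

lemma pheight_simps [simp]: "pheight [] = 0" "pheight (True # p) = Suc (pheight p)"
    "pheight (False # p) = pheight p" "pheight (p @ q) = pheight p + pheight q"
  by (simp_all add: pheight_def)

lemma pwidth_pheight: "pwidth p + pheight p = length p"
  by (induction p) (auto split: bool.splits simp: pwidth_def pheight_def)

lemma path_pt_eq: "path_pt p k = (pwidth (take k p), pheight (take k p))"
  by (simp add: path_pt_def pwidth_def pheight_def)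

lemma ehgt_append:
  "ehgt (p @ q) i = (if i < pwidth p then ehgt p i else pheight p + ehgt q (i - pwidth p))"
proof (induction p i rule: ehgt.induct)
  case (4 p i) then show ?case by simp
qed auto

lemma ehgt_le_pheight: "i < pwidth p \<Longrightarrow> ehgt p i \<le> pheight p"
  by (induction p i rule: ehgt.induct) auto

text \<open>If the east step out of column \<open>i\<close> has height at least \<open>j\<close>,
  the first \<open>i + j\<close> letters contain at most \<open>i\<close> east steps, hence at least
  \<open>j\<close> north steps; otherwise they contain more than \<open>i\<close> east steps. Column
  heights thus become counts over prefixes.\<close>

lemma ehgt_ge_iff: "i < pwidth p \<Longrightarrow> j \<le> ehgt p i \<longleftrightarrow> j \<le> pheight (take (i + j) p)"
proof (induction p i arbitrary: j rule: ehgt.induct)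
  case (2 p i)
  show ?case using 2 by (cases j) auto
next
  case (3 p)
  show ?case by (cases j) (use pwidth_pheight[of "take (j - 1) p"] in auto)
next
  case (4 p i)
  then show ?case by simp
qed auto

definition balanced :: "(bool list \<times> bool list) set" where
  "balanced = {(p, q). pwidth p = pwidth q \<and> pheight p = pheight q}"

text \<open>A vertex common to two paths from the origin is reached after equally many steps in
  both, so prefixes of equal length suffice: these are the pairs that meet only at their two
  ends.\<close>

definition primes :: "(bool list \<times> bool list) set" where
  "primes = {(p, q) \<in> balanced. p \<noteq> [] \<and>
     (\<forall>k. 0 < k \<and> k < length p \<longrightarrow> (take k p, take k q) \<notin> balanced)}"

text \<open>Natural subtraction truncates, so the first two entries are the areas where
  \<open>q\<close> runs above \<open>p\<close> and where \<open>p\<close> runs above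
  \<open>q\<close>. The width is the exponent of \<open>h\<close> because it will be the period
  \<open>n\<close>; the height will be \<open>m\<close> up to a surplus.\<close>

definition wwt :: "bool list \<times> bool list \<Rightarrow> weight" where
  "wwt = (\<lambda>(p, q). (\<Sum>i<pwidth p. ehgt q i - ehgt p i, \<Sum>i<pwidth p. ehgt p i - ehgt q i,
     pheight p, pwidth p))"

lemma balanced_length: "(p, q) \<in> balanced \<Longrightarrow> length p = length q"
  using pwidth_pheight[of p] pwidth_pheight[of q] by (simp add: balanced_def)

lemma balanced_append: "(p, q) \<in> balanced \<Longrightarrow> (p @ p', q @ q') \<in> balanced \<longleftrightarrow> (p', q') \<in> balanced"
  by (auto simp: balanced_def)

lemma finite_fibers_balanced: "finite_fibers wwt balanced"
  unfolding finite_fibers_def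
proof
  fix v :: weight
  obtain a b c d where v: "v = (a, b, c, d)" by (metis prod.collapse)
  have "{s \<in> balanced. wwt s = v} \<subseteq>
      {p. set p \<subseteq> UNIV \<and> length p = d + c} \<times> {p. set p \<subseteq> UNIV \<and> length p = d + c}"
    using pwidth_pheight by (auto simp: v wwt_def balanced_def) metis+
  then show "finite {s \<in> balanced. wwt s = v}"
    by (rule finite_subset) (intro finite_cartesian_product finite_lists_length_eq, simp_all)
qed

lemma sum_split_add:
  fixes f :: "nat \<Rightarrow> nat"
  shows "(\<Sum>i<m + n. f i) = (\<Sum>i<m. f i) + (\<Sum>i<n. f (m + i))"
  by (induction n) auto

lemma wwt_append:
  assumes "(p, q) \<in> balanced" "(p', q') \<in> balanced"
  shows "wwt (p @ p', q @ q') = wwt (p, q) + wwt (p', q')"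
  using assms by (simp add: wwt_def balanced_def sum_split_add ehgt_append)

text \<open>Unique factorisation: cut at the first return of the two paths to a common vertex. Of
  two different first factors the shorter one would be a balanced proper prefix of the longer
  one.\<close>

lemma bij_betw_primes:
  "bij_betw (\<lambda>((p, q), (p', q')). (p @ p', q @ q')) (primes \<times> balanced) {(p, q) \<in> balanced. p \<noteq> []}"
proof (rule bij_betw_imageI)
  show "inj_on (\<lambda>((p, q), (p', q')). (p @ p', q @ q')) (primes \<times> balanced)"
  proof (rule inj_onI, clarsimp)
    fix p1 q1 p1' q1' p2 q2 p2' q2'
    assume A: "(p1, q1) \<in> primes" "(p2, q2) \<in> primes"
      "p1 @ p1' = p2 @ p2'" "q1 @ q1' = q2 @ q2'"
    have len: "length p1 = length q1" "length p2 = length q2"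
      using A by (auto simp: primes_def dest: balanced_length)
    have *: "\<not> length r1 < length r2" if "(r1, s1) \<in> primes" "(r2, s2) \<in> primes"
      "r1 @ r1' = r2 @ r2'" "s1 @ s1' = s2 @ s2'" "length r1 = length s1" "length r2 = length s2"
      for r1 s1 r1' s1' r2 s2 r2' s2' :: "bool list"
    proof
      assume l: "length r1 < length r2"
      have "take (length r1) r2 = r1" "take (length r1) s2 = s1"
        using that l by (auto simp: append_eq_append_conv_if)
      moreover have "(r1, s1) \<in> balanced" "0 < length r1"
        using that(1) by (auto simp: primes_def)
      moreover have "0 < k \<Longrightarrow> k < length r2 \<Longrightarrow> (take k r2, take k s2) \<notin> balanced" for k
        using that(2) by (auto simp: primes_def)
      ultimately show False using l by metis
    qed
    have "length p1 = length p2"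
      using *[OF A len] *[OF A(2,1) A(3,4)[symmetric] len(2,1)] by simp
    then show "p1 = p2 \<and> q1 = q2 \<and> p1' = p2' \<and> q1' = q2'"
      using A len by auto
  qed
  show "(\<lambda>((p, q), (p', q')). (p @ p', q @ q')) ` (primes \<times> balanced) = {(p, q) \<in> balanced. p \<noteq> []}"
  proof (intro set_eqI iffI)
    fix z assume "z \<in> (\<lambda>((p, q), (p', q')). (p @ p', q @ q')) ` (primes \<times> balanced)"
    then show "z \<in> {(p, q) \<in> balanced. p \<noteq> []}"
      by (auto simp: primes_def balanced_append)
  next
    fix z assume "z \<in> {(p, q) \<in> balanced. p \<noteq> []}"
    then obtain p q where z: "z = (p, q)" "(p, q) \<in> balanced" "p \<noteq> []" by auto
    define P where "P = (\<lambda>k. 0 < k \<and> k \<le> length p \<and> (take k p, take k q) \<in> balanced)"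
    define k where "k = (LEAST k. P k)"
    have "P (length p)" using z balanced_length[OF z(2)] by (auto simp: P_def)
    then have k: "P k" "\<And>j. j < k \<Longrightarrow> \<not> P j"
      unfolding k_def by (auto intro: LeastI dest: not_less_Least)
    have "(take j (take k p), take j (take k q)) \<notin> balanced" if "0 < j" "j < length (take k p)" for j
      using k(2)[of j] k(1) that by (simp add: P_def)
    then have "(take k p, take k q) \<in> primes"
      unfolding primes_def using k(1) z(3) by (auto simp: P_def)
    moreover have "(drop k p, drop k q) \<in> balanced"
      using balanced_append[of "take k p" "take k q" "drop k p" "drop k q"] k(1) z(2)
      by (simp add: P_def)
    ultimately show "z \<in> (\<lambda>((p, q), (p', q')). (p @ p', q @ q')) ` (primes \<times> balanced)"
      by (intro image_eqI[of _ _ "((take k p, take k q), (drop k p, drop k q))"]) (auto simp: z(1))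
  qed
qed

section \<open>Balanced pairs with conditions on the first and last letters\<close>

definition words ::
    "(bool \<Rightarrow> bool \<Rightarrow> bool) \<Rightarrow> (bool \<Rightarrow> bool \<Rightarrow> bool) \<Rightarrow> (bool list \<times> bool list) set" where
  "words H R = {(p, q) \<in> balanced. p \<noteq> [] \<and> H (hd p) (hd q) \<and> R (last p) (last q)}"

definition prime_words ::
    "(bool \<Rightarrow> bool \<Rightarrow> bool) \<Rightarrow> (bool \<Rightarrow> bool \<Rightarrow> bool) \<Rightarrow> (bool list \<times> bool list) set" where
  "prime_words H R = words H R \<inter> primes"

abbreviation "any \<equiv> (\<lambda>_ _. True)"

lemma words_balanced: "words H R \<subseteq> balanced"
  by (auto simp: words_def)

text \<open>A pair is either prime or a prime followed by a non-empty rest. In the second case the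
  prime carries the condition on the first letters and the rest carries the one on the last
  letters.\<close>

lemma gf_words:
  "gf wwt (words H R) = gf wwt (prime_words H R) + gf wwt (prime_words H any) * gf wwt (words any R)"
proof -
  let ?f = "\<lambda>((p, q), (p', q')). (p @ p', q @ q') :: bool list \<times> bool list"
  let ?X = "prime_words H any \<times> words any R"
  have fin: "finite_fibers wwt (words H R)" for H R
    using finite_fibers_balanced words_balanced by (rule finite_fibers_subset)
  have finp: "finite_fibers wwt (prime_words H R)" for H R
    using fin by (rule finite_fibers_subset) (auto simp: prime_words_def)
  have sub: "?X \<subseteq> primes \<times> balanced" by (auto simp: prime_words_def words_def)
  have inj: "inj_on ?f (primes \<times> balanced)"
    using bij_betw_primes by (rule bij_betw_imp_inj_on)
  have ne: "q \<noteq> []" if "(p, q) \<in> balanced" "p \<noteq> []" for p q :: "bool list"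
    using balanced_length[OF that(1)] that(2) by auto
  have "gf wwt (words H R) = gf wwt (prime_words H R \<union> ?f ` ?X)"
  proof (rule arg_cong[where f = "gf wwt"], intro set_eqI iffI)
    fix z assume z: "z \<in> words H R"
    then have "z \<in> ?f ` (primes \<times> balanced)"
      using bij_betw_primes by (auto simp: words_def bij_betw_def)
    then obtain p q p' q' where pq: "z = (p @ p', q @ q')" "(p, q) \<in> primes" "(p', q') \<in> balanced"
      by auto
    have b: "(p, q) \<in> balanced" "p \<noteq> []" using pq(2) by (auto simp: primes_def)
    note n = ne[OF b]
    show "z \<in> prime_words H R \<union> ?f ` ?X"
    proof (cases "p' = []")
      case True
      then have "q' = []" using balanced_length[OF pq(3)] by simp
      with True z pq show ?thesis by (auto simp: prime_words_def)
    next
      case False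
      with ne[OF pq(3)] have "((p, q), (p', q')) \<in> ?X"
        using z pq b n by (auto simp: prime_words_def words_def)
      then show ?thesis using pq(1) by (intro UnI2 image_eqI) auto
    qed
  next
    fix z assume "z \<in> prime_words H R \<union> ?f ` ?X"
    then show "z \<in> words H R"
    proof
      assume "z \<in> ?f ` ?X"
      then obtain p q p' q' where pq: "z = (p @ p', q @ q')" "(p, q) \<in> prime_words H any"
          "(p', q') \<in> words any R"
        by auto
      then show ?thesis
        using ne[of p q] ne[of p' q'] by (auto simp: prime_words_def words_def balanced_append)
    qed (simp add: prime_words_def)
  qed
  also have "\<dots> = gf wwt (prime_words H R) + gf wwt (?f ` ?X)"
  proof (rule gf_Un)
    show "finite_fibers wwt (?f ` ?X)"
      using finite_fibers_balanced
      by (rule finite_fibers_subset) (auto simp: prime_words_def words_def balanced_append)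
    show "prime_words H R \<inter> ?f ` ?X = {}"
    proof (rule ccontr)
      assume "prime_words H R \<inter> ?f ` ?X \<noteq> {}"
      then obtain p q p' q' where pq: "(p @ p', q @ q') \<in> primes" "(p, q) \<in> primes"
          "(p', q') \<in> balanced" "p' \<noteq> []"
        by (auto simp: prime_words_def words_def)
      then have l: "length q = length p" "(p, q) \<in> balanced" "p \<noteq> []"
        by (auto simp: primes_def balanced_length)
      have "0 < k \<Longrightarrow> k < length (p @ p') \<Longrightarrow> (take k (p @ p'), take k (q @ q')) \<notin> balanced" for k
        using pq(1) by (auto simp: primes_def)
      from this[of "length p"] show False using l pq(4) by simp
    qed
  qed (rule finp)
  also have "gf wwt (?f ` ?X) = gf (\<lambda>(s, t). wwt s + wwt t) ?X"
  proof (rule gf_bij_betw[symmetric])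
    show "bij_betw ?f ?X (?f ` ?X)"
      using inj_on_subset[OF inj sub] by (simp add: bij_betw_def)
  qed (use sub in \<open>auto simp: wwt_append primes_def\<close>)
  also have "\<dots> = gf wwt (prime_words H any) * gf wwt (words any R)"
    by (rule gf_Times) (rule fin finp)+
  finally show ?thesis .
qed

section \<open>Polyominoes as prime pairs\<close>

lemma path_pt_eq_iff:
  assumes "k \<le> length p" "j \<le> length q"
  shows "path_pt p k = path_pt q j \<longleftrightarrow> k = j \<and> (take k p, take k q) \<in> balanced"
proof -
  have "pwidth (take k p) + pheight (take k p) = k" "pwidth (take j q) + pheight (take j q) = j"
    using assms by (simp_all add: pwidth_pheight)
  then show ?thesis by (auto simp: path_pt_eq balanced_def)
qed

text \<open>The common vertices are the images of those \<open>k\<close> at which the prefixes are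
  balanced. The coordinates of \<open>path_pt U k\<close> add up to \<open>k\<close>, so distinct
  \<open>k\<close> give distinct vertices, and meeting only at the ends leaves only \<open>0\<close>
  and \<open>length U\<close>.\<close>

lemma is_ppoly_iff: "is_ppoly (U, L) \<longleftrightarrow> (U, L) \<in> primes \<and> hd U \<and> \<not> hd L"
proof (cases "(U, L) \<in> balanced \<and> U \<noteq> [] \<and> hd U \<and> \<not> hd L")
  case False
  then show ?thesis by (auto simp: is_ppoly_def primes_def balanced_def)
next
  case True
  then have len: "length L = length U" and L: "L \<noteq> []"
    using balanced_length[of U L] by auto
  let ?I = "path_verts U \<inter> path_verts L"
  have ends: "path_pt U 0 = (0, 0)" "path_pt L 0 = (0, 0)"
    "path_pt U (length U) = (pwidth U, pheight U)" "path_pt L (length L) = (pwidth U, pheight U)"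
    using True by (auto simp: path_pt_eq balanced_def)
  have sub: "{(0, 0), (pwidth U, pheight U)} \<subseteq> ?I"
  proof -
    have "path_pt U 0 \<in> path_verts U" "path_pt L 0 \<in> path_verts L"
      "path_pt U (length U) \<in> path_verts U" "path_pt L (length L) \<in> path_verts L"
      by (simp_all add: path_verts_def)
    then show ?thesis by (simp add: ends)
  qed
  have I: "?I = path_pt U ` {k. k \<le> length U \<and> (take k U, take k L) \<in> balanced}"
  proof (intro set_eqI iffI)
    fix z assume "z \<in> ?I"
    then have "z \<in> path_verts U" "z \<in> path_verts L" by auto
    then obtain k j where "z = path_pt U k" "k \<le> length U" "z = path_pt L j" "j \<le> length L"
      unfolding path_verts_def by (metis (no_types, lifting) atLeastAtMost_iff imageE)
    then show "z \<in> path_pt U ` {k. k \<le> length U \<and> (take k U, take k L) \<in> balanced}"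
      using path_pt_eq_iff[of k U j L] by auto
  next
    fix z assume "z \<in> path_pt U ` {k. k \<le> length U \<and> (take k U, take k L) \<in> balanced}"
    then obtain k where "z = path_pt U k" "k \<le> length U" "(take k U, take k L) \<in> balanced"
      by auto
    moreover from this have "z = path_pt L k"
      using path_pt_eq_iff[of k U k L] len by simp
    ultimately show "z \<in> ?I"
      using len unfolding path_verts_def by (metis IntI atLeastAtMost_iff imageI zero_le)
  qed
  have eq: "path_pt U k = (0, 0) \<longleftrightarrow> k = 0" "path_pt U k = (pwidth U, pheight U) \<longleftrightarrow> k = length U"
    if "k \<le> length U" for k
    using pwidth_pheight[of "take k U"] pwidth_pheight[of U] that by (auto simp: path_pt_eq)
  have "?I = {(0, 0), (pwidth U, pheight U)} \<longleftrightarrow>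
      (\<forall>k. k \<le> length U \<and> (take k U, take k L) \<in> balanced \<longrightarrow> k = 0 \<or> k = length U)"
  proof
    assume *: "?I = {(0, 0), (pwidth U, pheight U)}"
    show "\<forall>k. k \<le> length U \<and> (take k U, take k L) \<in> balanced \<longrightarrow> k = 0 \<or> k = length U"
    proof (intro allI impI)
      fix k assume k: "k \<le> length U \<and> (take k U, take k L) \<in> balanced"
      then have "path_pt U k \<in> ?I" unfolding I by blast
      then show "k = 0 \<or> k = length U" using eq[of k] k unfolding * by auto
    qed
  next
    assume "\<forall>k. k \<le> length U \<and> (take k U, take k L) \<in> balanced \<longrightarrow> k = 0 \<or> k = length U"
    then have "?I \<subseteq> {(0, 0), (pwidth U, pheight U)}"
      using ends unfolding I by auto
    with sub show "?I = {(0, 0), (pwidth U, pheight U)}" by (rule subset_antisym[rotated])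
  qed
  also have "\<dots> \<longleftrightarrow> (U, L) \<in> primes"
  proof -
    have "(U, L) \<in> primes \<longleftrightarrow> (\<forall>k. 0 < k \<and> k < length U \<longrightarrow> (take k U, take k L) \<notin> balanced)"
      using True by (simp add: primes_def)
    then show ?thesis by (metis nat_less_le neq0_conv)
  qed
  finally show ?thesis using True L by (auto simp: is_ppoly_def balanced_def)
qed

lemma pheight_take_Suc: "k < length p \<Longrightarrow> pheight (take (Suc k) p) = pheight (take k p) + (if p ! k then 1 else 0)"
  by (simp add: take_Suc_conv_app_nth pheight_def)

lemma balanced_take_iff:
  assumes "length p = length q"
  shows "(take k p, take k q) \<in> balanced \<longleftrightarrow> pheight (take k p) = pheight (take k q)"
  using pwidth_pheight[of "take k p"] pwidth_pheight[of "take k q"] assms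
  by (auto simp: balanced_def)

text \<open>The difference of the heights changes by at most one in each step, so it cannot change sign
  without vanishing.\<close>
lemma prime_above:
  assumes "(U, L) \<in> primes" "hd U" "\<not> hd L" "0 < k" "k < length U"
  shows "pheight (take k L) < pheight (take k U)"
  using assms(4,5)
proof (induction k)
  case (Suc k)
  have len: "length L = length U" using assms(1) balanced_length[of U L] by (simp add: primes_def)
  have ne: "pheight (take (Suc k) L) \<noteq> pheight (take (Suc k) U)"
    using assms(1) Suc.prems len balanced_take_iff[of U L "Suc k"] by (auto simp: primes_def)
  show ?case
  proof (cases "k = 0")
    case True
    have "U ! 0" "\<not> L ! 0" using assms(2,3) Suc.prems len by (cases U; cases L; auto)+
    with True Suc.prems len show ?thesis
      using pheight_take_Suc[of 0 U] pheight_take_Suc[of 0 L] by (cases "U = []") simp_all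
  next
    case False
    then have "pheight (take k L) < pheight (take k U)" using Suc by simp
    with ne Suc.prems len show ?thesis by (auto simp: pheight_take_Suc split: if_splits)
  qed
qed simp

text \<open>Equal first letters already lead to a common vertex, so such a prime is a single common
  step.\<close>

lemma prime_hd_eq:
  assumes "(p, q) \<in> primes" "hd p = hd q"
  shows "p = [hd p]" "q = [hd p]"
proof -
  have len: "length p = length q" "p \<noteq> []"
    using assms(1) by (auto simp: primes_def balanced_length)
  then obtain a p' q' where p: "p = a # p'" "q = a # q'"
    using assms(2) by (cases p; cases q) auto
  have "(take 1 p, take 1 q) \<in> balanced" by (simp add: p balanced_def)
  then have "\<not> 1 < length p" using assms(1) by (auto simp: primes_def)
  with len p show "p = [hd p]" "q = [hd p]" by auto
qed

lemma ppoly_length: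
  assumes "is_ppoly (U, L)" shows "length U = length L" "1 < length U"
proof -
  have b: "(U, L) \<in> balanced" and U: "hd U" "\<not> hd L" "U \<noteq> []"
    using assms by (auto simp: is_ppoly_iff primes_def)
  show "length U = length L" using b by (rule balanced_length)
  with b U show "1 < length U"
    by (cases U; cases L; auto simp: balanced_def)
qed

lemma ppoly_take_le:
  assumes "is_ppoly (U, L)" shows "pheight (take k L) \<le> pheight (take k U)"
proof -
  have "(U, L) \<in> balanced" using assms by (simp add: is_ppoly_iff primes_def)
  moreover have "length U = length L" using assms by (rule ppoly_length)
  ultimately show ?thesis
    using prime_above[of U L k] assms unfolding is_ppoly_iff
    by (cases "k = 0"; cases "k < length U") (auto simp: balanced_def)
qed

text \<open>One step before the end \<open>U\<close> is still strictly higher than \<open>L\<close>;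
  the heights can only become equal by a north step of \<open>L\<close> and an east step of
  \<open>U\<close>.\<close>

lemma ppoly_last:
  assumes "is_ppoly (U, L)" shows "\<not> last U" "last L"
proof -
  have len: "length L = length U" "1 < length U" using ppoly_length[OF assms] by simp_all
  define k where "k = length U - 1"
  have k: "0 < k" "k < length U" "Suc k = length U" using len by (auto simp: k_def)
  have "pheight (take k L) < pheight (take k U)"
    using assms k by (intro prime_above) (auto simp: is_ppoly_iff)
  moreover have "pheight (take (Suc k) L) = pheight (take (Suc k) U)"
    using assms k len by (simp add: is_ppoly_iff primes_def balanced_def)
  ultimately have "\<not> U ! k" "L ! k"
    using k(2) len pheight_take_Suc[of k U] pheight_take_Suc[of k L] by (simp_all split: if_splits)
  moreover have "last U = U ! k" "last L = L ! k"
    using len last_conv_nth[of U] last_conv_nth[of L] by (cases U; cases L; simp add: k_def)+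
  ultimately show "\<not> last U" "last L" by simp_all
qed

lemma ppoly_ehgt_le:
  assumes "is_ppoly (U, L)" "i < pwidth U" shows "ehgt L i \<le> ehgt U i"
proof -
  have "i < pwidth L" using assms by (simp add: is_ppoly_iff primes_def balanced_def)
  then have "ehgt L i \<le> pheight (take (i + ehgt L i) L)"
    by (subst ehgt_ge_iff[symmetric]) simp_all
  also have "\<dots> \<le> pheight (take (i + ehgt L i) U)" using assms(1) by (rule ppoly_take_le)
  finally show ?thesis using assms(2) by (subst ehgt_ge_iff)
qed

lemma ppoly_area_eq: "ppoly_area (U, L) = (\<Sum>i<pwidth U. ehgt U i - ehgt L i)"
proof -
  have "ppoly_cells (U, L) = (SIGMA i : {..<pwidth U}. {ehgt L i..<ehgt U i})"
    by (auto simp: ppoly_cells_def)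
  then show ?thesis by (simp add: ppoly_area_def)
qed

subsection \<open>Transposition\<close>

lemma pwidth_map_Not [simp]: "pwidth (map Not p) = pheight p"
  by (induction p) (auto simp: pwidth_def pheight_def)

lemma pheight_map_Not [simp]: "pheight (map Not p) = pwidth p"
  by (induction p) (auto simp: pwidth_def pheight_def)

lemma map_Not_Not [simp]: "map Not (map Not p) = p"
  by (simp add: comp_def)

lemma balanced_map_Not: "(map Not q, map Not p) \<in> balanced \<longleftrightarrow> (p, q) \<in> balanced"
  by (auto simp: balanced_def)

lemma is_ppoly_transpose:
  assumes "is_ppoly (U, L)" shows "is_ppoly (map Not L, map Not U)"
proof -
  have "(U, L) \<in> balanced" "hd U" "\<not> hd L" "U \<noteq> []" "L \<noteq> []"
    "\<And>k. 0 < k \<Longrightarrow> k < length U \<Longrightarrow> (take k U, take k L) \<notin> balanced"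
    using assms ppoly_length[OF assms] unfolding is_ppoly_iff by (auto simp: primes_def)
  then show ?thesis
    using ppoly_length[OF assms] unfolding is_ppoly_iff primes_def
    by (auto simp: take_map balanced_map_Not hd_map simp del: map_Not_Not)
qed

text \<open>The cell in column \<open>i\<close> and row \<open>j\<close> lies on one side of the
  path, and reflection in the diagonal exchanges the two sides.\<close>

lemma less_ehgt_map_Not:
  "i < pwidth p \<Longrightarrow> j < pheight p \<Longrightarrow> i < ehgt (map Not p) j \<longleftrightarrow> \<not> j < ehgt p i"
proof (induction p arbitrary: i j)
  case (Cons a p)
  show ?case
  proof (cases a)
    case True
    with Cons show ?thesis by (cases j) auto
  next
    case False
    with Cons show ?thesis by (cases i) auto
  qed
qed simp

lemma ppoly_area_transpose:
  assumes "is_ppoly (U, L)" shows "ppoly_area (map Not L, map Not U) = ppoly_area (U, L)"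
proof -
  have b: "pwidth L = pwidth U" "pheight L = pheight U"
    using assms by (auto simp: is_ppoly_iff primes_def balanced_def)
  have "ppoly_cells (map Not L, map Not U) = prod.swap ` ppoly_cells (U, L)"
  proof (intro set_eqI)
    fix z :: "nat \<times> nat" obtain j i where z: "z = (j, i)" by (cases z)
    have "z \<in> ppoly_cells (map Not L, map Not U) \<longleftrightarrow>
        j < pheight U \<and> i < pwidth U \<and> ehgt (map Not U) j \<le> i \<and> i < ehgt (map Not L) j"
      using ehgt_le_pheight[of j "map Not L"] b by (auto simp: ppoly_cells_def z)
    also have "\<dots> \<longleftrightarrow> j < pheight U \<and> i < pwidth U \<and> ehgt L i \<le> j \<and> j < ehgt U i"
      using less_ehgt_map_Not[of i U j] less_ehgt_map_Not[of i L j] b by auto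
    also have "\<dots> \<longleftrightarrow> z \<in> prod.swap ` ppoly_cells (U, L)"
      using ehgt_le_pheight[of i U] by (force simp: ppoly_cells_def z)
    finally show "z \<in> ppoly_cells (map Not L, map Not U) \<longleftrightarrow> z \<in> prod.swap ` ppoly_cells (U, L)" .
  qed
  then show ?thesis by (simp add: ppoly_area_def card_image)
qed

text \<open>Needed because \<open>Px\<close> and \<open>Py\<close> mark the width by \<open>w\<close>, while \<open>wwt\<close> marks it by \<open>h\<close>.\<close>
lemma Pcoeff_commute: "Pcoeff a b c = Pcoeff a c b"
proof -
  let ?S = "\<lambda>b c. {UL. is_ppoly UL \<and> ppoly_area UL = a \<and> pwidth (fst UL) = b \<and> pheight (fst UL) = c}"
  let ?t = "\<lambda>(U, L). (map Not L, map Not U)"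
  have sub: "?t z \<in> ?S c b" if "z \<in> ?S b c" for z b c
  proof -
    obtain U L where z: "z = (U, L)" by (cases z)
    with that have "pwidth L = pwidth U" "pheight L = pheight U"
      by (auto simp: is_ppoly_iff primes_def balanced_def)
    with that show ?thesis by (auto simp: z is_ppoly_transpose ppoly_area_transpose)
  qed
  have "bij_betw ?t (?S b c) (?S c b)"
  proof (rule bij_betw_byWitness[where f' = ?t])
    show "?t ` ?S b c \<subseteq> ?S c b" "?t ` ?S c b \<subseteq> ?S b c" using sub by blast+
  qed (simp_all add: split_def comp_def)
  then show ?thesis unfolding Pcoeff_def by (simp add: bij_betw_same_card)
qed

subsection \<open>Evaluation of the generating functions\<close>

lemma wwt_ppoly:
  assumes "is_ppoly (U, L)"
  shows "wwt (U, L) = (0, ppoly_area (U, L), pheight U, pwidth U)"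
    and "wwt (L, U) = (ppoly_area (U, L), 0, pheight U, pwidth U)"
proof -
  have b: "pwidth L = pwidth U" "pheight L = pheight U"
    using assms by (auto simp: is_ppoly_iff primes_def balanced_def)
  show "wwt (U, L) = (0, ppoly_area (U, L), pheight U, pwidth U)"
    "wwt (L, U) = (ppoly_area (U, L), 0, pheight U, pwidth U)"
    using ppoly_ehgt_le[OF assms] b by (auto simp: wwt_def ppoly_area_eq)
qed

lemma gf_ppoly: "gf wwt {z. is_ppoly z} = Py"
proof (rule ps4_eqI)
  fix a b c d
  have "{z \<in> {z. is_ppoly z}. wwt z = (a, b, c, d)} = (if a = 0 then
      {UL. is_ppoly UL \<and> ppoly_area UL = b \<and> pwidth (fst UL) = d \<and> pheight (fst UL) = c} else {})"
    using wwt_ppoly(1) by (intro set_eqI) (auto simp: split_paired_all)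
  then show "fps_nth (fps_nth (fps_nth (fps_nth (gf wwt {z. is_ppoly z}) d) c) b) a =
      fps_nth (fps_nth (fps_nth (fps_nth Py d) c) b) a"
    unfolding Py_def mk4_nth gf_nth by (subst Pcoeff_commute) (simp add: Pcoeff_def)
qed

lemma gf_ppoly_swap: "gf wwt {z. is_ppoly (prod.swap z)} = Px"
proof (rule ps4_eqI)
  fix a b c d
  let ?S = "{UL. is_ppoly UL \<and> ppoly_area UL = a \<and> pwidth (fst UL) = d \<and> pheight (fst UL) = c}"
  have "{z \<in> {z. is_ppoly (prod.swap z)}. wwt z = (a, b, c, d)} = (if b = 0 then prod.swap ` ?S else {})"
  proof (intro set_eqI)
    fix z :: "bool list \<times> bool list"
    obtain L U where z: "z = (L, U)" by (cases z)
    have "z \<in> prod.swap ` ?S \<longleftrightarrow> (U, L) \<in> ?S" by (force simp: z)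
    then show "z \<in> {z \<in> {z. is_ppoly (prod.swap z)}. wwt z = (a, b, c, d)} \<longleftrightarrow>
        z \<in> (if b = 0 then prod.swap ` ?S else {})"
      using wwt_ppoly(2)[of U L] by (cases "is_ppoly (U, L)") (auto simp: z)
  qed
  then show "fps_nth (fps_nth (fps_nth (fps_nth (gf wwt {z. is_ppoly (prod.swap z)}) d) c) b) a =
      fps_nth (fps_nth (fps_nth (fps_nth Px d) c) b) a"
    unfolding Px_def mk4_nth gf_nth by (subst Pcoeff_commute) (simp add: Pcoeff_def card_image)
qed

lemma primes_balanced: "primes \<subseteq> balanced"
  by (auto simp: primes_def)

lemma primes_swap:
  assumes "(p, q) \<in> primes" shows "(q, p) \<in> primes"
proof -
  have swap: "(r, s) \<in> balanced \<Longrightarrow> (s, r) \<in> balanced" for r s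
    by (simp add: balanced_def)
  have b: "(p, q) \<in> balanced" "p \<noteq> []" using assms by (simp_all add: primes_def)
  then have len: "length p = length q" by (simp add: balanced_length)
  have "(take k q, take k p) \<notin> balanced" if "0 < k" "k < length q" for k
    using that assms swap[of "take k q" "take k p"] len by (auto simp: primes_def)
  moreover have "q \<noteq> []" using len b by auto
  ultimately show ?thesis using swap b by (simp add: primes_def)
qed

lemma ppoly_primes: "is_ppoly z \<Longrightarrow> z \<in> primes" "is_ppoly (prod.swap z) \<Longrightarrow> z \<in> primes"
  by (cases z; simp add: is_ppoly_iff primes_swap)+

text \<open>The first letters split the primes into a common north step (weight \<open>W4\<close>),
  a common east step (\<open>H4\<close>), polyominoes with upper path first (\<open>Py\<close>) and
  with lower path first (\<open>Px\<close>). The last letters are forced in each class.\<close>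

lemma gf_prime_words:
  "gf wwt (prime_words H R) =
    (if H True True \<and> R True True then W4 else 0) + (if H False False \<and> R False False then H4 else 0)
    + (if H True False \<and> R False True then Py else 0) + (if H False True \<and> R True False then Px else 0)"
proof -
  define S1 where "S1 = (if H True True \<and> R True True then {([True], [True])} else {})"
  define S2 where "S2 = (if H False False \<and> R False False then {([False], [False])} else {})"
  define S3 where "S3 = (if H True False \<and> R False True then {z. is_ppoly z} else {})"
  define S4 where "S4 = (if H False True \<and> R True False then {z. is_ppoly (prod.swap z)} else {})"
  have "prime_words H R = ((S1 \<union> S2) \<union> S3) \<union> S4"
  proof (intro set_eqI)
    fix z :: "bool list \<times> bool list"
    obtain p q where z: "z = (p, q)" by (cases z)
    have pr: "([True], [True]) \<in> primes" "([False], [False]) \<in> primes"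
      by (auto simp: primes_def balanced_def)
    have w: "z \<in> words H R \<longleftrightarrow> H (hd p) (hd q) \<and> R (last p) (last q)" if "z \<in> primes"
      using that by (auto simp: words_def z primes_def)
    show "z \<in> prime_words H R \<longleftrightarrow> z \<in> ((S1 \<union> S2) \<union> S3) \<union> S4"
    proof (cases "z \<in> primes")
      case False
      then show ?thesis
        using pr ppoly_primes[of z]
        by (auto simp: prime_words_def S1_def S2_def S3_def S4_def split: if_splits)
    next
      case True
      show ?thesis
      proof (cases "hd p = hd q")
        case eq: True
        then obtain a where "z = ([a], [a])"
          using prime_hd_eq True unfolding z by blast
        then show ?thesis using True w[OF True] z
          by (cases a) (auto simp: prime_words_def S1_def S2_def S3_def S4_def is_ppoly_iff)
      next
        case ne: False
        show ?thesis
        proof (cases "hd p")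
          case h: True
          then have "is_ppoly (p, q)" using ne True by (auto simp: is_ppoly_iff z)
          with ppoly_last[OF this] h ne show ?thesis using True w[OF True]
            by (auto simp: prime_words_def S1_def S2_def S3_def S4_def z is_ppoly_iff)
        next
          case h: False
          then have "is_ppoly (q, p)" using ne True primes_swap by (auto simp: is_ppoly_iff z)
          with ppoly_last[OF this] h ne show ?thesis using True w[OF True]
            by (auto simp: prime_words_def S1_def S2_def S3_def S4_def z is_ppoly_iff)
        qed
      qed
    qed
  qed
  moreover have "finite_fibers wwt S1" "finite_fibers wwt S2"
    by (auto simp: S1_def S2_def intro: finite_fibers_finite)
  moreover have "finite_fibers wwt S3" "finite_fibers wwt S4"
    using ppoly_primes primes_balanced unfolding S3_def S4_def
    by (auto intro!: finite_fibers_subset[OF finite_fibers_balanced])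
  moreover have "finite_fibers wwt (A \<union> B)" if "finite_fibers wwt A" "finite_fibers wwt B"
    for A B :: "(bool list \<times> bool list) set"
  proof -
    have "{s \<in> A \<union> B. wwt s = v} = {s \<in> A. wwt s = v} \<union> {s \<in> B. wwt s = v}" for v by auto
    then show ?thesis using that unfolding finite_fibers_def by simp
  qed
  moreover have "S1 \<inter> S2 = {}" "(S1 \<union> S2) \<inter> S3 = {}" "((S1 \<union> S2) \<union> S3) \<inter> S4 = {}"
    by (auto simp: S1_def S2_def S3_def S4_def is_ppoly_iff)
  ultimately have "gf wwt (prime_words H R) = gf wwt S1 + gf wwt S2 + gf wwt S3 + gf wwt S4"
    by (simp add: gf_Un)
  moreover have "gf wwt ({} :: (bool list \<times> bool list) set) = 0"
    by (rule ps4_eqI) simp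
  moreover have "gf wwt {([True], [True])} = W4" "gf wwt {([False], [False])} = H4"
    by (auto intro!: gf_singleton_W gf_singleton_H simp: wwt_def)
  ultimately show ?thesis
    by (simp add: S1_def S2_def S3_def S4_def gf_ppoly gf_ppoly_swap)
qed

abbreviation "F_any \<equiv> (\<lambda>a _. \<not> a)"
abbreviation "T_F \<equiv> (\<lambda>a b. a \<and> \<not> b)"

text \<open>With no condition on the first letters the series solves a linear equation whose
  coefficient \<open>W4 + H4 + Py + Px\<close> counts all primes; this is the origin of the
  denominator. A pair in \<open>words T_F T_F\<close> starts with a polyomino counted by
  \<open>Py\<close> and ends with one counted by \<open>Px\<close>, which yields the product of the
  two.\<close>

lemma gf_words_eq:
  "(W4 * gf wwt (words F_any F_any) - gf wwt (words T_F T_F)) * (1 - H4 - W4 - Px - Py) =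
    (1 - W4) * (H4 * W4 - Px * Py)"
proof -
  define A where "A = gf wwt (words F_any F_any)"
  define C where "C = gf wwt (words T_F T_F)"
  define E where "E = gf wwt (words any F_any)"
  define G where "G = gf wwt (words any T_F)"
  have A: "A = H4 + (H4 + Px) * E" and C: "C = Py * G"
    using gf_words[of F_any F_any] gf_words[of T_F T_F]
    unfolding gf_prime_words by (simp_all add: A_def C_def E_def G_def)
  have solve: "e * (1 - p) = a" if "e = a + p * e" for e p a :: ps4
  proof -
    have "e * (1 - p) = e - p * e" by (simp add: algebra_simps)
    also have "\<dots> = a" using that by (metis add_diff_cancel_right')
    finally show ?thesis .
  qed
  have E: "E = H4 + Py + (W4 + H4 + Py + Px) * E" and G: "G = Px + (W4 + H4 + Py + Px) * G"
    using gf_words[of any F_any] gf_words[of any T_F]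
    unfolding gf_prime_words E_def[symmetric] G_def[symmetric] by simp_all
  have E': "E * (1 - H4 - W4 - Px - Py) = H4 + Py"
    using solve[OF E] by (simp add: algebra_simps)
  have G': "G * (1 - H4 - W4 - Px - Py) = Px"
    using solve[OF G] by (simp add: algebra_simps)
  have "(W4 * A - C) * (1 - H4 - W4 - Px - Py) =
      W4 * H4 * (1 - H4 - W4 - Px - Py) + W4 * (H4 + Px) * (E * (1 - H4 - W4 - Px - Py))
      - Py * (G * (1 - H4 - W4 - Px - Py))"
    unfolding A C by (simp add: algebra_simps)
  also have "\<dots> = (1 - W4) * (H4 * W4 - Px * Py)"
    unfolding E' G' by (simp add: algebra_simps)
  finally show ?thesis by (simp add: A_def C_def)
qed

section \<open>Quasi-periodic functions\<close>

definition QP :: "int \<Rightarrow> nat \<Rightarrow> (int \<Rightarrow> int) set" where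
  "QP k n = {f. mono f \<and> (\<forall>t. f (t + int n) = f t + k)}"

lemma QP_mono: "f \<in> QP k n \<Longrightarrow> s \<le> t \<Longrightarrow> f s \<le> f t"
  by (auto simp: QP_def mono_def)

lemma QP_plus: "f \<in> QP k n \<Longrightarrow> f (t + int n) = f t + k"
  by (auto simp: QP_def)

lemma QP_minus: "f \<in> QP k n \<Longrightarrow> f (t - int n) = f t - k"
  using QP_plus[of f k n "t - int n"] by simp

lemma QP_mult:
  assumes "f \<in> QP k n" shows "f (t + j * int n) = f t + j * k"
proof (induction j rule: int_induct[where k = 0])
  case base then show ?case by simp
next
  case (step1 i)
  then show ?case using QP_plus[OF assms, of "t + i * int n"] by (simp add: algebra_simps)
next
  case (step2 i)
  then show ?case using QP_minus[OF assms, of "t + i * int n"] by (simp add: algebra_simps)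
qed

lemma QP_mod: "f \<in> QP k n \<Longrightarrow> f t = f (t mod int n) + k * (t div int n)"
  using QP_mult[of f k n "t mod int n" "t div int n"] by (simp add: algebra_simps)

lemma QP_eqI:
  assumes "f \<in> QP k n" "g \<in> QP k n" "0 < n" "\<And>t. 0 \<le> t \<Longrightarrow> t < int n \<Longrightarrow> f t = g t"
  shows "f = g"
proof
  fix t
  show "f t = g t"
    using QP_mod[OF assms(1), of t] QP_mod[OF assms(2), of t] assms(4)[of "t mod int n"] assms(3) by simp
qed

definition qp_ext :: "int \<Rightarrow> nat \<Rightarrow> (nat \<Rightarrow> int) \<Rightarrow> int \<Rightarrow> int" where
  "qp_ext k n s t = s (nat (t mod int n)) + k * (t div int n)"

lemma qp_ext_nat [simp]: "i < n \<Longrightarrow> qp_ext k n s (int i) = s i"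
  by (simp add: qp_ext_def)

lemma qp_ext_eq:
  assumes "f \<in> QP k n" "0 < n" "\<And>i. i < n \<Longrightarrow> s i = f (int i)"
  shows "qp_ext k n s = f"
proof
  fix t
  have "nat (t mod int n) < n" using assms(2) by (simp add: nat_less_iff)
  then have "s (nat (t mod int n)) = f (t mod int n)" using assms(2,3) by simp
  then show "qp_ext k n s t = f t" using QP_mod[OF assms(1), of t] by (simp add: qp_ext_def)
qed

lemma mono_intI:
  fixes f :: "int \<Rightarrow> int"
  assumes "\<And>t. f t \<le> f (t + 1)" shows "mono f"
proof (rule monoI)
  fix x y :: int assume "x \<le> y"
  then show "f x \<le> f y"
    by (induction y rule: int_ge_induct) (use assms order_trans in \<open>auto\<close>)
qed

text \<open>The last hypothesis is monotonicity across the border between two periods.\<close>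

lemma qp_ext_QP:
  assumes "0 < n" "\<And>i. Suc i < n \<Longrightarrow> s i \<le> s (Suc i)" "s (n - 1) \<le> s 0 + k"
  shows "qp_ext k n s \<in> QP k n"
proof -
  have "qp_ext k n s t \<le> qp_ext k n s (t + 1)" for t
  proof -
    define i where "i = nat (t mod int n)"
    define d where "d = t div int n"
    have i: "i < n" "t = int i + d * int n" using assms(1) by (simp_all add: i_def d_def nat_less_iff)
    have v: "qp_ext k n s t = s i + k * d" by (simp add: qp_ext_def i_def d_def)
    show ?thesis
    proof (cases "Suc i < n")
      case True
      have "t + 1 = int (Suc i) + d * int n" using i(2) by simp
      then have "(t + 1) mod int n = int (Suc i)" "(t + 1) div int n = d"
        using True by (simp_all only: mod_mult_self1 div_mult_self1) (simp_all add: assms(1) div_pos_pos_trivial)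
      then have "qp_ext k n s (t + 1) = s (Suc i) + k * d"
        unfolding qp_ext_def by (simp only: nat_int)
      then show ?thesis using assms(2)[OF True] by (simp add: v)
    next
      case False
      then have "i = n - 1" using i by simp
      have "t + 1 = (d + 1) * int n" using i(2) \<open>i = n - 1\<close> assms(1) by (simp add: algebra_simps)
      then have "(t + 1) mod int n = 0" "(t + 1) div int n = d + 1"
        using assms(1) by simp_all
      then show ?thesis using assms(3) \<open>i = n - 1\<close> by (simp add: v) (simp add: qp_ext_def algebra_simps)
    qed
  qed
  then have "mono (qp_ext k n s)" by (rule mono_intI)
  moreover have "qp_ext k n s (t + int n) = qp_ext k n s t + k" for t
    using assms(1) by (simp add: qp_ext_def algebra_simps)
  ultimately show ?thesis by (simp add: QP_def)
qed

section \<open>Words with prescribed heights\<close>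

lemma pheight_replicate_True [simp]: "pheight (replicate k True) = k"
  by (induction k) auto

lemma pwidth_replicate_True [simp]: "pwidth (replicate k True) = 0"
  by (induction k) auto

text \<open>Induction on the last east step: it is followed only by the \<open>H - s n\<close>
  missing north steps.\<close>

lemma word_exists:
  assumes "\<And>i j. i \<le> j \<Longrightarrow> j < n \<Longrightarrow> s i \<le> s j" "\<And>i. i < n \<Longrightarrow> s i \<le> H"
  shows "\<exists>p. pwidth p = n \<and> pheight p = H \<and> (\<forall>i<n. ehgt p i = s i)"
  using assms
proof (induction n arbitrary: H)
  case 0
  show ?case by (intro exI[of _ "replicate H True"]) simp
next
  case (Suc n)
  have "\<exists>p. pwidth p = n \<and> pheight p = s n \<and> (\<forall>i<n. ehgt p i = s i)"
    by (rule Suc.IH) (use Suc.prems(1) in auto)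
  then obtain p where p: "pwidth p = n" "pheight p = s n" "\<forall>i<n. ehgt p i = s i" by blast
  have "s n \<le> H" using Suc.prems(2) by simp
  with p show ?case
    by (intro exI[of _ "p @ False # replicate (H - s n) True"]) (auto simp: ehgt_append less_Suc_eq)
qed

lemma word_unique:
  assumes "pwidth p = pwidth q" "pheight p = pheight q" "\<And>i. i < pwidth p \<Longrightarrow> ehgt p i = ehgt q i"
  shows "p = q"
  using assms
proof (induction p arbitrary: q)
  case Nil
  then show ?case using pwidth_pheight[of q] by simp
next
  case (Cons a p)
  have "length (a # p) = length q"
    using Cons.prems(1,2) pwidth_pheight[of "a # p"] pwidth_pheight[of q] by simp
  then obtain b q' where q: "q = b # q'" by (cases q) auto
  show ?case
  proof (cases a)
    case a: True
    show ?thesis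
    proof (cases b)
      case b: True
      have "ehgt p i = ehgt q' i" if "i < pwidth p" for i
        using Cons.prems(3)[of i] that a b q by simp
      then have "p = q'" by (intro Cons.IH) (use Cons.prems(1,2) a b q in auto)
      with a b q show ?thesis by simp
    next
      case b: False
      then show ?thesis using Cons.prems(1) Cons.prems(3)[of 0] a q by simp
    qed
  next
    case a: False
    show ?thesis
    proof (cases b)
      case b: True
      then show ?thesis using Cons.prems(1) Cons.prems(3)[of 0] a q by simp
    next
      case b: False
      have "ehgt p i = ehgt q' i" if "i < pwidth p" for i
        using Cons.prems(3)[of "Suc i"] that a b q by simp
      then have "p = q'" by (intro Cons.IH) (use Cons.prems(1,2) a b q in auto)
      with a b q show ?thesis by simp
    qed
  qed
qed

lemma ehgt_mono: "i \<le> j \<Longrightarrow> j < pwidth p \<Longrightarrow> ehgt p i \<le> ehgt p j"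
proof (induction p arbitrary: i j)
  case (Cons a p)
  then show ?case by (cases a; cases i; cases j) auto
qed simp

lemma hd_iff_ehgt: "0 < pwidth p \<Longrightarrow> hd p \<longleftrightarrow> 0 < ehgt p 0"
proof (cases p)
  case (Cons a q)
  then show ?thesis by (cases a) auto
qed simp

lemma last_iff_ehgt: "0 < pwidth p \<Longrightarrow> last p \<longleftrightarrow> ehgt p (pwidth p - 1) < pheight p"
proof (induction p rule: rev_induct)
  case (snoc a p)
  show ?case
  proof (cases a)
    case True
    with snoc.prems show ?thesis
      using ehgt_le_pheight[of "pwidth p - 1" p] by (simp add: ehgt_append less_Suc_eq_le)
  qed (simp add: ehgt_append)
qed simp

section \<open>Pairs of quasi-periodic functions\<close>

type_synonym qpair = "nat \<times> nat \<times> (int \<Rightarrow> int) \<times> (int \<Rightarrow> int)"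

text \<open>\<open>al 0 = 0\<close> selects one representative among the pairs that differ by adding
  a constant to both functions; the weight depends on their difference only.\<close>

definition Omega :: "nat \<Rightarrow> nat \<Rightarrow> ((int \<Rightarrow> int) \<times> (int \<Rightarrow> int)) set" where
  "Omega m n = {(al, ps). al \<in> QP (int m - 1) n \<and> ps \<in> QP (int m) n \<and> al 0 = 0}"

lemma OmegaD:
  assumes "(al, ps) \<in> Omega m n"
  shows "al \<in> QP (int m - 1) n" "ps \<in> QP (int m) n" "al 0 = 0"
  using assms by (auto simp: Omega_def)

definition pos_part :: "nat \<Rightarrow> (int \<Rightarrow> int) \<Rightarrow> (int \<Rightarrow> int) \<Rightarrow> nat" where
  "pos_part n f g = (\<Sum>i<n. nat (f (int i) - g (int i)))"

definition qpairs :: "qpair set" where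
  "qpairs = {(m, n, z). 1 \<le> m \<and> 1 \<le> n \<and> z \<in> Omega m n}"

definition qwt :: "qpair \<Rightarrow> weight" where
  "qwt = (\<lambda>(m, n, al, ps). (pos_part n ps al, pos_part n al ps, m, n))"

lemma pos_part_ge: "i < n \<Longrightarrow> f (int i) - g (int i) \<le> int (pos_part n f g)"
proof -
  assume "i < n"
  then have "nat (f (int i) - g (int i)) \<le> pos_part n f g"
    unfolding pos_part_def by (intro member_le_sum) auto
  then show ?thesis by linarith
qed

text \<open>On one period \<open>al\<close> stays between \<open>0\<close> and \<open>m - 1\<close>,
  and the weight bounds \<open>ps - al\<close> from both sides; the values on a period determine
  both functions.\<close>

lemma finite_fibers_qpairs: "finite_fibers qwt qpairs"
  unfolding finite_fibers_def
proof
  fix v :: weight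
  obtain a b m n where v: "v = (a, b, m, n)" by (metis prod.collapse)
  let ?S = "{s \<in> qpairs. qwt s = v}"
  let ?L = "{xs. set xs \<subseteq> {- int (a + b)..int (m + a + b)} \<and> length xs = n}"
  let ?r = "\<lambda>f. map (\<lambda>i. f (int i)) [0..<n]"
  let ?f = "\<lambda>(_, _, al, ps). (?r al, ?r ps)"
  have "inj_on ?f ?S"
  proof (rule inj_onI)
    fix s s' assume "s \<in> ?S" "s' \<in> ?S" and eq: "?f s = ?f s'"
    then obtain al ps al' ps' where s: "s = (m, n, al, ps)" "s' = (m, n, al', ps')"
        "0 < n" "(al, ps) \<in> Omega m n" "(al', ps') \<in> Omega m n"
      by (auto simp: v qwt_def qpairs_def)
    have "al (int i) = al' (int i)" "ps (int i) = ps' (int i)" if "i < n" for i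
      using eq that by (simp_all add: s)
    then have "al = qp_ext (int m - 1) n (\<lambda>i. al' (int i))" "ps = qp_ext (int m) n (\<lambda>i. ps' (int i))"
      using s by (auto simp: Omega_def intro!: qp_ext_eq[symmetric])
    moreover have "al' = qp_ext (int m - 1) n (\<lambda>i. al' (int i))" "ps' = qp_ext (int m) n (\<lambda>i. ps' (int i))"
      using s by (auto simp: Omega_def intro!: qp_ext_eq[symmetric])
    ultimately show "s = s'" unfolding s by metis
  qed
  moreover have "?f ` ?S \<subseteq> ?L \<times> ?L"
  proof
    fix z assume "z \<in> ?f ` ?S"
    then obtain al ps where z: "z = (?r al, ?r ps)" "(al, ps) \<in> Omega m n" "0 < n"
        "a = pos_part n ps al" "b = pos_part n al ps"
      by (auto simp: v qwt_def qpairs_def)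
    have "0 \<le> al (int i) \<and> al (int i) \<le> int m - 1 \<and> ps (int i) - al (int i) \<le> int a
        \<and> al (int i) - ps (int i) \<le> int b" if "i < n" for i
    proof -
      have q: "al \<in> QP (int m - 1) n" "al 0 = 0" using z by (auto simp: Omega_def)
      have "al 0 \<le> al (int i)" "al (int i) \<le> al (0 + int n)"
        using that by (auto intro: QP_mono[OF q(1)])
      moreover have "al (0 + int n) = al 0 + (int m - 1)" by (rule QP_plus[OF q(1)])
      ultimately show ?thesis
        using q(2) z(4,5) pos_part_ge[OF that, of al ps] pos_part_ge[OF that, of ps al] by simp
    qed
    then show "z \<in> ?L \<times> ?L" unfolding z(1) by fastforce
  qed
  moreover have "finite (?L \<times> ?L)"
    by (intro finite_cartesian_product finite_lists_length_eq) auto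
  ultimately show "finite ?S"
    by (meson finite_subset inj_on_finite)
qed

section \<open>Sliding the window by one step\<close>

definition q_yy :: "qpair set" where
  "q_yy = {(m, n, al, ps) \<in> qpairs. ps (int n - 1) \<le> al (int n - 1)}"

text \<open>\<open>q_yy\<close> collects the pairs whose weight gains a factor \<open>y\<close>
  under \<open>qshift\<close>, and \<open>q_neg\<close> is its image; all other pairs lose a factor
  \<open>x\<close>.\<close>

definition q_neg :: "qpair set" where
  "q_neg = {(m, n, al, ps) \<in> qpairs. ps 0 < 0}"

definition qshift :: "qpair \<Rightarrow> qpair" where
  "qshift = (\<lambda>(m, n, al, ps). (m, n, \<lambda>t. al (t - 1) - al (- 1), \<lambda>t. ps (t - 1) - al (- 1)))"

lemma QP_translate: "f \<in> QP k n \<Longrightarrow> (\<lambda>t. f (t + d) - c) \<in> QP k n"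
proof -
  assume f: "f \<in> QP k n"
  have "f (t + int n + d) = f (t + d) + k" for t
    using QP_plus[OF f, of "t + d"] by (simp add: algebra_simps)
  then show ?thesis using QP_mono[OF f] by (auto simp: QP_def mono_def)
qed

lemma bij_betw_qshift: "bij_betw qshift qpairs qpairs"
proof (rule bij_betw_byWitness
    [where f' = "\<lambda>(m, n, al, ps). (m, n, \<lambda>t. al (t + 1) - al 1, \<lambda>t. ps (t + 1) - al 1)"])
  show "qshift ` qpairs \<subseteq> qpairs"
    using QP_translate[where d = "- 1"] by (auto simp: qshift_def qpairs_def Omega_def)
  show "(\<lambda>(m, n, al, ps). (m, n, \<lambda>t. al (t + 1) - al 1, \<lambda>t. ps (t + 1) - al 1)) ` qpairs \<subseteq> qpairs"
    using QP_translate[where d = 1] by (auto simp: qpairs_def Omega_def)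
qed (auto simp: qshift_def qpairs_def Omega_def)

lemma qpairs_minus_one:
  assumes "(m, n, al, ps) \<in> qpairs"
  shows "al (- 1) = al (int n - 1) - (int m - 1)" "ps (- 1) = ps (int n - 1) - int m"
proof -
  have "al \<in> QP (int m - 1) n" "ps \<in> QP (int m) n" using assms by (auto simp: qpairs_def Omega_def)
  then show "al (- 1) = al (int n - 1) - (int m - 1)" "ps (- 1) = ps (int n - 1) - int m"
    using QP_minus[of _ _ n "int n - 1"] by simp_all
qed

text \<open>The shifted \<open>ps\<close> takes at 0 the value \<open>ps (- 1) - al (- 1)\<close>,
  which is \<open>ps (n - 1) - al (n - 1) - 1\<close>.\<close>

lemma qshift_neg_iff: "s \<in> qpairs \<Longrightarrow> qshift s \<in> q_neg \<longleftrightarrow> s \<in> q_yy"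
proof -
  assume s: "s \<in> qpairs"
  obtain m n al ps where eq: "s = (m, n, al, ps)" by (metis prod.collapse)
  have "qshift s \<in> qpairs" using s bij_betw_qshift by (auto simp: bij_betw_def)
  then show ?thesis
    using s qpairs_minus_one[of m n al ps] by (auto simp: eq qshift_def q_neg_def q_yy_def)
qed

text \<open>The term at \<open>n - 1\<close> is exchanged for the term at \<open>- 1\<close>; the
  identity is kept additive since natural subtraction truncates.\<close>

lemma pos_part_qshift:
  assumes "1 \<le> n"
  shows "pos_part n (\<lambda>t. f (t - 1) - c) (\<lambda>t. g (t - 1) - c) + nat (f (int n - 1) - g (int n - 1)) =
    nat (f (- 1) - g (- 1)) + pos_part n f g"
proof -
  obtain k where n: "n = Suc k" using assms by (cases n) auto
  have "(\<Sum>i<Suc k. nat (f (int i - 1) - g (int i - 1))) =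
      nat (f (- 1) - g (- 1)) + (\<Sum>i<k. nat (f (int i) - g (int i)))"
    by (subst sum.lessThan_Suc_shift) simp
  then show ?thesis by (simp add: pos_part_def n)
qed

text \<open>A gap \<open>d\<close> at \<open>n - 1\<close> is replaced by \<open>d - 1\<close>. If
  \<open>d <= 0\<close>, the positive part of \<open>al - ps\<close> grows by one; if
  \<open>d > 0\<close>, that of \<open>ps - al\<close> shrinks by one.\<close>

lemma qwt_qshift:
  assumes "s \<in> qpairs"
  shows "s \<in> q_yy \<Longrightarrow> qwt (qshift s) = (0, 1, 0, 0) + qwt s"
    and "s \<notin> q_yy \<Longrightarrow> qwt s = (1, 0, 0, 0) + qwt (qshift s)"
proof -
  obtain m n al ps where eq: "s = (m, n, al, ps)" by (metis prod.collapse)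
  have n: "1 \<le> n" using assms by (auto simp: eq qpairs_def)
  note 1 = pos_part_qshift[OF n, of al "al (- 1)" ps] pos_part_qshift[OF n, of ps "al (- 1)" al]
  note 2 = qpairs_minus_one[OF assms[unfolded eq]]
  show "qwt (qshift s) = (0, 1, 0, 0) + qwt s" if "s \<in> q_yy"
  proof -
    have le: "ps (int n - 1) \<le> al (int n - 1)" using that by (simp add: eq q_yy_def)
    then show ?thesis using 1 2 by (simp add: eq qshift_def qwt_def)
  qed
  show "qwt s = (1, 0, 0, 0) + qwt (qshift s)" if "s \<notin> q_yy"
  proof -
    have le: "al (int n - 1) < ps (int n - 1)" using that assms by (simp add: eq q_yy_def)
    then show ?thesis using 1 2 by (simp add: eq qshift_def qwt_def)
  qed
qed

lemma bij_betw_qshift_yy: "bij_betw qshift q_yy q_neg"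
  "bij_betw qshift (qpairs - q_yy) (qpairs - q_neg)"
proof -
  have inj: "inj_on qshift qpairs" and im: "qshift ` qpairs = qpairs"
    using bij_betw_qshift by (auto simp: bij_betw_def)
  have sub: "q_yy \<subseteq> qpairs" "q_neg \<subseteq> qpairs" by (auto simp: q_yy_def q_neg_def)
  have "qshift ` q_yy = q_neg"
  proof (intro set_eqI iffI)
    fix z assume "z \<in> q_neg"
    then obtain s where "s \<in> qpairs" "z = qshift s" using sub im by blast
    then show "z \<in> qshift ` q_yy" using \<open>z \<in> q_neg\<close> qshift_neg_iff by blast
  qed (use sub qshift_neg_iff in blast)
  moreover have "qshift ` (qpairs - q_yy) = qshift ` qpairs - qshift ` q_yy"
    using inj sub by (intro inj_on_image_set_diff) auto
  ultimately show "bij_betw qshift q_yy q_neg" "bij_betw qshift (qpairs - q_yy) (qpairs - q_neg)"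
    using inj sub im by (auto simp: bij_betw_def intro: inj_on_subset)
qed

text \<open>Let K and Q be the series of \<open>qpairs\<close> and \<open>q_yy\<close>. The shift
  gives \<open>Y4\<close> Q for \<open>q_neg\<close> and K - Q = \<open>X4\<close> (K -
  \<open>Y4\<close> Q) for the complements, hence (1 - \<open>X4\<close>) K = (1 - \<open>X4\<close>
  \<open>Y4\<close>) Q. In Q - \<open>Y4\<close> Q the common part of \<open>q_yy\<close> and
  \<open>q_neg\<close> cancels.\<close>

lemma gf_qpairs_cyclic:
  "(1 - X4) * (1 - Y4) * gf qwt qpairs = (1 - X4 * Y4) * (gf qwt (q_yy - q_neg) - gf qwt (q_neg - q_yy))"
proof -
  have sub: "q_yy \<subseteq> qpairs" "q_neg \<subseteq> qpairs" by (auto simp: q_yy_def q_neg_def)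
  note fin = finite_fibers_subset[OF finite_fibers_qpairs]
  have split: "gf qwt S = gf qwt (S \<inter> T) + gf qwt (S - T)" if "S \<subseteq> qpairs" for S T
    using gf_Un[of qwt "S \<inter> T" "S - T"] that by (simp add: fin subset_iff Int_Diff_Un Int_Diff_disjoint)
  have neg: "gf qwt q_neg = Y4 * gf qwt q_yy"
  proof -
    have "qwt (qshift s) = (0, 1, 0, 0) + qwt s" if "s \<in> q_yy" for s
      using that sub qwt_qshift(1) by blast
    from gf_shift[OF fin[OF sub(1)] bij_betw_qshift_yy(1) this]
    show ?thesis by (simp add: gf_singleton_Y)
  qed
  \<comment> \<open>The shift lowers the weight here, so \<open>gf_shift\<close> is applied to its
    inverse.\<close>
  have "gf qwt (qpairs - q_yy) = X4 * gf qwt (qpairs - q_neg)"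
    using gf_shift[OF fin bij_betw_inv_into[OF bij_betw_qshift_yy(2)], of qwt "(1, 0, 0, 0)"]
      qwt_qshift(2) bij_betw_inv_into_right[OF bij_betw_qshift_yy(2)]
      bij_betwE[OF bij_betw_inv_into[OF bij_betw_qshift_yy(2)]]
    by (simp add: gf_singleton_X)
  moreover have "gf qwt qpairs = gf qwt q_yy + gf qwt (qpairs - q_yy)"
    "gf qwt qpairs = gf qwt q_neg + gf qwt (qpairs - q_neg)"
    using split[of qpairs q_yy] split[of qpairs q_neg] sub by (simp_all add: Int_absorb1)
  ultimately have 1: "gf qwt qpairs = gf qwt q_yy + X4 * (gf qwt qpairs - Y4 * gf qwt q_yy)"
    using neg by (metis add_diff_cancel_left')
  have "gf qwt q_yy = gf qwt (q_yy \<inter> q_neg) + gf qwt (q_yy - q_neg)"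
    "Y4 * gf qwt q_yy = gf qwt (q_yy \<inter> q_neg) + gf qwt (q_neg - q_yy)"
    using split[of q_yy q_neg] split[of q_neg q_yy] sub neg by (simp_all add: Int_commute)
  then have 2: "(1 - Y4) * gf qwt q_yy = gf qwt (q_yy - q_neg) - gf qwt (q_neg - q_yy)"
    by (metis (no_types, lifting) add_diff_cancel_left left_diff_distrib mult_1)
  have "(1 - X4) * gf qwt qpairs = gf qwt qpairs - X4 * (gf qwt qpairs - Y4 * gf qwt q_yy) - X4 * Y4 * gf qwt q_yy"
    by (simp add: algebra_simps)
  also have "gf qwt qpairs - X4 * (gf qwt qpairs - Y4 * gf qwt q_yy) = gf qwt q_yy"
    using 1 by (metis add_diff_cancel_right')
  finally have "(1 - X4) * gf qwt qpairs = (1 - X4 * Y4) * gf qwt q_yy"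
    by (simp add: algebra_simps)
  then have "(1 - X4) * (1 - Y4) * gf qwt qpairs = (1 - X4 * Y4) * ((1 - Y4) * gf qwt q_yy)"
    by (simp add: ac_simps)
  then show ?thesis unfolding 2 .
qed

text \<open>Here \<open>m\<close> may be any number exceeding the height of the paths; the surplus is the first component
  of the argument and accounts for the factor \<open>1 / (1 - w)\<close>.\<close>
definition lu_pair :: "nat \<times> bool list \<times> bool list \<Rightarrow> qpair" where
  "lu_pair = (\<lambda>(k, p, q). (Suc (pheight p + k), pwidth p,
     qp_ext (int (pheight p + k)) (pwidth p) (\<lambda>i. int (ehgt p i)),
     qp_ext (int (Suc (pheight p + k))) (pwidth p) (\<lambda>i. int (ehgt q i))))"

text \<open>Subtracting \<open>ehgt p 0\<close> restores the value 0 of the first function at 0. The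
  height is now \<open>ps (n - 1) - ps 0\<close>, which may be as large as \<open>m\<close>; in
  \<open>lu_pair\<close> it is \<open>al (n - 1)\<close>, at most \<open>m - 1\<close>, hence the
  \<open>Suc\<close> there and not here.\<close>

definition ul_pair :: "nat \<times> bool list \<times> bool list \<Rightarrow> qpair" where
  "ul_pair = (\<lambda>(k, p, q). (pheight p + k, pwidth p,
     qp_ext (int (pheight p + k) - 1) (pwidth p) (\<lambda>i. int (ehgt p i) - int (ehgt p 0)),
     qp_ext (int (pheight p + k)) (pwidth p) (\<lambda>i. int (ehgt q i) - int (ehgt p 0))))"

lemma qp_ext_last [simp]: "0 < n \<Longrightarrow> qp_ext k n s (int n - 1) = s (n - 1)"
  using qp_ext_nat[of "n - 1" n k s] by (simp add: of_nat_diff)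

lemma qp_ext_zero [simp]: "0 < n \<Longrightarrow> qp_ext k n s 0 = s 0"
  using qp_ext_nat[of 0 n k s] by simp

lemma words_width_pos:
  assumes "(p, q) \<in> words F_any F_any \<union> words T_F T_F" shows "0 < pwidth p" "0 < pwidth q"
proof -
  have "(p, q) \<in> balanced" and ne: "p \<noteq> []" "\<not> hd p \<or> \<not> hd q" using assms by (auto simp: words_def)
  moreover have "pwidth p = pwidth q" using calculation(1) by (simp add: balanced_def)
  moreover have "q \<noteq> []" using balanced_length calculation(1) ne(1) by fastforce
  moreover have "0 < pwidth r" if "r \<noteq> []" "\<not> hd r" for r
    using that by (cases r) auto
  ultimately show "0 < pwidth p" "0 < pwidth q" using ne by metis+
qed

text \<open>Conditions on boundary letters become values at \<open>0\<close> and
  \<open>n - 1\<close>: an initial east step has height 0, a final one has full height.\<close>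

lemma mem_words_F_any_iff:
  "(p, q) \<in> words F_any F_any \<longleftrightarrow> (p, q) \<in> balanced \<and> 0 < pwidth p \<and> ehgt p 0 = 0 \<and>
    ehgt p (pwidth p - 1) = pheight p"
proof (cases "(p, q) \<in> balanced \<and> 0 < pwidth p")
  case True
  then show ?thesis
    using hd_iff_ehgt[of p] last_iff_ehgt[of p] ehgt_le_pheight[of "pwidth p - 1" p]
    by (auto simp: words_def)
next
  case False
  then show ?thesis using words_width_pos[of p q] by (auto simp: words_def)
qed

lemma mem_words_T_F_iff:
  "(p, q) \<in> words T_F T_F \<longleftrightarrow> (p, q) \<in> balanced \<and> 0 < pwidth p \<and> 0 < ehgt p 0 \<and>
    ehgt p (pwidth p - 1) < pheight p \<and> ehgt q 0 = 0 \<and> ehgt q (pwidth p - 1) = pheight p"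
proof (cases "(p, q) \<in> balanced \<and> 0 < pwidth p")
  case True
  then have "pwidth q = pwidth p" "pheight q = pheight p" by (simp_all add: balanced_def)
  then show ?thesis
    using True hd_iff_ehgt[of p] last_iff_ehgt[of p] hd_iff_ehgt[of q] last_iff_ehgt[of q]
      ehgt_le_pheight[of "pwidth q - 1" q]
    by (auto simp: words_def)
next
  case False
  then show ?thesis using words_width_pos[of p q] by (auto simp: words_def)
qed

lemma qp_ext_ehgt_QP:
  assumes "0 < pwidth p" "int (ehgt p (pwidth p - 1)) \<le> int (ehgt p 0) + k"
  shows "qp_ext k (pwidth p) (\<lambda>i. int (ehgt p i) - c) \<in> QP k (pwidth p)"
  using assms ehgt_mono[of _ _ p] by (intro qp_ext_QP) auto

lemma pos_part_qp_ext:
  "pwidth q = pwidth p \<Longrightarrow>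
   pos_part (pwidth p) (qp_ext k (pwidth p) (\<lambda>i. int (ehgt p i) - c)) (qp_ext l (pwidth p) (\<lambda>i. int (ehgt q i) - c))
    = (\<Sum>i<pwidth p. ehgt p i - ehgt q i)"
  unfolding pos_part_def by (intro sum.cong) auto

text \<open>In this family \<open>al 0 = 0 <= ps 0\<close> and
  \<open>ps (n - 1) <= al (n - 1)\<close>, so on a period both functions lie between
  \<open>0\<close> and \<open>al (n - 1)\<close>, the common height. The bounds are attained by
  \<open>al\<close>, so \<open>p\<close> begins and ends with an east step, while \<open>q\<close>
  is free.\<close>

lemma lu_bij: "bij_betw lu_pair (UNIV \<times> words F_any F_any) (q_yy - q_neg)"
proof (rule bij_betw_imageI)
  show "inj_on lu_pair (UNIV \<times> words F_any F_any)"
  proof (rule inj_onI)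
    fix x y assume "x \<in> UNIV \<times> words F_any F_any" "y \<in> UNIV \<times> words F_any F_any" and eq: "lu_pair x = lu_pair y"
    then obtain k p q l r s where x: "x = (k, p, q)" "(p, q) \<in> words F_any F_any"
        and y: "y = (l, r, s)" "(r, s) \<in> words F_any F_any" by auto
    from x(2) have p: "pwidth q = pwidth p" "pheight q = pheight p" "0 < pwidth p"
        "ehgt p (pwidth p - 1) = pheight p"
      by (auto simp: mem_words_F_any_iff balanced_def)
    from y(2) have r: "pwidth s = pwidth r" "pheight s = pheight r" "ehgt r (pwidth r - 1) = pheight r"
      by (auto simp: mem_words_F_any_iff balanced_def)
    let ?K = "pheight p + k"
    have w: "pwidth r = pwidth p" and m: "pheight r + l = ?K"
      using eq by (auto simp: x y lu_pair_def)
    have e: "qp_ext (int ?K) (pwidth p) (\<lambda>i. int (ehgt p i)) (int i) =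
        qp_ext (int ?K) (pwidth p) (\<lambda>i. int (ehgt r i)) (int i)"
      "qp_ext (int (Suc ?K)) (pwidth p) (\<lambda>i. int (ehgt q i)) (int i) =
        qp_ext (int (Suc ?K)) (pwidth p) (\<lambda>i. int (ehgt s i)) (int i)" for i
      using eq unfolding x y lu_pair_def prod.case w m by (simp_all only: prod.inject)
    have h: "ehgt p i = ehgt r i" "ehgt q i = ehgt s i" if "i < pwidth p" for i
      using e[of i] that by simp_all
    \<comment> \<open>The last value of the first function separates the height from the
      surplus.\<close>
    have H: "pheight p = pheight r" using h(1)[of "pwidth p - 1"] p r w by simp
    have "p = r" using w H h by (intro word_unique) auto
    moreover have "q = s" using w H h p r by (intro word_unique) auto
    ultimately show "x = y" using m by (simp add: x y)
  qed
  show "lu_pair ` (UNIV \<times> words F_any F_any) = q_yy - q_neg"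
  proof (intro set_eqI iffI)
    fix z assume "z \<in> lu_pair ` (UNIV \<times> words F_any F_any)"
    then obtain k p q where z: "z = lu_pair (k, p, q)" "(p, q) \<in> words F_any F_any" by auto
    from z(2) have p: "pwidth q = pwidth p" "pheight q = pheight p" "0 < pwidth p"
        "ehgt p 0 = 0" "ehgt p (pwidth p - 1) = pheight p"
      by (auto simp: mem_words_F_any_iff balanced_def)
    have "ehgt q (pwidth p - 1) \<le> pheight p"
      using ehgt_le_pheight[of "pwidth q - 1" q] p by simp
    then show "z \<in> q_yy - q_neg"
      using p qp_ext_ehgt_QP[of p "int (pheight p + k)" 0]
        qp_ext_ehgt_QP[of q "int (Suc (pheight p + k))" 0]
      by (auto simp: z lu_pair_def q_yy_def q_neg_def qpairs_def Omega_def Suc_le_eq)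
  next
    fix z assume zz: "z \<in> q_yy - q_neg"
    obtain m n al ps where z: "z = (m, n, al, ps)" by (metis prod.collapse)
    from zz have al: "al \<in> QP (int m - 1) n" "al 0 = 0" and ps: "ps \<in> QP (int m) n" "0 \<le> ps 0"
      and mn: "0 < m" "0 < n" and le: "ps (int n - 1) \<le> al (int n - 1)"
      by (auto simp: z q_yy_def q_neg_def qpairs_def Omega_def)
    define H where "H = nat (al (int n - 1))"
    have al0: "0 \<le> al t" if "0 \<le> t" for t using QP_mono[OF al(1) that] al(2) by simp
    have ps0: "0 \<le> ps t" if "0 \<le> t" for t using QP_mono[OF ps(1) that] ps(2) by simp
    have alH: "al t \<le> int H" if "t \<le> int n - 1" for t
      using QP_mono[OF al(1) that] by (simp add: H_def)
    have psH: "ps t \<le> int H" if "t \<le> int n - 1" for t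
      using QP_mono[OF ps(1) that] le by (simp add: H_def)
    have "al (int n - 1) \<le> al (0 + int n)" by (rule QP_mono[OF al(1)]) simp
    then have "H \<le> m - 1" using QP_plus[OF al(1), of 0] al(2) mn by (simp add: H_def)
    then obtain k where k: "m = Suc (H + k)" using mn
      by (metis Suc_diff_1 le_add_diff_inverse)
    have "\<exists>p. pwidth p = n \<and> pheight p = H \<and> (\<forall>i<n. ehgt p i = nat (al (int i)))"
      by (rule word_exists) (use QP_mono[OF al(1)] alH al0 in \<open>auto simp: nat_le_iff nat_mono\<close>)
    then obtain p where p: "pwidth p = n" "pheight p = H" "\<forall>i<n. ehgt p i = nat (al (int i))" by blast
    have "\<exists>q. pwidth q = n \<and> pheight q = H \<and> (\<forall>i<n. ehgt q i = nat (ps (int i)))"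
      by (rule word_exists) (use QP_mono[OF ps(1)] psH ps0 in \<open>auto simp: nat_le_iff nat_mono\<close>)
    then obtain q where q: "pwidth q = n" "pheight q = H" "\<forall>i<n. ehgt q i = nat (ps (int i))" by blast
    have "ehgt p 0 = 0" "ehgt p (n - 1) = H"
      using p mn al(2) by (simp_all add: H_def of_nat_diff)
    then have "(p, q) \<in> words F_any F_any"
      using p q mn by (simp add: mem_words_F_any_iff balanced_def)
    moreover have "lu_pair (k, p, q) = z"
      unfolding lu_pair_def z prod.case p(1,2) q(1,2)
      using al(1) ps(1) mn(2) p(3) q(3) al0 ps0 by (auto simp: k intro!: qp_ext_eq)
    ultimately show "z \<in> lu_pair ` (UNIV \<times> words F_any F_any)" by (metis UNIV_I SigmaI imageI)
  qed
qed

text \<open>Here \<open>ps\<close> is outermost, strictly so at both ends: after adding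
  \<open>- ps 0\<close>, both functions run between 0 and the height, \<open>q\<close> attains both
  bounds and the ends of \<open>p\<close> are strictly inside. So \<open>q\<close> begins and ends
  with an east step and \<open>p\<close> with a north step.\<close>

lemma ul_bij: "bij_betw ul_pair (UNIV \<times> words T_F T_F) (q_neg - q_yy)"
proof (rule bij_betw_imageI)
  show "inj_on ul_pair (UNIV \<times> words T_F T_F)"
  proof (rule inj_onI)
    fix x y assume "x \<in> UNIV \<times> words T_F T_F" "y \<in> UNIV \<times> words T_F T_F" and eq: "ul_pair x = ul_pair y"
    then obtain k p q l r s where x: "x = (k, p, q)" "(p, q) \<in> words T_F T_F"
        and y: "y = (l, r, s)" "(r, s) \<in> words T_F T_F" by auto
    from x(2) have p: "pwidth q = pwidth p" "pheight q = pheight p" "0 < pwidth p"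
        "ehgt q (pwidth p - 1) = pheight p" "ehgt q 0 = 0"
      by (auto simp: mem_words_T_F_iff balanced_def)
    from y(2) have r: "pwidth s = pwidth r" "pheight s = pheight r" "ehgt s (pwidth r - 1) = pheight r"
        "ehgt s 0 = 0"
      by (auto simp: mem_words_T_F_iff balanced_def)
    let ?K = "pheight p + k"
    have w: "pwidth r = pwidth p" and m: "pheight r + l = ?K"
      using eq by (auto simp: x y ul_pair_def)
    have e: "qp_ext (int ?K - 1) (pwidth p) (\<lambda>i. int (ehgt p i) - int (ehgt p 0)) (int i) =
        qp_ext (int ?K - 1) (pwidth p) (\<lambda>i. int (ehgt r i) - int (ehgt r 0)) (int i)"
      "qp_ext (int ?K) (pwidth p) (\<lambda>i. int (ehgt q i) - int (ehgt p 0)) (int i) =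
        qp_ext (int ?K) (pwidth p) (\<lambda>i. int (ehgt s i) - int (ehgt r 0)) (int i)" for i
      using eq unfolding x y ul_pair_def prod.case w m by (simp_all only: prod.inject)
    have c: "ehgt p 0 = ehgt r 0" using e(2)[of 0] p r by simp
    have h: "ehgt p i = ehgt r i" "ehgt q i = ehgt s i" if "i < pwidth p" for i
      using e[of i] that c by simp_all
    have H: "pheight p = pheight r" using h(2)[of "pwidth p - 1"] p r w by simp
    have "p = r" using w H h by (intro word_unique) auto
    moreover have "q = s" using w H h p r by (intro word_unique) auto
    ultimately show "x = y" using m by (simp add: x y)
  qed
  show "ul_pair ` (UNIV \<times> words T_F T_F) = q_neg - q_yy"
  proof (intro set_eqI iffI)
    fix z assume "z \<in> ul_pair ` (UNIV \<times> words T_F T_F)"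
    then obtain k p q where z: "z = ul_pair (k, p, q)" "(p, q) \<in> words T_F T_F" by auto
    from z(2) have p: "pwidth q = pwidth p" "pheight q = pheight p" "0 < pwidth p"
        "0 < ehgt p 0" "ehgt p (pwidth p - 1) < pheight p" "ehgt q 0 = 0"
        "ehgt q (pwidth p - 1) = pheight p"
      by (auto simp: mem_words_T_F_iff balanced_def)
    then show "z \<in> q_neg - q_yy"
      using qp_ext_ehgt_QP[of p "int (pheight p + k) - 1" "int (ehgt p 0)"]
        qp_ext_ehgt_QP[of q "int (pheight p + k)" "int (ehgt p 0)"]
      by (auto simp: z ul_pair_def q_yy_def q_neg_def qpairs_def Omega_def Suc_le_eq)
  next
    fix z assume zz: "z \<in> q_neg - q_yy"
    obtain m n al ps where z: "z = (m, n, al, ps)" by (metis prod.collapse)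
    from zz have al: "al \<in> QP (int m - 1) n" "al 0 = 0" and ps: "ps \<in> QP (int m) n" "ps 0 < 0"
      and mn: "0 < m" "0 < n" and le: "al (int n - 1) < ps (int n - 1)"
      by (auto simp: z q_yy_def q_neg_def qpairs_def Omega_def)
    define c where "c = - ps 0"
    define H where "H = nat (ps (int n - 1) + c)"
    have al0: "0 \<le> al t + c" if "0 \<le> t" for t using QP_mono[OF al(1) that] al(2) ps(2) by (simp add: c_def)
    have ps0: "0 \<le> ps t + c" if "0 \<le> t" for t using QP_mono[OF ps(1) that] by (simp add: c_def)
    have alH: "al t + c \<le> int H" if "t \<le> int n - 1" for t
      using QP_mono[OF al(1) that] le by (simp add: H_def)
    have psH: "ps t + c \<le> int H" if "t \<le> int n - 1" for t
      using QP_mono[OF ps(1) that] by (simp add: H_def)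
    have "ps (int n - 1) \<le> ps (0 + int n)" by (rule QP_mono[OF ps(1)]) simp
    then have "H \<le> m" using QP_plus[OF ps(1), of 0] by (simp add: H_def c_def)
    then obtain k where k: "m = H + k" by (metis le_add_diff_inverse)
    have "\<exists>p. pwidth p = n \<and> pheight p = H \<and> (\<forall>i<n. ehgt p i = nat (al (int i) + c))"
      by (rule word_exists) (use QP_mono[OF al(1)] alH al0 in \<open>auto simp: nat_le_iff nat_mono\<close>)
    then obtain p where p: "pwidth p = n" "pheight p = H" "\<forall>i<n. ehgt p i = nat (al (int i) + c)" by blast
    have "\<exists>q. pwidth q = n \<and> pheight q = H \<and> (\<forall>i<n. ehgt q i = nat (ps (int i) + c))"
      by (rule word_exists) (use QP_mono[OF ps(1)] psH ps0 in \<open>auto simp: nat_le_iff nat_mono\<close>)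
    then obtain q where q: "pwidth q = n" "pheight q = H" "\<forall>i<n. ehgt q i = nat (ps (int i) + c)" by blast
    have p0: "ehgt p 0 = nat c" using p mn al(2) by simp
    have "int (ehgt p (n - 1)) = al (int n - 1) + c" "ehgt q (n - 1) = H" "ehgt q 0 = 0"
      using p q mn al0[of "int n - 1"] by (simp_all add: H_def of_nat_diff c_def)
    moreover from this(1) have "ehgt p (n - 1) < H" using le by (simp add: H_def)
    ultimately have "(p, q) \<in> words T_F T_F"
      using p q mn p0 ps(2) by (simp add: mem_words_T_F_iff balanced_def c_def)
    moreover have "ul_pair (k, p, q) = z"
      unfolding ul_pair_def z prod.case p(1,2) q(1,2) p0
      using al(1) ps(1) mn(2) p(3) q(3) al0 ps0 ps(2) by (auto simp: k c_def intro!: qp_ext_eq)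
    ultimately show "z \<in> ul_pair ` (UNIV \<times> words T_F T_F)" by (metis UNIV_I SigmaI imageI)
  qed
qed

section \<open>The series of the two surviving families\<close>

lemma finite_fibers_Times:
  assumes "finite_fibers wt S" "finite_fibers wt' T"
  shows "finite_fibers (\<lambda>(s, t). wt s + wt' t) (S \<times> T)"
  unfolding finite_fibers_def
proof
  fix v :: weight
  obtain a b c d where v: "v = (a, b, c, d)" by (metis prod.collapse)
  let ?I = "{..a} \<times> {..b} \<times> {..c} \<times> {..d}"
  have "{z \<in> S \<times> T. (case z of (s, t) \<Rightarrow> wt s + wt' t) = v} \<subseteq>
      (\<Union>x\<in>?I. {s \<in> S. wt s = x}) \<times> (\<Union>x\<in>?I. {t \<in> T. wt' t = x})"
  proof
    fix z assume "z \<in> {z \<in> S \<times> T. (case z of (s, t) \<Rightarrow> wt s + wt' t) = v}"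
    then obtain s t where z: "z = (s, t)" "s \<in> S" "t \<in> T" "wt s + wt' t = v" by auto
    obtain a1 b1 c1 d1 where ws: "wt s = (a1, b1, c1, d1)" by (metis prod.collapse)
    obtain a2 b2 c2 d2 where wt: "wt' t = (a2, b2, c2, d2)" by (metis prod.collapse)
    have "wt s \<in> ?I" "wt' t \<in> ?I" using z(4) by (auto simp: v ws wt)
    then show "z \<in> (\<Union>x\<in>?I. {s \<in> S. wt s = x}) \<times> (\<Union>x\<in>?I. {t \<in> T. wt' t = x})"
      using z by blast
  qed
  then show "finite {z \<in> S \<times> T. (case z of (s, t) \<Rightarrow> wt s + wt' t) = v}"
    by (rule finite_subset) (use assms in \<open>auto intro!: finite_cartesian_product finite_UN_I dest: finite_fibersD\<close>)
qed

lemma finite_fibers_nat: "finite_fibers (\<lambda>k::nat. (0, 0, k, 0)) UNIV"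
  unfolding finite_fibers_def
proof
  fix v :: weight
  have "{s \<in> UNIV. (0, 0, s, 0) = v} \<subseteq> {fst (snd (snd v))}" by auto
  then show "finite {s \<in> UNIV. (0, 0, s, 0) = v}" by (rule finite_subset) simp
qed

text \<open>The geometric series in \<open>w\<close>, which sums over the surplus.\<close>

lemma gf_nat: "gf (\<lambda>k. (0, 0, k, 0)) UNIV * (1 - W4) = 1"
proof -
  let ?w = "\<lambda>k::nat. (0, 0, k, 0) :: weight"
  have fin: "finite_fibers ?w S" for S
    using finite_fibers_nat by (rule finite_fibers_subset) simp
  have "gf ?w UNIV = gf ?w ({0} \<union> {1..})"
    by (rule arg_cong[where f = "gf ?w"]) auto
  also have "\<dots> = gf ?w {0} + gf ?w {1..}"
    by (rule gf_Un) (use fin in auto)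
  also have "gf ?w {0} = 1" by (rule gf_singleton_zero) (simp add: zero_prod_def)
  also have "gf ?w {1..} = gf (\<lambda>_. (0, 0, 1, 0)) {()} * gf ?w UNIV"
  proof (rule gf_shift[OF fin])
    show "bij_betw Suc UNIV {1..}" by (auto simp: bij_betw_def image_iff) (metis Suc_le_D)
  qed simp
  also have "gf (\<lambda>_. (0, 0, 1, 0)) {()} = W4" by (rule gf_singleton_W) simp
  finally have "gf ?w UNIV = 1 + W4 * gf ?w UNIV" .
  then have "gf ?w UNIV - W4 * gf ?w UNIV = 1" by (metis add_diff_cancel_right')
  then show ?thesis by (simp add: algebra_simps)
qed

text \<open>The factor \<open>W4\<close> on the right is the \<open>Suc\<close> in the first entry
  of \<open>lu_pair\<close>.\<close>

lemma gf_lu: "gf qwt (q_yy - q_neg) * (1 - W4) = W4 * gf wwt (words F_any F_any)"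
proof -
  let ?w = "\<lambda>k::nat. (0, 0, k, 0) :: weight"
  let ?S = "(UNIV :: nat set) \<times> words F_any F_any"
  have fin: "finite_fibers wwt (words F_any F_any)"
    using finite_fibers_balanced words_balanced by (rule finite_fibers_subset)
  have "gf qwt (q_yy - q_neg) = gf (\<lambda>_. (0, 0, 1, 0)) {()} * gf (\<lambda>(k, z). ?w k + wwt z) ?S"
  proof (rule gf_shift[OF _ lu_bij])
    show "finite_fibers (\<lambda>(k, z). ?w k + wwt z) ?S"
      by (rule finite_fibers_Times) (rule finite_fibers_nat fin)+
    fix x assume "x \<in> ?S"
    then obtain k p q where x: "x = (k, p, q)" "pwidth q = pwidth p"
      by (auto simp: mem_words_F_any_iff balanced_def)
    then show "qwt (lu_pair x) = (0, 0, 1, 0) + (case x of (k, z) \<Rightarrow> ?w k + wwt z)"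
      using pos_part_qp_ext[of p q _ 0] pos_part_qp_ext[of q p _ 0] by (simp add: qwt_def lu_pair_def wwt_def)
  qed
  also have "gf (\<lambda>(k, z). ?w k + wwt z) ?S = gf ?w UNIV * gf wwt (words F_any F_any)"
    by (rule gf_Times) (rule finite_fibers_nat fin)+
  also have "gf (\<lambda>_. (0, 0, 1, 0)) {()} = W4" by (rule gf_singleton_W) simp
  finally have "gf qwt (q_yy - q_neg) * (1 - W4) =
      W4 * gf wwt (words F_any F_any) * (gf ?w UNIV * (1 - W4))" by (simp only: ac_simps)
  then show ?thesis by (simp add: gf_nat)
qed

lemma gf_ul: "gf qwt (q_neg - q_yy) * (1 - W4) = gf wwt (words T_F T_F)"
proof -
  let ?w = "\<lambda>k::nat. (0, 0, k, 0) :: weight"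
  let ?S = "(UNIV :: nat set) \<times> words T_F T_F"
  have fin: "finite_fibers wwt (words T_F T_F)"
    using finite_fibers_balanced words_balanced by (rule finite_fibers_subset)
  have "gf qwt (q_neg - q_yy) = gf (\<lambda>(k, z). ?w k + wwt z) ?S"
  proof (rule gf_bij_betw[OF ul_bij, symmetric])
    fix x assume "x \<in> ?S"
    then obtain k p q where x: "x = (k, p, q)" "pwidth q = pwidth p"
      by (auto simp: mem_words_T_F_iff balanced_def)
    then show "qwt (ul_pair x) = (case x of (k, z) \<Rightarrow> ?w k + wwt z)"
      using pos_part_qp_ext[of p q _ "int (ehgt p 0)"] pos_part_qp_ext[of q p _ "int (ehgt p 0)"]
      by (simp add: qwt_def ul_pair_def wwt_def)
  qed
  also have "\<dots> = gf ?w UNIV * gf wwt (words T_F T_F)"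
    by (rule gf_Times) (rule finite_fibers_nat fin)+
  finally have "gf qwt (q_neg - q_yy) * (1 - W4) =
      gf wwt (words T_F T_F) * (gf ?w UNIV * (1 - W4))" by (simp only: ac_simps)
  then show ?thesis by (simp add: gf_nat)
qed

lemma gf_qpairs:
  "gf qwt qpairs * ((1 - X4) * (1 - Y4) * (1 - H4 - W4 - Px - Py)) = (1 - X4 * Y4) * (H4 * W4 - Px * Py)"
proof -
  let ?K = "gf qwt qpairs" and ?D = "1 - H4 - W4 - Px - Py"
  let ?L = "gf qwt (q_yy - q_neg)" and ?U = "gf qwt (q_neg - q_yy)"
  have "(1 - W4) * (?K * ((1 - X4) * (1 - Y4) * ?D)) = (1 - W4) * ?D * ((1 - X4) * (1 - Y4) * ?K)"
    by (simp only: ac_simps)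
  also have "\<dots> = (1 - X4 * Y4) * ((?L * (1 - W4) - ?U * (1 - W4)) * ?D)"
    unfolding gf_qpairs_cyclic left_diff_distrib[symmetric] by (simp only: ac_simps)
  also have "\<dots> = (1 - W4) * ((1 - X4 * Y4) * (H4 * W4 - Px * Py))"
    unfolding gf_lu gf_ul gf_words_eq by (simp only: ac_simps)
  \<comment> \<open>The factor \<open>1 - W4\<close> is cancelled by multiplying with its inverse
    from \<open>gf_nat\<close>.\<close>
  finally have "gf (\<lambda>k. (0, 0, k, 0)) UNIV * (1 - W4) * (?K * ((1 - X4) * (1 - Y4) * ?D)) =
      gf (\<lambda>k. (0, 0, k, 0)) UNIV * (1 - W4) * ((1 - X4 * Y4) * (H4 * W4 - Px * Py))"
    by (simp only: mult.assoc)
  then show ?thesis by (simp add: gf_nat)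
qed

section \<open>The rank of a configuration\<close>

lemma int_threshold:
  fixes P :: "int \<Rightarrow> bool"
  assumes up: "\<And>r s. P r \<Longrightarrow> r \<le> s \<Longrightarrow> P s" and "P b" "\<not> P a"
  shows "\<exists>p. \<forall>r. p < r \<longleftrightarrow> P r"
proof -
  have ex: "P (a + int (nat (b - a)))"
    using assms(2,3) up[of b a] by (cases "a \<le> b") auto
  define k where "k = (LEAST k. P (a + int k))"
  have k: "P (a + int k)" unfolding k_def using ex by (rule LeastI)
  with assms(3) have "k \<noteq> 0" by (intro notI) simp
  then have "\<not> P (a + int (k - 1))"
    using not_less_Least[of "k - 1" "\<lambda>k. P (a + int k)"] by (simp add: k_def)
  then have "a + int (k - 1) < r \<longleftrightarrow> P r" for r
    using up[of r "a + int (k - 1)"] up[OF k, of r] \<open>k \<noteq> 0\<close> by (cases "r \<le> a + int (k - 1)") auto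
  then show ?thesis by blast
qed

text \<open>One less than the least \<open>r\<close> with \<open>t \<le> g r\<close>.\<close>
definition psi :: "(int \<Rightarrow> int) \<Rightarrow> int \<Rightarrow> int" where
  "psi g t = (SOME p. \<forall>r. p < r \<longleftrightarrow> t \<le> g r)"

lemma psi_less_iff:
  assumes g: "g \<in> QP k n" "0 < k" "0 < n" shows "psi g t < r \<longleftrightarrow> t \<le> g r"
proof -
  have "\<exists>p. \<forall>r. p < r \<longleftrightarrow> t \<le> g r"
  proof (rule int_threshold)
    show "t \<le> g s" if "t \<le> g r" "r \<le> s" for r s
      using that QP_mono[OF g(1), of r s] by simp
    \<comment> \<open>Over \<open>j\<close> periods \<open>g\<close> moves by \<open>j * k\<close>,
      at least \<open>j\<close>, and \<open>j\<close> exceeds the distance from \<open>g 0\<close>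
      to \<open>t\<close>; so \<open>g\<close> passes \<open>t\<close> in both directions.\<close>
    define j where "j = \<bar>t - g 0\<bar> + 1"
    have "j * 1 \<le> j * k" using g(2) by (intro mult_left_mono) (auto simp: j_def)
    moreover have "g (j * int n) = g 0 + j * k" "g (- j * int n) = g 0 - j * k"
      using QP_mult[OF g(1), of 0 j] QP_mult[OF g(1), of 0 "- j"] by simp_all
    moreover have "t - g 0 < j" "g 0 - t < j" unfolding j_def by arith+
    ultimately show "t \<le> g (j * int n)" "\<not> t \<le> g (- j * int n)" by linarith+
  qed
  then show ?thesis unfolding psi_def by (rule someI2_ex) blast
qed

lemma psi_eqI:
  assumes "g \<in> QP k n" "0 < k" "0 < n" "\<And>r. p < r \<longleftrightarrow> t \<le> g r"
  shows "psi g t = p"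
  using psi_less_iff[OF assms(1-3), of t] assms(4) by (metis linorder_neqE less_irrefl)

text \<open>Inversion reflects the graph in the diagonal and thereby exchanges the period with the
  increment.\<close>

lemma psi_QP:
  assumes g: "g \<in> QP (int k) n" "0 < k" "0 < n" shows "psi g \<in> QP (int n) k"
proof -
  note iff = psi_less_iff[OF g(1), simplified, OF g(2,3)]
  have "psi g s \<le> psi g t" if "s \<le> t" for s t
    using iff[of s "psi g t + 1"] iff[of t "psi g t + 1"] that by simp
  moreover have "psi g (t + int k) = psi g t + int n" for t
  proof (rule psi_eqI[OF g(1)])
    fix r
    have "psi g t + int n < r \<longleftrightarrow> t \<le> g (r - int n)" using iff[of t "r - int n"] by auto
    then show "psi g t + int n < r \<longleftrightarrow> t + int k \<le> g r" using QP_minus[OF g(1), of r] by auto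
  qed (use g in auto)
  ultimately show ?thesis by (auto simp: QP_def mono_def)
qed

section \<open>Floor sums and the loss caused by one chip\<close>

lemma div_minus_one: "0 < n \<Longrightarrow> (x - 1) div int n = x div int n - (if int n dvd x then 1 else 0)"
proof -
  assume n: "0 < n"
  define q r where "q = x div int n" and "r = x mod int n"
  have x: "x = q * int n + r" "0 \<le> r" "r < int n" using n by (simp_all add: q_def r_def)
  show ?thesis
  proof (cases "r = 0")
    case True
    have "(x - 1) div int n = q - 1"
      using x True n by (intro int_div_pos_eq[of _ _ _ "int n - 1"]) (auto simp: algebra_simps)
    then show ?thesis using True by (simp add: q_def r_def dvd_eq_mod_eq_0)
  next
    case False
    have "(x - 1) div int n = q"
      using x False n by (intro int_div_pos_eq[of _ _ _ "r - 1"]) (auto simp: algebra_simps)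
    then show ?thesis using False by (simp add: q_def r_def dvd_eq_mod_eq_0)
  qed
qed

lemma sum_div_QP:
  assumes "0 < n" "finite I" shows "(\<lambda>t. \<Sum>i\<in>I. (x i + t) div int n) \<in> QP (int (card I)) n"
proof -
  have "(x i + (t + int n)) div int n = (x i + t) div int n + 1" for i t
    using assms(1) by (simp flip: add.assoc)
  then show ?thesis
    using assms by (auto simp: QP_def mono_def sum.distrib intro!: sum_mono zdiv_mono1)
qed

text \<open>Hermite's identity. Raising \<open>x\<close> by 1 replaces the term
  \<open>x div n\<close> by \<open>(x + n) div n\<close>, so the sum grows by 1.\<close>

lemma hermite:
  assumes "0 < n" shows "(\<Sum>i<n. (x + int i) div int n) = x"
proof -
  obtain k where n: "n = Suc k" using assms by (cases n) auto
  have step: "(\<Sum>i<n. (y + 1 + int i) div int n) = (\<Sum>i<n. (y + int i) div int n) + 1" for y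
  proof -
    have "(\<Sum>i<n. (y + int i) div int n) = y div int n + (\<Sum>i<k. (y + 1 + int i) div int n)"
      unfolding n by (subst sum.lessThan_Suc_shift) (simp add: algebra_simps)
    moreover have "(\<Sum>i<n. (y + 1 + int i) div int n) =
        (\<Sum>i<k. (y + 1 + int i) div int n) + (y + int n) div int n"
      unfolding n by (simp add: algebra_simps)
    ultimately show ?thesis using assms by simp
  qed
  show ?thesis
  proof (induction x rule: int_induct[where k = 0])
    case base
    show ?case by (intro sum.neutral) auto
  next
    case (step1 i) then show ?case using step[of i] by simp
  next
    case (step2 i) then show ?case using step[of "i - 1"] by simp
  qed
qed

lemma sum_residue_class:
  assumes "0 < n" shows "(\<Sum>i<n. if int n dvd int i - c then 1 else 0) = (1::nat)"
proof -
  have "int n dvd int i - c \<longleftrightarrow> i = nat (c mod int n)" if "i < n" for i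
    using that assms by (auto simp flip: mod_eq_dvd_iff)
  then have "(\<Sum>i<n. if int n dvd int i - c then 1 else 0) = (\<Sum>i<n. if i = nat (c mod int n) then 1 else (0::nat))"
    by (intro sum.cong) auto
  also have "\<dots> = 1" using assms by (simp add: nat_less_iff)
  finally show ?thesis .
qed

text \<open>The difference drops by at most 1, and only on one residue class, which meets
  \<open>0, ..., n - 1\<close> exactly once.\<close>

lemma pos_part_decrease:
  assumes "0 < n"
    and "\<And>t. f t - g t \<le> f' t - g' t + (if int n dvd t - c then 1 else 0)"
  shows "pos_part n f g \<le> pos_part n f' g' + 1"
proof -
  have "pos_part n f g \<le> (\<Sum>i<n. nat (f' (int i) - g' (int i)) + (if int n dvd int i - c then 1 else 0))"
    unfolding pos_part_def
  proof (rule sum_mono)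
    fix i
    show "nat (f (int i) - g (int i)) \<le> nat (f' (int i) - g' (int i)) + (if int n dvd int i - c then 1 else 0)"
      using assms(2)[of "int i"] by (auto split: if_splits)
  qed
  then show ?thesis using sum_residue_class[OF assms(1), of c] by (simp add: sum.distrib pos_part_def)
qed

section \<open>Effectiveness through total numbers of topplings\<close>

definition conf_f :: "nat \<Rightarrow> nat \<Rightarrow> (vtx \<Rightarrow> int) \<Rightarrow> int \<Rightarrow> int" where
  "conf_f m n u t = (\<Sum>i\<in>{1..m}. (u (A i) + t) div int n)"

definition conf_g :: "nat \<Rightarrow> nat \<Rightarrow> (vtx \<Rightarrow> int) \<Rightarrow> int \<Rightarrow> int" where
  "conf_g m n u s = (\<Sum>j\<in>{1..n}. (u (B j) + s) div int m)"

lemma sum_verts: "(\<Sum>c\<in>verts m n. h c) = (\<Sum>i\<in>{1..m}. h (A i)) + (\<Sum>j\<in>{1..n}. h (B j))"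
proof -
  have "(\<Sum>c\<in>verts m n. h c) = (\<Sum>c\<in>A ` {1..m}. h c) + (\<Sum>c\<in>B ` {1..n}. h c)"
    unfolding verts_def by (rule sum.union_disjoint) auto
  then show ?thesis by (simp add: sum.reindex inj_on_def)
qed

lemma finite_verts: "finite (verts m n)"
  by (simp add: verts_def)

lemma verts_iff [simp]: "A i \<in> verts m n \<longleftrightarrow> i \<in> {1..m}" "B j \<in> verts m n \<longleftrightarrow> j \<in> {1..n}"
  by (auto simp: verts_def)

lemma adj_simps [simp]: "\<not> adj m n (A i) (A j)" "\<not> adj m n (B i) (B j)"
  "adj m n (A i) (B j) \<longleftrightarrow> i \<in> {1..m} \<and> j \<in> {1..n}"
  "adj m n (B j) (A i) \<longleftrightarrow> i \<in> {1..m} \<and> j \<in> {1..n}"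
  by (auto simp: adj_def)

lemma gdeg_eq: "i \<in> {1..m} \<Longrightarrow> gdeg m n (A i) = int n" "j \<in> {1..n} \<Longrightarrow> gdeg m n (B j) = int m"
proof -
  have "{d \<in> verts m n. adj m n (A i) d} = B ` {1..n}" if "i \<in> {1..m}"
    using that by (auto simp: verts_def)
  then show "i \<in> {1..m} \<Longrightarrow> gdeg m n (A i) = int n" by (simp add: gdeg_def card_image inj_on_def)
  have "{d \<in> verts m n. adj m n (B j) d} = A ` {1..m}" if "j \<in> {1..n}"
    using that by (auto simp: verts_def)
  then show "j \<in> {1..n} \<Longrightarrow> gdeg m n (B j) = int m" by (simp add: gdeg_def card_image inj_on_def)
qed

lemma sum_lap:
  fixes z :: "vtx \<Rightarrow> int"
  shows "i \<in> {1..m} \<Longrightarrow> (\<Sum>c\<in>verts m n. z c * lap m n c (A i)) = int n * z (A i) - (\<Sum>j\<in>{1..n}. z (B j))"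
    and "j \<in> {1..n} \<Longrightarrow> (\<Sum>c\<in>verts m n. z c * lap m n c (B j)) = int m * z (B j) - (\<Sum>i\<in>{1..m}. z (A i))"
    and "d \<notin> verts m n \<Longrightarrow> (\<Sum>c\<in>verts m n. z c * lap m n c d) = 0"
proof -
  assume i: "i \<in> {1..m}"
  have "(\<Sum>k\<in>{1..m}. z (A k) * lap m n (A k) (A i)) = (\<Sum>k\<in>{1..m}. if k = i then int n * z (A i) else 0)"
    using gdeg_eq(1)[OF i, of n] by (intro sum.cong) (auto simp: lap_def)
  also have "\<dots> = int n * z (A i)" using i by simp
  finally have 1: "(\<Sum>k\<in>{1..m}. z (A k) * lap m n (A k) (A i)) = int n * z (A i)" .
  have "(\<Sum>j\<in>{1..n}. z (B j) * lap m n (B j) (A i)) = (\<Sum>j\<in>{1..n}. - z (B j))"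
    using i by (intro sum.cong) (auto simp: lap_def)
  with 1 show "(\<Sum>c\<in>verts m n. z c * lap m n c (A i)) = int n * z (A i) - (\<Sum>j\<in>{1..n}. z (B j))"
    by (simp add: sum_verts sum_negf)
next
  assume j: "j \<in> {1..n}"
  have "(\<Sum>k\<in>{1..n}. z (B k) * lap m n (B k) (B j)) = (\<Sum>k\<in>{1..n}. if k = j then int m * z (B j) else 0)"
    using gdeg_eq(2)[OF j, of m] by (intro sum.cong) (auto simp: lap_def)
  also have "\<dots> = int m * z (B j)" using j by simp
  finally have 1: "(\<Sum>k\<in>{1..n}. z (B k) * lap m n (B k) (B j)) = int m * z (B j)" .
  have "(\<Sum>i\<in>{1..m}. z (A i) * lap m n (A i) (B j)) = (\<Sum>i\<in>{1..m}. - z (A i))"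
    using j by (intro sum.cong) (auto simp: lap_def)
  with 1 show "(\<Sum>c\<in>verts m n. z c * lap m n c (B j)) = int m * z (B j) - (\<Sum>i\<in>{1..m}. z (A i))"
    by (simp add: sum_verts sum_negf)
next
  assume "d \<notin> verts m n"
  then have "lap m n c d = 0" if "c \<in> verts m n" for c
    using that by (auto simp: lap_def adj_def verts_def)
  then show "(\<Sum>c\<in>verts m n. z c * lap m n c d) = 0" by simp
qed

text \<open>The whole slack is taken out of the entry with index 1.\<close>

lemma sum_eq_exists:
  fixes b :: "nat \<Rightarrow> int"
  assumes "0 < k" "s \<le> (\<Sum>i\<in>{1..k}. b i)"
  shows "\<exists>z. (\<forall>i\<in>{1..k}. z i \<le> b i) \<and> (\<Sum>i\<in>{1..k}. z i) = s"
proof -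
  define z where "z = (\<lambda>i. b i - (if i = 1 then (\<Sum>i\<in>{1..k}. b i) - s else 0))"
  have "(\<Sum>i\<in>{1..k}. z i) = s" using assms(1) by (simp add: z_def sum_subtractf)
  moreover have "\<forall>i\<in>{1..k}. z i \<le> b i" using assms(2) by (simp add: z_def)
  ultimately show ?thesis by blast
qed

text \<open>Division as an adjoint, in the shape of the condition that a vertex toppled
  \<open>z\<close> times stays non-negative after receiving \<open>t\<close> chips.\<close>

lemma le_div_iff: "0 < k \<Longrightarrow> z \<le> (a + t) div int k \<longleftrightarrow> int k * z - t \<le> a"
proof -
  assume k: "0 < k"
  have "z \<le> (a + t) div int k \<longleftrightarrow> z * int k \<le> a + t"
  proof
    assume "z \<le> (a + t) div int k"
    then have "z * int k \<le> (a + t) div int k * int k" using k by (intro mult_right_mono) auto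
    also have "\<dots> \<le> a + t" using k by (simp add: minus_mod_eq_div_mult [symmetric])
    finally show "z * int k \<le> a + t" .
  next
    assume "z * int k \<le> a + t"
    then have "(z * int k) div int k \<le> (a + t) div int k" using k by (intro zdiv_mono1) auto
    then show "z \<le> (a + t) div int k" using k by simp
  qed
  then show ?thesis by (auto simp: algebra_simps)
qed

context
  fixes m n :: nat
  assumes m: "0 < m" and n: "0 < n"
begin

lemma conf_f_QP: "conf_f m n u \<in> QP (int m) n"
  using sum_div_QP[OF n, of "{1..m}" "\<lambda>i. u (A i)"] by (simp add: conf_f_def[abs_def])

lemma conf_g_QP: "conf_g m n u \<in> QP (int n) m"
  using sum_div_QP[OF m, of "{1..n}" "\<lambda>j. u (B j)"] by (simp add: conf_g_def[abs_def])

lemma psi_g_less_iff: "psi (conf_g m n u) t < r \<longleftrightarrow> t \<le> conf_g m n u r"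
  using psi_less_iff[OF conf_g_QP] m n by simp

lemma psi_g_QP: "psi (conf_g m n u) \<in> QP (int m) n"
  using psi_QP[OF conf_g_QP n m] .

lemma effective_iff_topple:
  assumes "is_conf m n u"
  shows "effective m n u \<longleftrightarrow> (\<exists>z. (\<forall>i\<in>{1..m}. int n * z (A i) - (\<Sum>j\<in>{1..n}. z (B j)) \<le> u (A i)) \<and>
    (\<forall>j\<in>{1..n}. int m * z (B j) - (\<Sum>i\<in>{1..m}. z (A i)) \<le> u (B j)))"
proof
  assume "effective m n u"
  then obtain w z where w: "\<forall>c\<in>verts m n. w c \<ge> 0" "\<forall>d. u d - w d = (\<Sum>c\<in>verts m n. z c * lap m n c d)"
    by (auto simp: effective_def toppling_equiv_def)
  have "int n * z (A i) - (\<Sum>j\<in>{1..n}. z (B j)) \<le> u (A i)" if "i \<in> {1..m}" for i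
    using w(1)[rule_format, of "A i"] w(2)[rule_format, of "A i"] sum_lap(1)[OF that, where z = z and n = n] that by simp
  moreover have "int m * z (B j) - (\<Sum>i\<in>{1..m}. z (A i)) \<le> u (B j)" if "j \<in> {1..n}" for j
    using w(1)[rule_format, of "B j"] w(2)[rule_format, of "B j"] sum_lap(2)[OF that, where z = z and m = m] that by simp
  ultimately show "\<exists>z. (\<forall>i\<in>{1..m}. int n * z (A i) - (\<Sum>j\<in>{1..n}. z (B j)) \<le> u (A i)) \<and>
    (\<forall>j\<in>{1..n}. int m * z (B j) - (\<Sum>i\<in>{1..m}. z (A i)) \<le> u (B j))" by blast
next
  assume "\<exists>z. (\<forall>i\<in>{1..m}. int n * z (A i) - (\<Sum>j\<in>{1..n}. z (B j)) \<le> u (A i)) \<and>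
    (\<forall>j\<in>{1..n}. int m * z (B j) - (\<Sum>i\<in>{1..m}. z (A i)) \<le> u (B j))"
  then obtain z where z: "\<forall>i\<in>{1..m}. int n * z (A i) - (\<Sum>j\<in>{1..n}. z (B j)) \<le> u (A i)"
    "\<forall>j\<in>{1..n}. int m * z (B j) - (\<Sum>i\<in>{1..m}. z (A i)) \<le> u (B j)" by blast
  define w where "w = (\<lambda>d. u d - (\<Sum>c\<in>verts m n. z c * lap m n c d))"
  have "is_conf m n w" using assms sum_lap(3) by (simp add: is_conf_def w_def)
  moreover have "w c \<ge> 0" if "c \<in> verts m n" for c
    using that z sum_lap(1,2)[where z = z] by (cases c) (auto simp: w_def)
  moreover have "toppling_equiv m n u w" unfolding toppling_equiv_def w_def by (intro exI[of _ z]) simp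
  ultimately show "effective m n u" by (auto simp: effective_def)
qed

lemma effective_iff:
  assumes "is_conf m n u"
  shows "effective m n u \<longleftrightarrow> (\<exists>t. psi (conf_g m n u) t < conf_f m n u t)"
proof
  assume "effective m n u"
  then obtain z where z: "\<forall>i\<in>{1..m}. int n * z (A i) - (\<Sum>j\<in>{1..n}. z (B j)) \<le> u (A i)"
    "\<forall>j\<in>{1..n}. int m * z (B j) - (\<Sum>i\<in>{1..m}. z (A i)) \<le> u (B j)"
    using effective_iff_topple[OF assms] by blast
  let ?t = "\<Sum>j\<in>{1..n}. z (B j)" and ?s = "\<Sum>i\<in>{1..m}. z (A i)"
  have "?s \<le> conf_f m n u ?t" unfolding conf_f_def
    using z(1) by (intro sum_mono) (simp add: le_div_iff[OF n])
  moreover have "?t \<le> conf_g m n u ?s" unfolding conf_g_def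
    using z(2) by (intro sum_mono) (simp add: le_div_iff[OF m])
  ultimately show "\<exists>t. psi (conf_g m n u) t < conf_f m n u t"
    using psi_g_less_iff[of u ?t ?s] by (intro exI[of _ ?t]) simp
next
  assume "\<exists>t. psi (conf_g m n u) t < conf_f m n u t"
  then obtain t where t: "t \<le> conf_g m n u (conf_f m n u t)" using psi_g_less_iff by blast
  define s where "s = conf_f m n u t"
  \<comment> \<open>Each \<open>A i\<close> topples as often as \<open>t\<close> permits, whereas
    the bounds on the \<open>B\<close>-side may add up to more than \<open>t\<close> and are lowered
    to total exactly \<open>t\<close>.\<close>
  obtain zb where zb: "\<forall>j\<in>{1..n}. zb j \<le> (u (B j) + s) div int m" "(\<Sum>j\<in>{1..n}. zb j) = t"
    using sum_eq_exists[OF n, of t "\<lambda>j. (u (B j) + s) div int m"] t by (auto simp: conf_g_def s_def)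
  define za where "za = (\<lambda>i. (u (A i) + t) div int n)"
  have za: "(\<Sum>i\<in>{1..m}. za i) = s" by (simp add: za_def s_def conf_f_def)
  define z where "z = (\<lambda>c. case c of A i \<Rightarrow> za i | B j \<Rightarrow> zb j)"
  have [simp]: "z (A i) = za i" "z (B j) = zb j" for i j by (simp_all add: z_def)
  show "effective m n u"
    unfolding effective_iff_topple[OF assms]
  proof (intro exI[of _ z] conjI ballI)
    show "int n * z (A i) - (\<Sum>j\<in>{1..n}. z (B j)) \<le> u (A i)" for i
      using le_div_iff[OF n, of "za i" "u (A i)" t] zb(2) by (simp add: za_def)
    show "int m * z (B j) - (\<Sum>i\<in>{1..m}. z (A i)) \<le> u (B j)" if "j \<in> {1..n}" for j
      using le_div_iff[OF m, of "zb j" "u (B j)" s] zb(1) za that by simp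
  qed
qed

definition excess :: "(vtx \<Rightarrow> int) \<Rightarrow> nat" where
  "excess u = pos_part n (conf_f m n u) (psi (conf_g m n u))"

text \<open>\<open>conf_f\<close> and \<open>psi\<close> have the same increment \<open>m\<close>,
  so their difference is periodic and one window of length \<open>n\<close> decides.\<close>

lemma excess_zero_iff: "excess u = 0 \<longleftrightarrow> \<not> (\<exists>t. psi (conf_g m n u) t < conf_f m n u t)"
proof -
  have "conf_f m n u t - psi (conf_g m n u) t =
      conf_f m n u (t mod int n) - psi (conf_g m n u) (t mod int n)" for t
    using QP_mod[OF conf_f_QP, of u t] QP_mod[OF psi_g_QP, of u t] by simp
  then have *: "psi (conf_g m n u) t < conf_f m n u t \<longleftrightarrow>
      psi (conf_g m n u) (int (nat (t mod int n))) < conf_f m n u (int (nat (t mod int n)))" for t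
    using n by (smt (verit) int_nat_eq pos_mod_sign of_nat_0_less_iff)
  have "excess u = 0 \<longleftrightarrow> (\<forall>i<n. conf_f m n u (int i) \<le> psi (conf_g m n u) (int i))"
    by (auto simp: excess_def pos_part_def)
  also have "\<dots> \<longleftrightarrow> \<not> (\<exists>t. psi (conf_g m n u) t < conf_f m n u t)"
  proof
    assume le: "\<forall>i<n. conf_f m n u (int i) \<le> psi (conf_g m n u) (int i)"
    have "nat (t mod int n) < n" for t using n by (simp add: nat_less_iff)
    then show "\<not> (\<exists>t. psi (conf_g m n u) t < conf_f m n u t)" using le * by (meson not_less)
  qed (auto simp: not_less)
  finally show ?thesis .
qed

definition remove_chip :: "vtx \<Rightarrow> (vtx \<Rightarrow> int) \<Rightarrow> vtx \<Rightarrow> int" where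
  "remove_chip c u = (\<lambda>v. u v - (if v = c then 1 else 0))"

lemma remove_chip_A:
  assumes "i \<in> {1..m}"
  shows "conf_g m n (remove_chip (A i) u) = conf_g m n u"
    and "conf_f m n (remove_chip (A i) u) t = conf_f m n u t - (if int n dvd u (A i) + t then 1 else 0)"
proof -
  show "conf_g m n (remove_chip (A i) u) = conf_g m n u"
    by (rule ext) (simp add: conf_g_def remove_chip_def)
  have "conf_f m n (remove_chip (A i) u) t = (\<Sum>k\<in>{1..m}. (u (A k) + t) div int n -
      (if k = i then (if int n dvd u (A i) + t then 1 else 0) else 0))"
    unfolding conf_f_def
  proof (rule sum.cong)
    fix k
    have e: "u (A i) - 1 + t = u (A i) + t - 1" by simp
    have "(u (A i) - 1 + t) div int n = (u (A i) + t) div int n - (if int n dvd u (A i) + t then 1 else 0)"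
      unfolding e by (rule div_minus_one[OF n])
    then show "(remove_chip (A i) u (A k) + t) div int n = (u (A k) + t) div int n -
        (if k = i then (if int n dvd u (A i) + t then 1 else 0) else 0)"
      by (simp add: remove_chip_def)
  qed simp
  then show "conf_f m n (remove_chip (A i) u) t = conf_f m n u t - (if int n dvd u (A i) + t then 1 else 0)"
    using assms by (simp add: sum_subtractf conf_f_def)
qed

lemma remove_chip_B:
  assumes "j \<in> {1..n}"
  shows "conf_f m n (remove_chip (B j) u) = conf_f m n u"
    and "conf_g m n (remove_chip (B j) u) t = conf_g m n u t - (if int m dvd u (B j) + t then 1 else 0)"
proof -
  show "conf_f m n (remove_chip (B j) u) = conf_f m n u"
    by (rule ext) (simp add: conf_f_def remove_chip_def)
  have "conf_g m n (remove_chip (B j) u) t = (\<Sum>k\<in>{1..n}. (u (B k) + t) div int m -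
      (if k = j then (if int m dvd u (B j) + t then 1 else 0) else 0))"
    unfolding conf_g_def
  proof (rule sum.cong)
    fix k
    have e: "u (B j) - 1 + t = u (B j) + t - 1" by simp
    have "(u (B j) - 1 + t) div int m = (u (B j) + t) div int m - (if int m dvd u (B j) + t then 1 else 0)"
      unfolding e by (rule div_minus_one[OF m])
    then show "(remove_chip (B j) u (B k) + t) div int m = (u (B k) + t) div int m -
        (if k = j then (if int m dvd u (B j) + t then 1 else 0) else 0)"
      by (simp add: remove_chip_def)
  qed simp
  then show "conf_g m n (remove_chip (B j) u) t = conf_g m n u t - (if int m dvd u (B j) + t then 1 else 0)"
    using assms by (simp add: sum_subtractf conf_g_def)
qed

text \<open>Removing a chip from \<open>B j\<close> deletes from \<open>{(r, t). t \<le> g r}\<close> a single orbit of the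
  translation by \<open>(m, n)\<close>, so \<open>psi\<close> grows by one on a single residue class.\<close>
lemma psi_remove_chip_B:
  assumes "j \<in> {1..n}"
  shows "\<exists>c. \<forall>t. psi (conf_g m n (remove_chip (B j) u)) t \<le>
    psi (conf_g m n u) t + (if int n dvd t - c then 1 else 0)"
proof -
  let ?g = "conf_g m n u" and ?g' = "conf_g m n (remove_chip (B j) u)"
  note g = conf_g_QP[of u]
  define r0 where "r0 = - u (B j)"
  have g': "?g' r = ?g r - (if int m dvd r - r0 then 1 else 0)" for r
    using remove_chip_B(2)[OF assms, of u r] by (simp add: r0_def add.commute)
  show ?thesis
  \<comment> \<open>\<open>g\<close> loses 1 exactly at the points \<open>r0 + k * m\<close>, where
    its value is \<open>g r0 + k * n\<close>; these values form the residue class of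
    \<open>g r0\<close> modulo \<open>n\<close>.\<close>
  proof (intro exI[of _ "?g r0"] allI)
    fix t
    let ?p = "psi ?g t"
    have p: "t \<le> ?g (?p + 1)" using psi_g_less_iff[of u t "?p + 1"] by simp
    have "psi ?g' t < ?p + (if int n dvd t - ?g r0 then 1 else 0) + 1"
    proof (cases "int n dvd t - ?g r0")
      case True
      have mono': "?g' r \<le> ?g' s" if "r \<le> s" for r s
        using QP_mono[OF conf_g_QP that, of "remove_chip (B j) u"] .
      have "t \<le> ?g' (?p + 2)"
      \<comment> \<open>Two consecutive arguments cannot both lose 1 unless \<open>m = 1\<close>,
        and in that case \<open>g\<close> rises by \<open>n\<close> at every step, which covers the
        loss.\<close>
      proof (cases "int m dvd ?p + 2 - r0")
        case True
        then have "\<not> int m dvd ?p + 1 - r0 \<or> m = 1"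
          using dvd_diff[of "int m" "?p + 2 - r0" "?p + 1 - r0"] by auto
        then show ?thesis
        proof
          assume "\<not> int m dvd ?p + 1 - r0"
          then show ?thesis using p g'[of "?p + 1"] mono'[of "?p + 1" "?p + 2"] by simp
        next
          assume "m = 1"
          then have "?g (?p + 2) = ?g (?p + 1) + int n" using QP_plus[OF g, of "?p + 1"] by (simp add: add.assoc)
          then show ?thesis using p g'[of "?p + 2"] n by (auto split: if_splits)
        qed
      next
        case False
        then show ?thesis using p g'[of "?p + 2"] QP_mono[OF g, of "?p + 1" "?p + 2"] by simp
      qed
      then show ?thesis using True psi_g_less_iff[of "remove_chip (B j) u" t "?p + 2"] by simp
    next
      case False
      have "t \<le> ?g' (?p + 1)"
      \<comment> \<open>Where the loss occurs, \<open>g\<close> is congruent to \<open>g r0\<close>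
        and hence different from \<open>t\<close>; the inequality \<open>t <= g (p + 1)\<close> is
        then strict and survives the loss.\<close>
      proof (cases "int m dvd ?p + 1 - r0")
        case True
        then obtain k where "?p + 1 - r0 = int m * k" by (elim dvdE)
        then have "?p + 1 = r0 + k * int m" by (simp add: algebra_simps)
        then have "?g (?p + 1) = ?g r0 + k * int n" using QP_mult[OF g] by simp
        then have "?g (?p + 1) \<noteq> t" using False by auto
        then show ?thesis using p g'[of "?p + 1"] by (auto split: if_splits)
      qed (use p g'[of "?p + 1"] in simp)
      then show ?thesis using False psi_g_less_iff[of "remove_chip (B j) u" t "?p + 1"] by simp
    qed
    then show "psi ?g' t \<le> ?p + (if int n dvd t - ?g r0 then 1 else 0)" by simp
  qed
qed

lemma excess_remove_chip:
  assumes "c \<in> verts m n" shows "excess u \<le> excess (remove_chip c u) + 1"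
proof (cases c)
  case (A i)
  then have i: "i \<in> {1..m}" using assms by simp
  show ?thesis unfolding excess_def A
  proof (rule pos_part_decrease[OF n, where c = "- u (vtx.A i)"])
    fix t
    show "conf_f m n u t - psi (conf_g m n u) t \<le> conf_f m n (remove_chip (vtx.A i) u) t -
        psi (conf_g m n (remove_chip (vtx.A i) u)) t + (if int n dvd t - - u (vtx.A i) then 1 else 0)"
      using remove_chip_A[OF i, of u] by (simp add: add.commute)
  qed
next
  case (B j)
  then have j: "j \<in> {1..n}" using assms by simp
  obtain d where d: "\<And>t. psi (conf_g m n (remove_chip (vtx.B j) u)) t \<le>
    psi (conf_g m n u) t + (if int n dvd t - d then 1 else 0)"
    using psi_remove_chip_B[OF j, of u] by blast
  show ?thesis unfolding excess_def B
  proof (rule pos_part_decrease[OF n, where c = d])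
    fix t
    show "conf_f m n u t - psi (conf_g m n u) t \<le> conf_f m n (remove_chip (vtx.B j) u) t -
        psi (conf_g m n (remove_chip (vtx.B j) u)) t + (if int n dvd t - d then 1 else 0)"
      using remove_chip_B(1)[OF j, of u] d[of t] by simp
  qed
qed

text \<open>Lower bound for the rank: each removed chip costs at most 1, so reaching excess 0 takes
  at least \<open>excess u\<close> chips.\<close>

lemma excess_lower:
  assumes "is_conf m n f" "\<forall>c\<in>verts m n. f c \<ge> 0"
  shows "int (excess u) \<le> int (excess (\<lambda>v. u v - f v)) + cdegree m n f"
  using assms
proof (induction "nat (cdegree m n f)" arbitrary: f u)
  case 0
  have "0 \<le> cdegree m n f" unfolding cdegree_def using 0 by (intro sum_nonneg) auto
  with 0 have "cdegree m n f = 0" by simp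
  then have "\<forall>c\<in>verts m n. f c = 0"
    using 0 finite_verts unfolding cdegree_def by (subst (asm) sum_nonneg_eq_0_iff) auto
  then have "f = (\<lambda>_. 0)" using 0 by (auto simp: is_conf_def)
  then show ?case by (simp add: cdegree_def)
next
  case (Suc k)
  have "\<exists>c\<in>verts m n. 0 < f c"
  proof (rule ccontr)
    assume "\<not> ?thesis"
    then have "cdegree m n f \<le> 0" unfolding cdegree_def by (intro sum_nonpos) auto
    with Suc.hyps(2) show False by simp
  qed
  then obtain c where c: "c \<in> verts m n" "0 < f c" by blast
  let ?f = "remove_chip c f"
  have deg: "cdegree m n ?f = cdegree m n f - 1"
    using c finite_verts by (simp add: cdegree_def remove_chip_def sum_subtractf)
  have "int (excess (remove_chip c u)) \<le> int (excess (\<lambda>v. remove_chip c u v - ?f v)) + cdegree m n ?f"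
  proof (rule Suc.hyps(1))
    show "k = nat (cdegree m n ?f)" using Suc.hyps(2) deg by simp
    show "is_conf m n ?f" using Suc.prems c by (auto simp: is_conf_def remove_chip_def)
    show "\<forall>c\<in>verts m n. 0 \<le> ?f c" using Suc.prems c by (auto simp: remove_chip_def)
  qed
  moreover have "(\<lambda>v. remove_chip c u v - ?f v) = (\<lambda>v. u v - f v)" by (auto simp: remove_chip_def)
  ultimately show ?case using excess_remove_chip[OF c(1), of u] deg by simp
qed

text \<open>Otherwise \<open>conf_f\<close> would be constant from a positive point leftwards, since
  there \<open>psi\<close> only decreases and the point stays positive; but over a period
  \<open>conf_f\<close> falls by \<open>m\<close>. A jump is needed to find a chip whose removal
  pays off.\<close>

lemma excess_pos_jump:
  assumes "0 < excess u"
  shows "\<exists>t. psi (conf_g m n u) t < conf_f m n u t \<and> conf_f m n u (t - 1) < conf_f m n u t"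
proof (rule ccontr)
  assume no: "\<not> ?thesis"
  obtain t where t: "psi (conf_g m n u) t < conf_f m n u t"
    using assms excess_zero_iff by (metis less_irrefl)
  have "conf_f m n u (t - int k) = conf_f m n u t" for k
  proof (induction k)
    case (Suc k)
    have "psi (conf_g m n u) (t - int k) \<le> psi (conf_g m n u) t" by (rule QP_mono[OF psi_g_QP]) simp
    then have "psi (conf_g m n u) (t - int k) < conf_f m n u (t - int k)" using t Suc by linarith
    then have "\<not> conf_f m n u (t - int k - 1) < conf_f m n u (t - int k)" using no by blast
    moreover have "conf_f m n u (t - int k - 1) \<le> conf_f m n u (t - int k)"
      by (rule QP_mono[OF conf_f_QP]) simp
    ultimately show ?case using Suc by (simp add: algebra_simps)
  qed simp
  then show False using QP_minus[OF conf_f_QP, of u t] m by simp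
qed

text \<open>Greedy removal on the \<open>A\<close>-side: a jump of \<open>conf_f\<close> at
  \<open>t\<close> comes from some \<open>A i\<close> with \<open>n\<close> dividing
  \<open>u (A i) + t\<close>. Taking a chip there lowers \<open>conf_f\<close> at a positive point
  and leaves \<open>psi\<close> alone, so the excess drops.\<close>

lemma excess_upper:
  assumes "is_conf m n u"
  shows "\<exists>f. is_conf m n f \<and> (\<forall>c\<in>verts m n. f c \<ge> 0) \<and> \<not> effective m n (\<lambda>v. u v - f v) \<and>
    cdegree m n f \<le> int (excess u)"
  using assms
proof (induction "excess u" arbitrary: u rule: less_induct)
  case less
  show ?case
  proof (cases "excess u = 0")
    case True
    then have "\<not> effective m n u" using effective_iff[OF less.prems] excess_zero_iff by simp
    then show ?thesis by (intro exI[of _ "\<lambda>_. 0"]) (simp add: is_conf_def cdegree_def)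
  next
    case False
    then obtain t where t: "psi (conf_g m n u) t < conf_f m n u t" "conf_f m n u (t - 1) < conf_f m n u t"
      using excess_pos_jump by blast
    have "\<exists>i\<in>{1..m}. int n dvd u (A i) + t"
    proof (rule ccontr)
      assume "\<not> ?thesis"
      then have "(u (A i) + (t - 1)) div int n = (u (A i) + t) div int n" if "i \<in> {1..m}" for i
        using that div_minus_one[OF n, of "u (A i) + t"] by (simp add: algebra_simps)
      then have "conf_f m n u (t - 1) = conf_f m n u t" unfolding conf_f_def by (intro sum.cong) auto
      with t show False by simp
    qed
    then obtain i where i: "i \<in> {1..m}" "int n dvd u (A i) + t" by blast
    let ?u = "remove_chip (A i) u"
    \<comment> \<open>The jump may lie outside the window; its residue is the index at which the sum
      strictly decreases.\<close>
    let ?k = "nat (t mod int n)"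
    have k: "?k < n" "int ?k = t mod int n" using n by (simp_all add: nat_less_iff)
    have dk: "int n dvd u (A i) + int ?k"
      using i(2) unfolding k(2) by (simp add: dvd_eq_mod_eq_0 mod_add_right_eq)
    have pk: "psi (conf_g m n u) (int ?k) < conf_f m n u (int ?k)"
      using t(1) QP_mod[OF conf_f_QP, of u t] QP_mod[OF psi_g_QP, of u t] unfolding k(2) by simp
    have lt: "excess ?u < excess u"
      unfolding excess_def pos_part_def
    proof (rule sum_strict_mono_ex1)
      show "\<forall>l\<in>{..<n}. nat (conf_f m n ?u (int l) - psi (conf_g m n ?u) (int l))
          \<le> nat (conf_f m n u (int l) - psi (conf_g m n u) (int l))"
        using remove_chip_A[OF i(1), of u] by (auto intro!: nat_mono)
      show "\<exists>l\<in>{..<n}. nat (conf_f m n ?u (int l) - psi (conf_g m n ?u) (int l))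
          < nat (conf_f m n u (int l) - psi (conf_g m n u) (int l))"
        using remove_chip_A[OF i(1), of u] k(1) dk pk by (intro bexI[of _ ?k]) auto
    qed simp
    have "is_conf m n ?u" using less.prems i by (auto simp: is_conf_def remove_chip_def)
    from less.hyps[OF lt this] obtain f where f: "is_conf m n f" "\<forall>c\<in>verts m n. f c \<ge> 0"
      "\<not> effective m n (\<lambda>v. ?u v - f v)" "cdegree m n f \<le> int (excess ?u)" by blast
    let ?f = "\<lambda>v. f v + (if v = A i then 1 else 0)"
    have "(\<lambda>v. u v - ?f v) = (\<lambda>v. ?u v - f v)" by (auto simp: remove_chip_def)
    moreover have "cdegree m n ?f = cdegree m n f + 1"
      using i finite_verts by (simp add: cdegree_def sum.distrib)
    moreover have "is_conf m n ?f" using f(1) i by (auto simp: is_conf_def)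
    ultimately show ?thesis using f lt by (intro exI[of _ ?f]) auto
  qed
qed

text \<open>\<open>LEAST\<close> over the integers is determined by exhibiting the minimum:
  \<open>excess_lower\<close> bounds the degrees from below and \<open>excess_upper\<close> attains
  the bound.\<close>

lemma crank_eq:
  assumes "is_conf m n u" shows "crank m n u = int (excess u) - 1"
proof -
  let ?P = "\<lambda>d. \<exists>f. is_conf m n f \<and> (\<forall>c\<in>verts m n. f c \<ge> 0) \<and> \<not> effective m n (\<lambda>v. u v - f v) \<and>
      cdegree m n f = d"
  have low: "int (excess u) \<le> d" if P: "?P d" for d
  proof -
    obtain f where f: "is_conf m n f" "\<forall>c\<in>verts m n. f c \<ge> 0" "\<not> effective m n (\<lambda>v. u v - f v)"
      "cdegree m n f = d" using P by blast
    have "is_conf m n (\<lambda>v. u v - f v)" using assms f(1) by (simp add: is_conf_def)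
    then have "excess (\<lambda>v. u v - f v) = 0" using f(3) effective_iff excess_zero_iff by blast
    then show ?thesis using excess_lower[OF f(1,2), of u] f(4) by simp
  qed
  obtain f where f: "is_conf m n f" "\<forall>c\<in>verts m n. f c \<ge> 0" "\<not> effective m n (\<lambda>v. u v - f v)"
      "cdegree m n f \<le> int (excess u)" using excess_upper[OF assms] by blast
  then have "?P (cdegree m n f)" by blast
  with low[OF this] f(4) have "?P (int (excess u))" by (metis order_antisym)
  then have "(LEAST d. ?P d) = int (excess u)" by (rule Least_equality) (rule low)
  then show ?thesis by (simp add: crank_def)
qed

end

section \<open>Parking configurations\<close>

lemma sum_one_if: "finite S \<Longrightarrow> (\<Sum>i\<in>S. if P i then 1 else 0 :: int) = int (card {i \<in> S. P i})"
  by (simp add: sum.If_cases Int_def conj_commute)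

text \<open>If \<open>x j + s\<close> reaches \<open>N\<close>, the entries from \<open>j\<close> on
  contribute at least 1 and the others at least 0; if not, entries up to \<open>j\<close> contribute
  at most 0 and later ones at most 1. It lets sorted values be read off from floor sums, on both
  sides of the graph.\<close>

lemma sorted_dual:
  fixes x :: "nat \<Rightarrow> int"
  assumes N: "0 < N" and j: "j \<in> {1..k}"
    and x: "\<And>i. i \<in> {1..k} \<Longrightarrow> 0 \<le> x i \<and> x i < int N"
    and mono: "\<And>i l. 1 \<le> i \<Longrightarrow> i \<le> l \<Longrightarrow> l \<le> k \<Longrightarrow> x i \<le> x l"
  shows "int (k + 1 - j) \<le> (\<Sum>i\<in>{1..k}. (x i + s) div int N) \<longleftrightarrow> int N - x j \<le> s"
proof
  assume s: "int N - x j \<le> s"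
  have "int (k + 1 - j) = int (card {i \<in> {1..k}. j \<le> i})"
  proof -
    have "{i \<in> {1..k}. j \<le> i} = {j..k}" using j by auto
    then show ?thesis using j by simp
  qed
  also have "\<dots> = (\<Sum>i\<in>{1..k}. if j \<le> i then 1 else 0)" by (rule sum_one_if[symmetric]) simp
  also have "\<dots> \<le> (\<Sum>i\<in>{1..k}. (x i + s) div int N)"
  proof (rule sum_mono)
    fix i assume i: "i \<in> {1..k}"
    have "0 \<le> x i + s" using s x[OF i] x[OF j] by simp
    then have 0: "0 \<le> (x i + s) div int N" using N by (simp add: pos_imp_zdiv_nonneg_iff)
    show "(if j \<le> i then 1 else 0) \<le> (x i + s) div int N"
    proof (cases "j \<le> i")
      case True
      then have "x j \<le> x i" using mono[of j i] i j by simp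
      then have "int N * 1 - s \<le> x i" using s by simp
      then show ?thesis using le_div_iff[OF N, of 1 "x i" s] by simp
    qed (use 0 in simp)
  qed
  finally show "int (k + 1 - j) \<le> (\<Sum>i\<in>{1..k}. (x i + s) div int N)" .
next
  assume le: "int (k + 1 - j) \<le> (\<Sum>i\<in>{1..k}. (x i + s) div int N)"
  show "int N - x j \<le> s"
  proof (rule ccontr)
    assume s: "\<not> int N - x j \<le> s"
    have "(\<Sum>i\<in>{1..k}. (x i + s) div int N) \<le> (\<Sum>i\<in>{1..k}. if j < i then 1 else 0)"
    proof (rule sum_mono)
      fix i assume i: "i \<in> {1..k}"
      have "\<not> 2 \<le> (x i + s) div int N"
        using le_div_iff[OF N, of 2 "x i" s] x[OF i] x[OF j] s by simp
      moreover have "\<not> 1 \<le> (x i + s) div int N" if "\<not> j < i"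
      proof -
        have "x i \<le> x j" using mono[of i j] i j that by simp
        then show ?thesis using le_div_iff[OF N, of 1 "x i" s] s by simp
      qed
      ultimately show "(x i + s) div int N \<le> (if j < i then 1 else 0)" by auto
    qed
    also have "\<dots> = int (card {i \<in> {1..k}. j < i})" by (rule sum_one_if) simp
    also have "{i \<in> {1..k}. j < i} = {Suc j..k}" using j by auto
    finally show False using le j by simp
  qed
qed

lemma sum_reverse: "(\<Sum>i<n. h (int (Suc i))) = (\<Sum>j\<in>{1..n}. h (int (n + 1 - j)) :: int)"
  by (rule sum.reindex_bij_witness[where i = "\<lambda>j. n - j" and j = "\<lambda>i. n - i"])
     (auto simp: Suc_diff_le)

definition conf_a :: "nat \<Rightarrow> nat \<Rightarrow> (vtx \<Rightarrow> int) \<Rightarrow> int \<Rightarrow> int" where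
  "conf_a m n u t = (\<Sum>i\<in>{1..m - 1}. (u (A i) + t) div int n)"

text \<open>The upper bounds are what \<open>parking\<close> demands of the singletons
  \<open>C\<close>.\<close>

definition box :: "nat \<Rightarrow> nat \<Rightarrow> (vtx \<Rightarrow> int) \<Rightarrow> bool" where
  "box m n u \<longleftrightarrow> (\<forall>i\<in>{1..m - 1}. 0 \<le> u (A i) \<and> u (A i) < int n) \<and>
     (\<forall>j\<in>{1..n}. 0 \<le> u (B j) \<and> u (B j) < int m)"

lemma lapset_eq:
  assumes "C \<subseteq> verts m n"
  shows "i \<in> {1..m} \<Longrightarrow> lapset m n C (A i) = (if A i \<in> C then int n else 0) - int (card {j \<in> {1..n}. B j \<in> C})"
    and "j \<in> {1..n} \<Longrightarrow> lapset m n C (B j) = (if B j \<in> C then int m else 0) - int (card {i \<in> {1..m}. A i \<in> C})"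
proof -
  let ?z = "\<lambda>c. if c \<in> C then 1 else 0 :: int"
  have eq: "lapset m n C v = (\<Sum>c\<in>verts m n. ?z c * lap m n c v)" for v
  proof -
    have "(\<Sum>c\<in>verts m n. ?z c * lap m n c v) = (\<Sum>c\<in>verts m n. if c \<in> C then lap m n c v else 0)"
      by (intro sum.cong) auto
    also have "\<dots> = (\<Sum>c\<in>verts m n \<inter> C. lap m n c v)"
      by (rule sum.inter_restrict[symmetric]) (rule finite_verts)
    finally show ?thesis using assms by (simp add: lapset_def Int_absorb1)
  qed
  show "i \<in> {1..m} \<Longrightarrow> lapset m n C (A i) = (if A i \<in> C then int n else 0) - int (card {j \<in> {1..n}. B j \<in> C})"
    using sum_lap(1)[where z = ?z and m = m and n = n and i = i] by (simp only: eq sum_one_if finite_atLeastAtMost) simp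
  show "j \<in> {1..n} \<Longrightarrow> lapset m n C (B j) = (if B j \<in> C then int m else 0) - int (card {i \<in> {1..m}. A i \<in> C})"
    using sum_lap(2)[where z = ?z and m = m and n = n and j = j] by (simp only: eq sum_one_if finite_atLeastAtMost) simp
qed

context
  fixes m n :: nat
  assumes m: "0 < m" and n: "0 < n"
begin

lemma conf_a_QP: "conf_a m n u \<in> QP (int m - 1) n"
  using sum_div_QP[OF n, of "{1..m - 1}" "\<lambda>i. u (A i)"] m by (simp add: conf_a_def[abs_def] of_nat_diff)

lemma conf_f_conf_a: "conf_f m n u t = conf_a m n u t + (u (A m) + t) div int n"
proof -
  have "{1..m} = insert m {1..m - 1}" using m by auto
  then show ?thesis using m by (simp add: conf_f_def conf_a_def)
qed

lemma ball_nonsink: "(\<forall>c\<in>verts m n - {sink m}. P c) \<longleftrightarrow> (\<forall>i\<in>{1..m - 1}. P (A i)) \<and> (\<forall>j\<in>{1..n}. P (B j))"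
proof -
  have "verts m n - {sink m} = A ` {1..m - 1} \<union> B ` {1..n}"
  proof (intro set_eqI)
    fix c show "c \<in> verts m n - {sink m} \<longleftrightarrow> c \<in> A ` {1..m - 1} \<union> B ` {1..n}"
      using m by (cases c) (auto simp: sink_def image_iff)
  qed
  then show ?thesis by (simp add: ball_Un)
qed

text \<open>A set \<open>C\<close> with \<open>p\<close> vertices in \<open>A\<close> and
  \<open>q\<close> in \<open>B\<close> violates \<open>parking\<close> iff its members have at least
  \<open>n - q\<close> and \<open>m - p\<close> chips respectively. For given \<open>q\<close> it is
  best to take all eligible \<open>A i\<close>, which number \<open>conf_a q\<close>; enough
  \<open>B j\<close> are then eligible iff \<open>q <= conf_g (conf_a q)\<close>, that is
  \<open>psi q < conf_a q\<close>.\<close>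

lemma parking_iff:
  "parking m n u \<longleftrightarrow> box m n u \<and> (\<forall>q\<in>{1..int n}. conf_a m n u q \<le> psi (conf_g m n u) q)"
proof
  assume park: "parking m n u"
  let ?V = "verts m n - {sink m}"
  have nonneg: "\<forall>i\<in>{1..m - 1}. 0 \<le> u (A i)" "\<forall>j\<in>{1..n}. 0 \<le> u (B j)"
    using park unfolding parking_def ball_nonsink by blast+
  have legal: "\<not> ((\<forall>i\<in>{1..m - 1}. lapset m n C (A i) \<le> u (A i)) \<and> (\<forall>j\<in>{1..n}. lapset m n C (B j) \<le> u (B j)))"
    if "C \<subseteq> ?V" "C \<noteq> {}" for C
  proof -
    have "\<exists>c\<in>?V. u c - lapset m n C c < 0" using park that by (auto simp: parking_def)
    then obtain c where "c \<in> ?V" "\<not> lapset m n C c \<le> u c" by force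
    then have "\<not> (\<forall>c\<in>?V. lapset m n C c \<le> u c)" by blast
    then show ?thesis unfolding ball_nonsink .
  qed
  have ua: "u (A i) < int n" if i: "i \<in> {1..m - 1}" for i
  proof (rule ccontr)
    assume "\<not> ?thesis"
    moreover have "{A i} \<subseteq> ?V" using i m by (auto simp: sink_def)
    moreover from this have "{A i} \<subseteq> verts m n" by auto
    note lapset_eq[OF this]
    ultimately show False using legal[of "{A i}"] nonneg by fastforce
  qed
  have ub: "u (B j) < int m" if j: "j \<in> {1..n}" for j
  proof (rule ccontr)
    assume "\<not> ?thesis"
    moreover have "{B j} \<subseteq> ?V" using j by (auto simp: sink_def)
    moreover from this have "{B j} \<subseteq> verts m n" by auto
    note lapset_eq[OF this]
    ultimately show False using legal[of "{B j}"] nonneg by fastforce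
  qed
  have box: "box m n u" using nonneg ua ub by (simp add: box_def)
  have "conf_a m n u q \<le> psi (conf_g m n u) q" if q: "q \<in> {1..int n}" for q
  proof (rule ccontr)
    assume "\<not> ?thesis"
    then have le: "q \<le> conf_g m n u (conf_a m n u q)" using psi_g_less_iff[OF m n, of u q "conf_a m n u q"] by simp
    define p where "p = conf_a m n u q"
    define CA where "CA = {i \<in> {1..m - 1}. int n - q \<le> u (A i)}"
    define CB where "CB = {j \<in> {1..n}. int m - p \<le> u (B j)}"
    have "(u (A i) + q) div int n = (if int n - q \<le> u (A i) then 1 else 0)" if "i \<in> {1..m - 1}" for i
    proof -
      have "0 \<le> u (A i)" "u (A i) < int n" using box that by (auto simp: box_def)
      then show ?thesis
        using le_div_iff[OF n, of 1 "u (A i)" q] le_div_iff[OF n, of 2 "u (A i)" q]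
          le_div_iff[OF n, of 0 "u (A i)" q] q by auto
    qed
    then have pA: "p = int (card CA)"
      unfolding p_def conf_a_def CA_def by (subst sum_one_if[symmetric]) (auto intro!: sum.cong)
    have "card CA \<le> card {1..m - 1}" unfolding CA_def by (intro card_mono) auto
    then have pm: "0 \<le> p" "p < int m" using pA m by auto
    have "(u (B j) + p) div int m = (if int m - p \<le> u (B j) then 1 else 0)" if "j \<in> {1..n}" for j
    proof -
      have "0 \<le> u (B j)" "u (B j) < int m" using box that by (auto simp: box_def)
      then show ?thesis
        using le_div_iff[OF m, of 1 "u (B j)" p] le_div_iff[OF m, of 2 "u (B j)" p]
          le_div_iff[OF m, of 0 "u (B j)" p] pm by auto
    qed
    then have "conf_g m n u p = int (card CB)"
      unfolding conf_g_def CB_def by (subst sum_one_if[symmetric]) (auto intro!: sum.cong)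
    \<comment> \<open>\<open>CB\<close> may have more than \<open>q\<close> elements; this only
      relaxes the condition on the \<open>A\<close>-side.\<close>
    then have qB: "q \<le> int (card CB)" using le by (simp add: p_def)
    let ?C = "A ` CA \<union> B ` CB"
    have sub: "?C \<subseteq> ?V" using m by (auto simp: CA_def CB_def sink_def)
    then have sub': "?C \<subseteq> verts m n" by auto
    have "{i \<in> {1..m}. A i \<in> ?C} = CA" "{j \<in> {1..n}. B j \<in> ?C} = CB"
      by (auto simp: CA_def CB_def)
    then have lap: "i \<in> {1..m} \<Longrightarrow> lapset m n ?C (A i) = (if i \<in> CA then int n else 0) - int (card CB)"
      "j \<in> {1..n} \<Longrightarrow> lapset m n ?C (B j) = (if j \<in> CB then int m else 0) - p" for i j
      using lapset_eq[OF sub', of i] lapset_eq(2)[OF sub', of j] pA by (auto simp: image_iff)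
    have "CB \<noteq> {}" using qB q by auto
    moreover have "lapset m n ?C (A i) \<le> u (A i)" if "i \<in> {1..m - 1}" for i
    proof -
      have "0 \<le> u (A i)" "i \<in> {1..m}" using nonneg(1) that by auto
      then show ?thesis using lap(1)[of i] that qB by (cases "i \<in> CA") (simp_all add: CA_def)
    qed
    moreover have "lapset m n ?C (B j) \<le> u (B j)" if "j \<in> {1..n}" for j
    proof -
      have "0 \<le> u (B j)" using nonneg(2) that by blast
      then show ?thesis using lap(2)[OF that] pm by (cases "j \<in> CB") (simp_all add: CB_def)
    qed
    ultimately show False using legal[OF sub] by blast
  qed
  then show "box m n u \<and> (\<forall>q\<in>{1..int n}. conf_a m n u q \<le> psi (conf_g m n u) q)" using box by blast
next
  assume R: "box m n u \<and> (\<forall>q\<in>{1..int n}. conf_a m n u q \<le> psi (conf_g m n u) q)"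
  show "parking m n u"
    unfolding parking_def
  proof (intro conjI allI impI)
    show "\<forall>c\<in>verts m n - {sink m}. 0 \<le> u c" using R unfolding ball_nonsink box_def by blast
    fix C assume C: "C \<subseteq> verts m n - {sink m} \<and> C \<noteq> {}"
    show "\<exists>c\<in>verts m n - {sink m}. u c - lapset m n C c < 0"
    proof (rule ccontr)
      assume no: "\<not> ?thesis"
      have "\<forall>c\<in>verts m n - {sink m}. lapset m n C c \<le> u c"
      proof (rule ballI, rule ccontr)
        fix c assume "c \<in> verts m n - {sink m}" "\<not> lapset m n C c \<le> u c"
        moreover from this have "u c - lapset m n C c < 0" by simp
        ultimately show False using no by blast
      qed
      then have legal: "\<forall>i\<in>{1..m - 1}. lapset m n C (A i) \<le> u (A i)" "\<forall>j\<in>{1..n}. lapset m n C (B j) \<le> u (B j)"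
        unfolding ball_nonsink by blast+
      have sub: "C \<subseteq> verts m n" using C by auto
      define q where "q = card {j \<in> {1..n}. B j \<in> C}"
      define p where "p = card {i \<in> {1..m}. A i \<in> C}"
      have "{i \<in> {1..m}. A i \<in> C} = {i \<in> {1..m - 1}. A i \<in> C}"
        using C by (auto simp: sink_def)
      then have p': "p = card {i \<in> {1..m - 1}. A i \<in> C}" by (simp add: p_def)
      have ca: "int n - int q \<le> u (A i)" if "i \<in> {1..m - 1}" "A i \<in> C" for i
        using lapset_eq(1)[OF sub, of i] legal(1) that by (force simp: q_def)
      have cb: "int m - int p \<le> u (B j)" if "j \<in> {1..n}" "B j \<in> C" for j
        using lapset_eq(2)[OF sub, of j] legal(2) that by (force simp: p_def)
      \<comment> \<open>Without vertices in \<open>B\<close>, some \<open>A i\<close> in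
        \<open>C\<close> would hold at least \<open>n\<close> chips, contrary to
        \<open>box\<close>.\<close>
      have "q \<noteq> 0"
      proof
        assume "q = 0"
        then have noB: "\<not> B j \<in> C" if "j \<in> {1..n}" for j using that by (auto simp: q_def)
        obtain c where c: "c \<in> C" "c \<in> verts m n - {sink m}" using C by blast
        show False
        proof (cases c)
          case (A i)
          then have "i \<in> {1..m - 1}" using c by (auto simp: sink_def)
          then show False using ca[of i] R c A \<open>q = 0\<close> by (force simp: box_def)
        next
          case (B j)
          then show False using noB c by auto
        qed
      qed
      have "q \<le> card {1..n}" unfolding q_def by (intro card_mono) auto
      then have q: "int q \<in> {1..int n}" using \<open>q \<noteq> 0\<close> by simp
      have "int p = (\<Sum>i\<in>{1..m - 1}. if A i \<in> C then 1 else 0)"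
        unfolding p' by (rule sum_one_if[symmetric]) simp
      also have "\<dots> \<le> conf_a m n u (int q)"
        unfolding conf_a_def
      proof (rule sum_mono)
        fix i assume i: "i \<in> {1..m - 1}"
        show "(if A i \<in> C then 1 else 0) \<le> (u (A i) + int q) div int n"
          using le_div_iff[OF n, of 1 "u (A i)" "int q"] le_div_iff[OF n, of 0 "u (A i)" "int q"] ca[OF i]
            R i by (auto simp: box_def)
      qed
      finally have pa: "int p \<le> conf_a m n u (int q)" .
      have "int q = (\<Sum>j\<in>{1..n}. if B j \<in> C then 1 else 0)"
        unfolding q_def by (rule sum_one_if[symmetric]) simp
      also have "\<dots> \<le> conf_g m n u (int p)"
        unfolding conf_g_def
      proof (rule sum_mono)
        fix j assume j: "j \<in> {1..n}"
        show "(if B j \<in> C then 1 else 0) \<le> (u (B j) + int p) div int m"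
          using le_div_iff[OF m, of 1 "u (B j)" "int p"] le_div_iff[OF m, of 0 "u (B j)" "int p"] cb[OF j]
            R j by (auto simp: box_def)
      qed
      finally have "psi (conf_g m n u) (int q) < int p" using psi_g_less_iff[OF m n] by blast
      moreover have "conf_a m n u (int q) \<le> psi (conf_g m n u) (int q)" using R q by blast
      ultimately show False using pa by linarith
    qed
  qed
qed

lemma psi_sorted:
  assumes "box m n u" "sorted_conf m n u" "j \<in> {1..n}"
  shows "psi (conf_g m n u) (int (n + 1 - j)) = int m - 1 - u (B j)"
proof (rule psi_eqI[OF conf_g_QP[OF m n]])
  fix r
  have "int (n + 1 - j) \<le> (\<Sum>i\<in>{1..n}. (u (B i) + r) div int m) \<longleftrightarrow> int m - u (B j) \<le> r"
    using assms by (intro sorted_dual[OF m]) (auto simp: box_def sorted_conf_def)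
  then show "int m - 1 - u (B j) < r \<longleftrightarrow> int (n + 1 - j) \<le> conf_g m n u r"
    by (auto simp: conf_g_def)
qed (use m n in auto)

text \<open>\<open>psi_sorted\<close> supplies the values at \<open>1, ..., n\<close>, whereas the
  sum runs over \<open>0, ..., n - 1\<close>; the final \<open>- int m\<close> is
  \<open>psi 0 - psi n\<close>.\<close>

lemma sum_psi:
  assumes "box m n u" "sorted_conf m n u"
  shows "(\<Sum>i<n. psi (conf_g m n u) (int i)) = int n * (int m - 1) - (\<Sum>j\<in>{1..n}. u (B j)) - int m"
proof -
  let ?p = "psi (conf_g m n u)"
  obtain k where k: "n = Suc k" using n by (cases n) auto
  have "?p (0 + int n) = ?p 0 + int m" by (rule QP_plus[OF psi_g_QP[OF m n]])
  moreover have "(\<Sum>i<n. ?p (int i)) = ?p 0 + (\<Sum>i<k. ?p (int (Suc i)))"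
    unfolding k by (subst sum.lessThan_Suc_shift) simp
  moreover have "(\<Sum>i<n. ?p (int (Suc i))) = (\<Sum>i<k. ?p (int (Suc i))) + ?p (int n)"
    unfolding k by simp
  moreover have "(\<Sum>i<n. ?p (int (Suc i))) = (\<Sum>j\<in>{1..n}. int m - 1 - u (B j))"
    unfolding sum_reverse by (intro sum.cong psi_sorted assms) auto
  ultimately show ?thesis by (simp add: sum_subtractf)
qed

lemma sum_conf_f: "(\<Sum>i<n. conf_f m n u (int i)) = (\<Sum>i\<in>{1..m}. u (A i))"
  unfolding conf_f_def by (subst sum.swap) (simp add: hermite[OF n])

text \<open>An identity of Riemann-Roch shape: the two positive parts differ by the sum of
  \<open>f - psi\<close> over a period, which by \<open>hermite\<close> and \<open>sum_psi\<close>
  is degree minus genus plus 1, while the positive part of \<open>f - psi\<close> is the rank plus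
  1.\<close>

lemma genus_crank_degree:
  assumes "is_conf m n u" "box m n u" "sorted_conf m n u"
  shows "int ((m - 1) * (n - 1)) + crank m n u - cdegree m n u =
    int (pos_part n (psi (conf_g m n u)) (conf_f m n u))"
proof -
  let ?f = "conf_f m n u" and ?p = "psi (conf_g m n u)"
  have "int (pos_part n ?f ?p) - int (pos_part n ?p ?f) = (\<Sum>i<n. ?f (int i) - ?p (int i))"
    unfolding pos_part_def of_nat_sum sum_subtractf[symmetric] by (intro sum.cong) auto
  also have "\<dots> = cdegree m n u - int n * (int m - 1) + int m"
    unfolding sum_subtractf sum_conf_f sum_psi[OF assms(2,3)] by (simp add: cdegree_def sum_verts)
  finally have "int (pos_part n ?f ?p) - int (pos_part n ?p ?f) = cdegree m n u - int n * (int m - 1) + int m" .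
  moreover have "int ((m - 1) * (n - 1)) = (int m - 1) * (int n - 1)" using m n by (simp add: of_nat_diff)
  ultimately show ?thesis
    using crank_eq[OF m n assms(1)] by (simp add: excess_def[OF m n] algebra_simps)
qed

end

section \<open>From configurations to pairs of quasi-periodic functions\<close>

definition park_sorted :: "nat \<Rightarrow> nat \<Rightarrow> (vtx \<Rightarrow> int) set" where
  "park_sorted m n = {u. is_conf m n u \<and> parking m n u \<and> sorted_conf m n u}"

text \<open>As \<open>al 0 = 0\<close>, the conditions say that 0 is the last point at which
  \<open>ps\<close> is below \<open>al\<close>. The sink value \<open>\<sigma>\<close> is
  unrestricted.\<close>

definition triples :: "nat \<Rightarrow> nat \<Rightarrow> ((int \<Rightarrow> int) \<times> (int \<Rightarrow> int) \<times> int) set" where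
  "triples m n = {(al, ps, \<sigma>). (al, ps) \<in> Omega m n \<and> ps 0 < 0 \<and> (\<forall>t\<ge>1. al t \<le> ps t)}"

definition to_triple :: "nat \<Rightarrow> nat \<Rightarrow> (vtx \<Rightarrow> int) \<Rightarrow> (int \<Rightarrow> int) \<times> (int \<Rightarrow> int) \<times> int" where
  "to_triple m n u = (conf_a m n u, psi (conf_g m n u), u (A m))"

definition rotate_triple :: "(int \<Rightarrow> int) \<times> (int \<Rightarrow> int) \<times> int \<Rightarrow> (int \<Rightarrow> int) \<times> (int \<Rightarrow> int)" where
  "rotate_triple = (\<lambda>(al, ps, \<sigma>). (\<lambda>t. al (t - \<sigma>) - al (- \<sigma>), \<lambda>t. ps (t - \<sigma>) - al (- \<sigma>)))"

lemma sum_periodic_shift: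
  fixes d :: "int \<Rightarrow> nat"
  assumes "0 < n" "\<And>t. d (t + int n) = d t"
  shows "(\<Sum>i<n. d (int i + s)) = (\<Sum>i<n. d (int i))"
proof -
  obtain k where n: "n = Suc k" using assms(1) by (cases n) auto
  have step: "(\<Sum>i<n. d (int i + (s + 1))) = (\<Sum>i<n. d (int i + s))" for s
  proof -
    have "(\<Sum>i<n. d (int i + s)) = d s + (\<Sum>i<k. d (int i + (s + 1)))"
      unfolding n by (subst sum.lessThan_Suc_shift) (simp add: algebra_simps)
    moreover have "(\<Sum>i<n. d (int i + (s + 1))) = (\<Sum>i<k. d (int i + (s + 1))) + d (s + int n)"
      unfolding n by (simp add: algebra_simps)
    ultimately show ?thesis using assms(2) by simp
  qed
  show ?thesis
  proof (induction s rule: int_induct[where k = 0])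
    case (step2 i) then show ?case using step[of "i - 1"] by simp
  qed (simp_all add: step)
qed

context
  fixes m n :: nat
  assumes m: "0 < m" and n: "0 < n"
begin

text \<open>\<open>ps - al\<close> increases by 1 with each period, so the inequality propagates to
  the right.\<close>

lemma le_from_window:
  assumes "(al, ps) \<in> Omega m n" "\<forall>q\<in>{1..int n}. al q \<le> ps q" "1 \<le> t"
  shows "al t \<le> ps t"
proof -
  note O = OmegaD[OF assms(1)]
  define k where "k = (t - 1) div int n"
  define q where "q = (t - 1) mod int n + 1"
  have "t = q + k * int n" by (simp add: q_def k_def algebra_simps)
  moreover have q: "1 \<le> q" "q \<le> int n"
    using n pos_mod_bound[of "int n" "t - 1"] pos_mod_sign[of "int n" "t - 1"] unfolding q_def by linarith+
  moreover have "0 \<le> k" using assms(3) n by (simp add: k_def pos_imp_zdiv_nonneg_iff)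
  moreover have "al q \<le> ps q" using assms(2) q by simp
  ultimately show ?thesis
    using QP_mult[OF O(1), of q k] QP_mult[OF O(2), of q k] by (simp add: algebra_simps)
qed

lemma to_triple_mem:
  assumes "u \<in> park_sorted m n" shows "to_triple m n u \<in> triples m n"
proof -
  have u: "box m n u" "sorted_conf m n u" "\<forall>q\<in>{1..int n}. conf_a m n u q \<le> psi (conf_g m n u) q"
    using assms parking_iff[OF m n, of u] by (auto simp: park_sorted_def)
  have "conf_a m n u 0 = 0" using u(1) by (simp add: conf_a_def box_def)
  then have O: "(conf_a m n u, psi (conf_g m n u)) \<in> Omega m n"
    using conf_a_QP[OF m n] psi_g_QP[OF m n] by (simp add: Omega_def)
  have "psi (conf_g m n u) (0 + int n) = psi (conf_g m n u) 0 + int m"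
    by (rule QP_plus[OF psi_g_QP[OF m n]])
  \<comment> \<open>This value is at most \<open>m - 1\<close>, so one period earlier
    \<open>psi\<close> is negative.\<close>
  moreover have "psi (conf_g m n u) (int n) = int m - 1 - u (B 1)"
    using psi_sorted[OF m n u(1,2), of 1] n by simp
  moreover have "0 \<le> u (B 1)" using u(1) n by (simp add: box_def)
  ultimately show ?thesis
    using O le_from_window[OF O u(3)] by (simp add: to_triple_def triples_def)
qed

lemma conf_a_sorted:
  assumes "box m n u" "sorted_conf m n u" "i \<in> {1..m - 1}"
  shows "int (m - i) \<le> conf_a m n u s \<longleftrightarrow> int n - u (A i) \<le> s"
proof -
  have "int (m - 1 + 1 - i) \<le> (\<Sum>k\<in>{1..m - 1}. (u (A k) + s) div int n) \<longleftrightarrow> int n - u (A i) \<le> s"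
    using assms by (intro sorted_dual[OF n]) (auto simp: box_def sorted_conf_def)
  then show ?thesis using m by (simp add: conf_a_def)
qed

lemma inj_to_triple: "inj_on (to_triple m n) (park_sorted m n)"
proof (rule inj_onI)
  fix u v assume "u \<in> park_sorted m n" "v \<in> park_sorted m n" and eq: "to_triple m n u = to_triple m n v"
  then have u: "box m n u" "sorted_conf m n u" "is_conf m n u"
    and v: "box m n v" "sorted_conf m n v" "is_conf m n v"
    using parking_iff[OF m n] by (auto simp: park_sorted_def)
  have "u c = v c" for c
  proof (cases c)
    case (A i)
    consider "i \<in> {1..m - 1}" | "i = m" | "i \<notin> {1..m}" using m by force
    then show ?thesis
    proof cases
      case 1
      have "int n - u (vtx.A i) \<le> s \<longleftrightarrow> int n - v (vtx.A i) \<le> s" for s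
        using conf_a_sorted[OF u(1,2) 1, of s] conf_a_sorted[OF v(1,2) 1, of s] eq
        by (simp add: to_triple_def)
      from this[of "int n - u (vtx.A i)"] this[of "int n - v (vtx.A i)"] show ?thesis by (simp add: A)
    next
      case 2
      then show ?thesis using eq by (simp add: to_triple_def A)
    next
      case 3
      then show ?thesis using u(3) v(3) by (simp add: is_conf_def A)
    qed
  next
    case (B j)
    show ?thesis
    proof (cases "j \<in> {1..n}")
      case True
      then show ?thesis
        using psi_sorted[OF m n u(1,2) True] psi_sorted[OF m n v(1,2) True] eq by (simp add: to_triple_def B)
    next
      case False
      then show ?thesis using u(3) v(3) by (simp add: is_conf_def B)
    qed
  qed
  then show "u = v" by (rule ext)
qed

lemma surj_to_triple:
  assumes "(al, ps, \<sigma>) \<in> triples m n" shows "\<exists>u\<in>park_sorted m n. to_triple m n u = (al, ps, \<sigma>)"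
proof -
  have O: "(al, ps) \<in> Omega m n" and neg: "ps 0 < 0" and le: "\<And>t. 1 \<le> t \<Longrightarrow> al t \<le> ps t"
    using assms by (auto simp: triples_def)
  note al = OmegaD(1)[OF O] and ps = OmegaD(2)[OF O] and al0 = OmegaD(3)[OF O]
  have aln: "al (int n) = int m - 1" using QP_plus[OF al, of 0] al0 by simp
  have psn: "ps (int n) = ps 0 + int m" using QP_plus[OF ps, of 0] by simp
  \<comment> \<open>Forced by \<open>conf_a_sorted\<close>: \<open>n - x i\<close> is the least
    \<open>s\<close> with \<open>m - i <= al s\<close>. The \<open>B\<close>-entries below are
    likewise forced by \<open>psi_sorted\<close>.\<close>
  define x where "x = (\<lambda>i. int n - 1 - psi al (int (m - i)))"
  define u where "u = (\<lambda>c. case c of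
      A i \<Rightarrow> if i = m then \<sigma> else if i \<in> {1..m} then x i else 0
    | B j \<Rightarrow> if j \<in> {1..n} then int m - 1 - ps (int (n + 1 - j)) else 0)"
  have uA: "u (A i) = x i" if "i \<in> {1..m - 1}" for i using that by (auto simp: u_def)
  have uB: "u (B j) = int m - 1 - ps (int (n + 1 - j))" if "j \<in> {1..n}" for j using that by (simp add: u_def)
  have um: "u (A m) = \<sigma>" by (simp add: u_def)
  \<comment> \<open>For \<open>m = 1\<close> the function \<open>al\<close> is constant and has no
    such inverse, but then no \<open>A i\<close> besides the sink exists.\<close>
  have psi_al: "psi al t < r \<longleftrightarrow> t \<le> al r" if "1 < m" for t r
    using psi_less_iff[OF al, of t r] that n by simp
  have "is_conf m n u" using m by (auto simp: is_conf_def u_def split: vtx.splits)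
  have box: "box m n u"
    unfolding box_def
  proof (intro conjI ballI)
    fix i assume i: "i \<in> {1..m - 1}"
    then have m1: "1 < m" by auto
    have "psi al (int (m - i)) < int n" "\<not> psi al (int (m - i)) < 0"
      unfolding psi_al[OF m1] aln al0 using i by (auto simp: of_nat_diff)
    then show "0 \<le> u (A i)" "u (A i) < int n" using uA[OF i] by (simp_all add: x_def)
  next
    fix j assume j: "j \<in> {1..n}"
    have "al 0 \<le> al (int (n + 1 - j))" by (rule QP_mono[OF al]) simp
    also have "\<dots> \<le> ps (int (n + 1 - j))" using j by (intro le) auto
    finally have "0 \<le> ps (int (n + 1 - j))" using al0 by simp
    moreover have "ps (int (n + 1 - j)) \<le> ps (int n)" using j by (intro QP_mono[OF ps]) auto
    ultimately show "0 \<le> u (B j)" "u (B j) < int m" using uB[OF j] psn neg by simp_all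
  qed
  have sorted: "sorted_conf m n u"
    unfolding sorted_conf_def
  proof (intro conjI allI impI)
    fix i j assume ij: "1 \<le> i \<and> i \<le> j \<and> j \<le> m - 1"
    then have m1: "1 < m" by auto
    have "psi al (int (m - j)) \<le> psi al (int (m - i))"
    proof -
      have "int (m - i) \<le> al (psi al (int (m - i)) + 1)"
        using psi_al[OF m1, of "int (m - i)" "psi al (int (m - i)) + 1"] by simp
      moreover have "int (m - j) \<le> int (m - i)" using ij by (simp add: diff_le_mono2)
      ultimately have "int (m - j) \<le> al (psi al (int (m - i)) + 1)" by (rule order_trans[rotated])
      then have "psi al (int (m - j)) < psi al (int (m - i)) + 1"
        using psi_al[OF m1, of "int (m - j)" "psi al (int (m - i)) + 1"] by simp
      then show ?thesis by simp
    qed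
    then show "u (A i) \<le> u (A j)" using uA ij by (simp add: x_def)
  next
    fix i j assume ij: "1 \<le> i \<and> i \<le> j \<and> j \<le> n"
    then have "ps (int (n + 1 - j)) \<le> ps (int (n + 1 - i))" by (intro QP_mono[OF ps]) auto
    then show "u (B i) \<le> u (B j)" using uB ij by simp
  qed
  have psi_q: "psi (conf_g m n u) (int q) = ps (int q)" if "q \<in> {1..n}" for q
  proof -
    have *: "n + 1 - q \<in> {1..n}" "n + 1 - (n + 1 - q) = q" using that by auto
    show ?thesis using psi_sorted[OF m n box sorted *(1)] uB[OF *(1)] unfolding *(2) by simp
  qed
  have "psi (conf_g m n u) = ps"
  proof (rule QP_eqI[OF psi_g_QP[OF m n] ps n])
    fix t :: int assume t: "0 \<le> t" "t < int n"
    show "psi (conf_g m n u) t = ps t"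
    proof (cases "t = 0")
      case True
      then show ?thesis using psi_q[of n] n QP_plus[OF psi_g_QP[OF m n], of u 0] psn by simp
    next
      case False
      then have "1 \<le> nat t" "nat t \<le> n" using t by linarith+
      then show ?thesis using psi_q[of "nat t"] t by simp
    qed
  qed
  moreover have "conf_a m n u = al"
  proof (rule QP_eqI[OF conf_a_QP[OF m n] al n])
    fix t :: int assume t: "0 \<le> t" "t < int n"
    let ?a = "conf_a m n u"
    \<comment> \<open>On the window both functions take values in \<open>0, ..., m - 1\<close>, so
      they agree once all thresholds \<open>k\<close> from \<open>1\<close> to \<open>m - 1\<close>
      agree.\<close>
    have iff: "k \<le> ?a t \<longleftrightarrow> k \<le> al t" if "1 \<le> k" "k \<le> int m - 1" for k
    proof -
      define i where "i = m - nat k"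
      have k: "nat k \<le> m - 1" "1 \<le> nat k" using that m by linarith+
      then have "1 \<le> i" "i \<le> m - 1" "m - i = nat k" unfolding i_def using m by linarith+
      then have i: "i \<in> {1..m - 1}" "int (m - i) = k" using that by simp_all
      then have m1: "1 < m" by auto
      have "k \<le> ?a t \<longleftrightarrow> int n - u (A i) \<le> t" using conf_a_sorted[OF box sorted i(1)] i(2) by simp
      also have "\<dots> \<longleftrightarrow> psi al k < t" using uA[OF i(1)] i(2) by (auto simp: x_def)
      finally show ?thesis using psi_al[OF m1] by simp
    qed
    have "?a 0 = 0" using box by (simp add: conf_a_def box_def)
    then have "0 \<le> ?a t" "?a t \<le> int m - 1"
      using QP_mono[OF conf_a_QP[OF m n], of 0 t u] QP_mono[OF conf_a_QP[OF m n], of t "0 + int n" u]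
        QP_plus[OF conf_a_QP[OF m n], of u 0] t by simp_all
    moreover have "0 \<le> al t" "al t \<le> int m - 1"
      using QP_mono[OF al, of 0 t] QP_mono[OF al, of t "int n"] aln al0 t by simp_all
    ultimately show "?a t = al t"
      using iff[of "?a t"] iff[of "al t"] by (cases "1 \<le> ?a t"; cases "1 \<le> al t") simp_all
  qed
  ultimately have "to_triple m n u = (al, ps, \<sigma>)" by (simp add: to_triple_def um)
  moreover from this have "parking m n u"
    unfolding parking_iff[OF m n] using box le by (simp add: to_triple_def)
  ultimately show ?thesis using \<open>is_conf m n u\<close> sorted by (auto simp: park_sorted_def)
qed

lemma bij_betw_to_triple: "bij_betw (to_triple m n) (park_sorted m n) (triples m n)"
proof (rule bij_betw_imageI[OF inj_to_triple], rule subset_antisym)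
  show "to_triple m n ` park_sorted m n \<subseteq> triples m n" using to_triple_mem by blast
  show "triples m n \<subseteq> to_triple m n ` park_sorted m n"
  proof
    fix z assume "z \<in> triples m n"
    moreover obtain al ps \<sigma> where "z = (al, ps, \<sigma>)" by (metis prod.collapse)
    ultimately show "z \<in> to_triple m n ` park_sorted m n" using surj_to_triple by (metis imageI)
  qed
qed

text \<open>The shift is recovered as the last point at which the second function is below the first one.\<close>
lemma bij_betw_rotate: "bij_betw rotate_triple (triples m n) (Omega m n)"
proof (rule bij_betw_imageI)
  show "inj_on rotate_triple (triples m n)"
  proof (rule inj_onI)
    fix x y assume xy: "x \<in> triples m n" "y \<in> triples m n" and eq: "rotate_triple x = rotate_triple y"
    obtain al ps \<sigma> where x: "x = (al, ps, \<sigma>)" by (metis prod.collapse)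
    obtain al' ps' \<tau> where y: "y = (al', ps', \<tau>)" by (metis prod.collapse)
    have a: "al (t - \<sigma>) - al (- \<sigma>) = al' (t - \<tau>) - al' (- \<tau>)"
      and p: "ps (t - \<sigma>) - al (- \<sigma>) = ps' (t - \<tau>) - al' (- \<tau>)" for t
      using eq by (auto simp: x y rotate_triple_def fun_eq_iff)
    have X: "al 0 = 0" "ps 0 < 0" "\<And>t. 1 \<le> t \<Longrightarrow> al t \<le> ps t"
      using xy(1) by (auto simp: x triples_def Omega_def)
    have Y: "al' 0 = 0" "ps' 0 < 0" "\<And>t. 1 \<le> t \<Longrightarrow> al' t \<le> ps' t"
      using xy(2) by (auto simp: y triples_def Omega_def)
    \<comment> \<open>At \<open>\<sigma>\<close> the first rotated pair still has a negative gap,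
      while the second has none beyond \<open>\<tau>\<close>.\<close>
    have "\<not> \<tau> < \<sigma>" using a[of \<sigma>] p[of \<sigma>] X(1,2) Y(3)[of "\<sigma> - \<tau>"] by auto
    moreover have "\<not> \<sigma> < \<tau>" using a[of \<tau>] p[of \<tau>] Y(1,2) X(3)[of "\<tau> - \<sigma>"] by auto
    ultimately have s: "\<sigma> = \<tau>" by simp
    have c: "al (- \<sigma>) = al' (- \<sigma>)" using a[of \<sigma>] X(1) Y(1) s by simp
    have "al t = al' t" "ps t = ps' t" for t
      using a[of "t + \<sigma>"] p[of "t + \<sigma>"] c s by simp_all
    then show "x = y" using s by (simp add: x y fun_eq_iff)
  qed
  show "rotate_triple ` triples m n = Omega m n"
  proof (intro set_eqI iffI)
    fix z assume "z \<in> rotate_triple ` triples m n"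
    then obtain al ps \<sigma> where z: "z = rotate_triple (al, ps, \<sigma>)" "(al, ps) \<in> Omega m n"
      by (auto simp: triples_def)
    note O = OmegaD[OF z(2)]
    show "z \<in> Omega m n"
      using QP_translate[OF O(1), of "- \<sigma>" "al (- \<sigma>)"] QP_translate[OF O(2), of "- \<sigma>" "al (- \<sigma>)"]
      by (simp add: z(1) rotate_triple_def Omega_def)
  next
    fix z assume zO: "z \<in> Omega m n"
    obtain al ps where z: "z = (al, ps)" by (cases z)
    note O = OmegaD[OF zO[unfolded z]]
    \<comment> \<open>The gap is \<open>t div n\<close> up to a bounded error. The bounds confine
      its negative points beyond \<open>?L\<close> to a finite non-empty set, so a last one
      exists.\<close>
    define K where "K = al (int n) - ps 0"
    have lb: "t div int n - K \<le> ps t - al t" and ub: "ps t - al t \<le> t div int n + (ps (int n) - al 0)" for t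
    proof -
      have t: "0 \<le> t mod int n" "t mod int n \<le> int n" using n by (auto simp: less_imp_le)
      have "ps t - al t = ps (t mod int n) - al (t mod int n) + t div int n"
        using QP_mod[OF O(1), of t] QP_mod[OF O(2), of t] by (simp add: algebra_simps)
      moreover have "ps 0 \<le> ps (t mod int n)" "al (t mod int n) \<le> al (int n)"
        "al 0 \<le> al (t mod int n)" "ps (t mod int n) \<le> ps (int n)"
        using t by (auto intro: QP_mono[OF O(1)] QP_mono[OF O(2)])
      ultimately show "t div int n - K \<le> ps t - al t" "ps t - al t \<le> t div int n + (ps (int n) - al 0)"
        by (simp_all add: K_def)
    qed
    let ?L = "- (1 + \<bar>ps (int n) - al 0\<bar>) * int n" and ?M = "\<bar>K\<bar> * int n"
    have L: "ps ?L < al ?L" using ub[of ?L] n by (simp del: mult_minus_left)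
    have M: "\<not> ps t < al t" if "?M \<le> t" for t
    proof -
      have "(?M) div int n \<le> t div int n" using that n by (intro zdiv_mono1) auto
      then show ?thesis using lb[of t] n by simp
    qed
    define S where "S = {t \<in> {?L..?M}. ps t < al t}"
    have "?L \<le> ?M" using L M[of ?L] by force
    then have "?L \<in> S" using L by (simp add: S_def)
    define \<sigma> where "\<sigma> = Max S"
    have "finite S"
      by (rule finite_subset[OF _ finite_atLeastAtMost_int[of ?L ?M]]) (unfold S_def, blast)
    then have \<sigma>: "\<sigma> \<in> S" "\<And>t. t \<in> S \<Longrightarrow> t \<le> \<sigma>" using Max_in[of S] Max_ge[of S] \<open>?L \<in> S\<close> unfolding \<sigma>_def by blast+
    have neg: "ps \<sigma> < al \<sigma>" using \<sigma>(1) by (simp add: S_def)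
    have pos: "al t \<le> ps t" if "\<sigma> < t" for t
    proof (rule ccontr)
      assume "\<not> ?thesis"
      then have "ps t < al t" by simp
      then have "t \<le> ?M" using M[of t] by force
      then have "t \<in> S" using \<open>ps t < al t\<close> that \<sigma>(1) by (auto simp: S_def)
      then show False using \<sigma>(2) that by force
    qed
    let ?x = "(\<lambda>t. al (t + \<sigma>) - al \<sigma>, \<lambda>t. ps (t + \<sigma>) - al \<sigma>, \<sigma>)"
    have "?x \<in> triples m n"
      using QP_translate[OF O(1), of \<sigma> "al \<sigma>"] QP_translate[OF O(2), of \<sigma> "al \<sigma>"] neg pos
      by (simp add: triples_def Omega_def)
    moreover have "rotate_triple ?x = z" using O(3) by (simp add: rotate_triple_def z)
    ultimately show "z \<in> rotate_triple ` triples m n" by (metis imageI)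
  qed
qed

text \<open>On the window from \<open>- u (A m)\<close> to \<open>n - 1 - u (A m)\<close> the
  quotient of the sink vanishes, so \<open>conf_a\<close> and \<open>conf_f\<close> agree there;
  this is why the translation is by the sink value. As \<open>conf_f - psi\<close> is periodic, any
  window gives the same sum.\<close>

lemma rotate_weights:
  assumes "u \<in> park_sorted m n" "rotate_triple (to_triple m n u) = (al, ps)"
  shows "pos_part n al ps = excess m n u"
    and "pos_part n ps al = pos_part n (psi (conf_g m n u)) (conf_f m n u)"
proof -
  let ?f = "conf_f m n u" and ?p = "psi (conf_g m n u)" and ?s = "u (A m)"
  have f: "?f (int i - ?s) = conf_a m n u (int i - ?s)" if "i < n" for i
    using that by (simp add: conf_f_conf_a[OF m n])
  have al: "al (int i) = ?f (int i - ?s) - conf_a m n u (- ?s)" if "i < n" for i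
    using assms(2) f[OF that] by (auto simp: rotate_triple_def to_triple_def)
  have ps: "ps (int i) = ?p (int i - ?s) - conf_a m n u (- ?s)" for i
    using assms(2) by (auto simp: rotate_triple_def to_triple_def)
  have "pos_part n al ps = (\<Sum>i<n. nat (?f (int i + - ?s) - ?p (int i + - ?s)))"
    unfolding pos_part_def by (intro sum.cong) (auto simp: al ps)
  also have "\<dots> = pos_part n ?f ?p"
    unfolding pos_part_def
    by (rule sum_periodic_shift[OF n, of "\<lambda>t. nat (?f t - ?p t)"])
       (simp add: QP_plus[OF conf_f_QP[OF m n]] QP_plus[OF psi_g_QP[OF m n]])
  finally show "pos_part n al ps = excess m n u" by (simp add: excess_def[OF m n])
  have "pos_part n ps al = (\<Sum>i<n. nat (?p (int i + - ?s) - ?f (int i + - ?s)))"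
    unfolding pos_part_def by (intro sum.cong) (auto simp: al ps)
  also have "\<dots> = pos_part n ?p ?f"
    unfolding pos_part_def
    by (rule sum_periodic_shift[OF n, of "\<lambda>t. nat (?p t - ?f t)"])
       (simp add: QP_plus[OF conf_f_QP[OF m n]] QP_plus[OF psi_g_QP[OF m n]])
  finally show "pos_part n ps al = pos_part n ?p ?f" .
qed

lemma Kcoeff_eq:
  "Kcoeff m n a b = int (card {(al, ps) \<in> Omega m n. pos_part n ps al = a \<and> pos_part n al ps = b})"
proof -
  let ?h = "rotate_triple \<circ> to_triple m n"
  let ?S = "{u \<in> park_sorted m n. int ((m - 1) * (n - 1)) + crank m n u - cdegree m n u = int a \<and>
      crank m n u + 1 = int b}"
  let ?T = "{(al, ps) \<in> Omega m n. pos_part n ps al = a \<and> pos_part n al ps = b}"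
  have bij: "bij_betw ?h (park_sorted m n) (Omega m n)"
    by (rule bij_betw_trans[OF bij_betw_to_triple bij_betw_rotate])
  have iff: "u \<in> ?S \<longleftrightarrow> ?h u \<in> ?T" if u: "u \<in> park_sorted m n" for u
  proof -
    obtain al ps where z: "?h u = (al, ps)" by (cases "?h u")
    have O: "(al, ps) \<in> Omega m n" using bij_betwE[OF bij] u z by metis
    have c: "is_conf m n u" "box m n u" "sorted_conf m n u"
      using u parking_iff[OF m n] by (auto simp: park_sorted_def)
    have r: "rotate_triple (to_triple m n u) = (al, ps)" using z by simp
    have e: "int ((m - 1) * (n - 1)) + crank m n u - cdegree m n u = int (pos_part n ps al)"
      "crank m n u + 1 = int (pos_part n al ps)"
      unfolding genus_crank_degree[OF m n c] rotate_weights[OF u r] by (simp_all add: crank_eq[OF m n c(1)])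
    have "u \<in> ?S \<longleftrightarrow> pos_part n ps al = a \<and> pos_part n al ps = b"
      unfolding mem_Collect_eq e of_nat_eq_iff using u by blast
    also have "\<dots> \<longleftrightarrow> ?h u \<in> ?T" using O unfolding z by simp
    finally show ?thesis .
  qed
  have "bij_betw ?h ?S ?T"
  proof (rule bij_betw_imageI)
    have "?S \<subseteq> park_sorted m n" by (rule Collect_restrict)
    then show "inj_on ?h ?S" using bij_betw_imp_inj_on[OF bij] by (rule inj_on_subset[rotated])
    show "?h ` ?S = ?T"
    proof (intro set_eqI iffI)
      fix z assume "z \<in> ?h ` ?S"
      then obtain u where u: "u \<in> ?S" "z = ?h u" by (rule imageE)
      then have "u \<in> park_sorted m n" by simp
      from iff[OF this] u show "z \<in> ?T" by simp
    next
      fix z assume z: "z \<in> ?T"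
      then have "z \<in> Omega m n" by auto
      then obtain u where u: "u \<in> park_sorted m n" "z = ?h u"
        using bij_betw_imp_surj_on[OF bij] by blast
      then have "u \<in> ?S" using iff[OF u(1)] z by simp
      then show "z \<in> ?h ` ?S" by (rule rev_image_eqI) (rule u(2))
    qed
  qed
  then have "card ?S = card ?T" by (rule bij_betw_same_card)
  moreover have "?S = {u. is_conf m n u \<and> parking m n u \<and> sorted_conf m n u \<and>
      int ((m - 1) * (n - 1)) + crank m n u - cdegree m n u = int a \<and> crank m n u + 1 = int b}"
    by (auto simp: park_sorted_def)
  ultimately show ?thesis by (simp add: Kcoeff_def)
qed

end

lemma Fser_eq: "Fser = gf qwt qpairs"
proof (rule ps4_eqI)
  fix a b m n
  let ?T = "{(al, ps) \<in> Omega m n. pos_part n ps al = a \<and> pos_part n al ps = b}"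
  have "{s \<in> qpairs. qwt s = (a, b, m, n)} = (if m \<ge> 1 \<and> n \<ge> 1 then (\<lambda>z. (m, n, z)) ` ?T else {})"
    by (auto simp: qpairs_def qwt_def)
  then have "card {s \<in> qpairs. qwt s = (a, b, m, n)} = (if m \<ge> 1 \<and> n \<ge> 1 then card ?T else 0)"
    by (simp add: card_image inj_on_def)
  then show "fps_nth (fps_nth (fps_nth (fps_nth Fser n) m) b) a =
      fps_nth (fps_nth (fps_nth (fps_nth (gf qwt qpairs) n) m) b) a"
    using Kcoeff_eq[of m n a b] by (simp add: Fser_def Suc_le_eq)
qed

text \<open>The quotient is stated with denominators cleared. Each factor of the denominator has
  constant coefficient 1, because polyominoes have positive width, and is therefore
  invertible.\<close>

theorem theorem15p2:
  shows "Fser * ((1 - X4) * (1 - Y4) * (1 - H4 - W4 - Px - Py))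
           = (1 - X4 * Y4) * (H4 * W4 - Px * Py)"
  unfolding Fser_eq by (rule gf_qpairs)

end
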